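(* Let $\Lambda\subset\mathbb{R}^d$ be compact and let $\mathcal{F}$ be a system of random curves in $\Lambda$ with variable short-distance cutoff, described by probability measures $\{\mu_\delta\}_{0<\delta\le1}$ on $\Omega_\Lambda$. Assume that there exist $\sigma>0$, $\rho<1$ and a constant $K<\infty$ such that for every $\delta$, every $k$, and every collection of $k$ well separated cylinders $A_1,\dots,A_k$ of aspect ratio $\sigma$ and lengths $\ell_1,\dots,\ell_k\ge\delta$, $$\mathrm{Prob}_\delta\big(\text{each } A_j \text{ is traversed (in the long direction) by a curve in } \mathcal{F}_\delta\big)\ \le\ K\rho^k .$$ Then there exists $d_{\min}>1$ such that for any fixed $r>0$ and $s<d_{\min}$ the random variable $$T_{s,r;\delta}(\omega)\ :=\ \inf_{\mathcal{C}\in\mathcal{F}_\delta(\omega):\ \mathrm{diam}(\mathcal{C})\ge r}\mathrm{Cap}_{s;\delta}(\mathcal{C})$$ stays stochastically bounded away from zero as $\delta\to0$. Furthermore, any scaling limit $\mu=\lim_{\delta_n\to0}\mu_{\delta_n}$ of the measures $\mu_\delta$ is supported on configurations containing only curves $\mathcal{C}$ with $$\dim_{\mathcal{H}}\mathcal{C}\ \ge\ d_{\min}\ (>1).$$ In particular, the scaling limit contains no rectifiable curves.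
   Context: Curves: a curve in a closed set $\Lambda\subset\mathbb{R}^d$ is an equivalence class of continuous functions $f:[0,1]\to\Lambda$, where $f_1,f_2$ represent the same curve iff there are monotone continuous bijections $\phi_1,\phi_2:[0,1]\to[0,1]$ with $f_1\circ\phi_1=f_2\circ\phi_2$. $\mathrm{diam}$, $\dim_{\mathcal{H}}$ (Hausdorff dimension) and $\mathrm{Cap}$ of a curve refer to its image. $\mathcal{S}_\Lambda$ is the space of curves in $\Lambda$, with the metric $\mathrm{d}(\mathcal{C}_1,\mathcal{C}_2)=\inf_{\phi_1,\phi_2}\sup_{t\in[0,1]}|f_1(\phi_1(t))-f_2(\phi_2(t))|$, where $f_i$ is any continuous function representing $\mathcal{C}_i$ and the infimum is over all strictly monotone continuous functions of $[0,1]$ onto itself. $\Omega_\Lambda$ is the space of closed subsets (configurations) of $\mathcal{S}_\Lambda$, with the Hausdorff metric. A system of random curves in $\Lambda$ with variable short-distance cutoff is a collection of probability measures $\{\mu_\delta(d\mathcal{F}_\delta)\}_{0<\delta\le1}$ on $\Omega_\Lambda$, where $\mu_\delta$ describes random closed sets of curves $\mathcal{F}_\delta(\omega)\subset\mathcal{S}_\Lambda$ consisting of polygonal paths of step size $\delta$. $\mathrm{Prob}_\delta$ denotes probability with respect to $\mu_\delta$. A scaling limit is a limit, in the sense of weak convergence of probability measures on $\Omega_\Lambda$, along some sequence $\delta_n\to0$. A collection of sets $\{A_j\}$ is well separated if the distance of each $A_j$ to the other sets $\{A_i\}_{i\ne j}$ is at least as large as the diameter of $A_j$. The aspect ratio of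 a cylinder is the ratio of its length to its cross-sectional diameter. Capacity: for $s>0$, $\ell\ge0$ and $A\subset\mathbb{R}^d$, $$\frac1{\mathrm{Cap}_{s;\ell}(A)}=\inf_{\mu\ge0,\ \int_Ad\mu=1}\iint_{A\times A}\frac{\mu(dx)\,\mu(dy)}{\max\{|x-y|,\ell\}^s}.$$ A random variable $X$ with versions $X_\delta$, $0<\delta\le1$, is stochastically bounded for $\delta\to0$ if for every $\varepsilon>0$ there is $u<\infty$ such that $\mathrm{Prob}_\delta(|X_\delta(\omega)|\ge u)\le\varepsilon$ uniformly in $\delta$; it is stochastically bounded away from zero if its inverse is stochastically bounded.
   Formalization: The dimension bound and non-rectifiability in the scaling limit are asserted for curves of positive diameter only; constant curves must be excluded, since a single deterministic segment of length δ satisfies the hypothesis and converges to a one-point curve of dimension 0. *)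

theory Defs
  imports "HOL-Probability.Probability"
begin

section \<open>Curves\<close>

text \<open>Reparametrisations are the monotone continuous bijections of the unit interval.  They may
  reverse the orientation, and they are the same thing as the strictly monotone continuous
  functions of the unit interval onto itself.\<close>

definition reparams :: "(real \<Rightarrow> real) set" where
  "reparams = {\<phi>. continuous_on {0..1} \<phi> \<and> bij_betw \<phi> {0..1} {0..1} \<and>
                  (mono_on {0..1} \<phi> \<or> antimono_on {0..1} \<phi>)}"

definition paths_in :: "'a::metric_space set \<Rightarrow> (real \<Rightarrow> 'a) set" where
  "paths_in \<Lambda> = {f. path f \<and> path_image f \<subseteq> \<Lambda>}"

definition same_curve :: "'a::metric_space set \<Rightarrow> ((real \<Rightarrow> 'a) \<times> (real \<Rightarrow> 'a)) set" where
  "same_curve \<Lambda> = {(f, g). f \<in> paths_in \<Lambda> \<and> g \<in> paths_in \<Lambda> \<and>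
     (\<exists>\<phi>\<in>reparams. \<exists>\<psi>\<in>reparams. \<forall>t\<in>{0..1}. f (\<phi> t) = g (\<psi> t))}"

type_synonym 'a curve = "(real \<Rightarrow> 'a) set"

text \<open>Values outside the unit interval are irrelevant for the equivalence.\<close>

definition curves :: "'a::metric_space set \<Rightarrow> 'a curve set" where
  "curves \<Lambda> = paths_in \<Lambda> // same_curve \<Lambda>"

definition curve_rep :: "'a curve \<Rightarrow> real \<Rightarrow> 'a" where
  "curve_rep C = (SOME f. f \<in> C)"

definition curve_image :: "'a::metric_space curve \<Rightarrow> 'a set" where
  "curve_image C = path_image (curve_rep C)"

definition param_dist :: "(real \<Rightarrow> 'a::metric_space) \<Rightarrow> (real \<Rightarrow> 'a) \<Rightarrow> real" where
  "param_dist f g = (INF (\<phi>, \<psi>) \<in> reparams \<times> reparams. SUP t\<in>{0..1}. dist (f (\<phi> t)) (g (\<psi> t)))"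

text \<open>This is only a pseudometric on \<^term>\<open>curves \<Lambda>\<close>: a curve and the same curve with pauses
  inserted are at distance zero, though not related by bijective reparametrisations.  A closed
  set of curves contains either all or none of the curves at mutual distance zero, so such
  curves are identified in everything below.\<close>

definition curve_dist :: "'a::metric_space curve \<Rightarrow> 'a curve \<Rightarrow> real" where
  "curve_dist C D = param_dist (curve_rep C) (curve_rep D)"

lemma reparams_id: "(\<lambda>t. t) \<in> reparams"
  by (auto simp: reparams_def monotone_on_def bij_betw_def)

lemma reparams_image: "\<phi> \<in> reparams \<Longrightarrow> \<phi> ` {0..1} = {0..1}"
  by (auto simp: reparams_def bij_betw_def)

lemma reparams_in: "\<phi> \<in> reparams \<Longrightarrow> t \<in> {0..1} \<Longrightarrow> \<phi> t \<in> {0..1}"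
  using reparams_image by blast

lemma reparams_comp:
  assumes p: "\<phi> \<in> reparams" and q: "\<psi> \<in> reparams"
  shows "\<phi> \<circ> \<psi> \<in> reparams"
proof -
  have c: "continuous_on {0..1} (\<phi> \<circ> \<psi>)"
    using p q by (intro continuous_on_compose) (auto simp: reparams_def bij_betw_def)
  have b: "bij_betw (\<phi> \<circ> \<psi>) {0..1} {0..1}"
    using p q by (auto simp: reparams_def intro: bij_betw_trans)
  have in01: "\<And>t. t \<in> {0..1} \<Longrightarrow> \<psi> t \<in> {0..1}"
    using q reparams_in by blast
  have "mono_on {0..1} (\<phi> \<circ> \<psi>) \<or> antimono_on {0..1} (\<phi> \<circ> \<psi>)"
    using p q in01 unfolding reparams_def monotone_on_def mem_Collect_eq comp_def by meson
  with c b show ?thesis by (simp add: reparams_def)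
qed

lemma reparams_inv:
  assumes p: "\<phi> \<in> reparams"
  shows "inv_into {0..1} \<phi> \<in> reparams"
proof -
  let ?g = "inv_into {0..1} \<phi>"
  have bij: "bij_betw \<phi> {0..1} {0..1}" and cont: "continuous_on {0..1} \<phi>"
    using p by (auto simp: reparams_def)
  have b: "bij_betw ?g {0..1} {0..1}"
    using bij by (rule bij_betw_inv_into)
  have c: "continuous_on {0..1} ?g"
    using continuous_on_inv[OF cont compact_Icc, of ?g] bij by (auto simp: bij_betw_def)
  have fg: "\<phi> (?g y) = y" if "y \<in> {0..1}" for y
    using bij that by (rule bij_betw_inv_into_right)
  have gin: "?g y \<in> {0..1}" if "y \<in> {0..1}" for y
    using b that by (auto simp: bij_betw_def)
  consider "mono_on {0..1} \<phi>" | "antimono_on {0..1} \<phi>"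
    using p by (auto simp: reparams_def)
  then have "mono_on {0..1} ?g \<or> antimono_on {0..1} ?g"
  proof cases
    case 1
    have "mono_on {0..1} ?g"
    proof (rule monotone_onI, rule ccontr)
      fix x y :: real assume xy: "x \<in> {0..1}" "y \<in> {0..1}" "x \<le> y" "\<not> ?g x \<le> ?g y"
      then have "\<phi> (?g y) \<le> \<phi> (?g x)"
        using monotone_onD[OF 1 gin gin, of y x] by simp
      then have "x = y" using fg xy by simp
      with xy show False by simp
    qed
    then show ?thesis ..
  next
    case 2
    have "antimono_on {0..1} ?g"
    proof (rule monotone_onI, rule ccontr)
      fix x y :: real assume xy: "x \<in> {0..1}" "y \<in> {0..1}" "x \<le> y" "\<not> ?g y \<le> ?g x"
      then have "\<phi> (?g y) \<le> \<phi> (?g x)"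
        using monotone_onD[OF 2 gin gin, of x y] by simp
      then have "x = y" using fg xy by simp
      with xy show False by simp
    qed
    then show ?thesis ..
  qed
  with b c show ?thesis by (simp add: reparams_def)
qed

lemma same_curve_iff:
  "(f, g) \<in> same_curve \<Lambda> \<longleftrightarrow>
     f \<in> paths_in \<Lambda> \<and> g \<in> paths_in \<Lambda> \<and> (\<exists>\<phi>\<in>reparams. \<forall>t\<in>{0..1}. f t = g (\<phi> t))"
proof
  assume "(f, g) \<in> same_curve \<Lambda>"
  then obtain \<phi> \<psi> where *: "f \<in> paths_in \<Lambda>" "g \<in> paths_in \<Lambda>" "\<phi> \<in> reparams" "\<psi> \<in> reparams"
    "\<forall>t\<in>{0..1}. f (\<phi> t) = g (\<psi> t)" by (auto simp: same_curve_def)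
  let ?i = "inv_into {0..1} \<phi>"
  have i: "?i \<in> reparams" using *(3) by (rule reparams_inv)
  have "f t = g ((\<psi> \<circ> ?i) t)" if t: "t \<in> {0..1}" for t
  proof -
    have "\<phi> (?i t) = t" using *(3) t by (auto simp: reparams_def bij_betw_inv_into_right)
    then show ?thesis using *(5) reparams_in[OF i t] by (metis comp_apply)
  qed
  then show "f \<in> paths_in \<Lambda> \<and> g \<in> paths_in \<Lambda> \<and> (\<exists>\<phi>\<in>reparams. \<forall>t\<in>{0..1}. f t = g (\<phi> t))"
    using * reparams_comp[OF *(4) i] by blast
next
  assume "f \<in> paths_in \<Lambda> \<and> g \<in> paths_in \<Lambda> \<and> (\<exists>\<phi>\<in>reparams. \<forall>t\<in>{0..1}. f t = g (\<phi> t))"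
  then show "(f, g) \<in> same_curve \<Lambda>"
    using reparams_id by (fastforce simp: same_curve_def)
qed

lemma equiv_same_curve: "equiv (paths_in \<Lambda>) (same_curve \<Lambda>)"
proof (rule equivI)
  show "same_curve \<Lambda> \<subseteq> paths_in \<Lambda> \<times> paths_in \<Lambda>" by (auto simp: same_curve_def)
  show "refl_on (paths_in \<Lambda>) (same_curve \<Lambda>)"
    using reparams_id by (fastforce simp: refl_on_def same_curve_def)
  show "sym (same_curve \<Lambda>)"
    by (rule symI) (auto simp: same_curve_def; metis)
  show "trans (same_curve \<Lambda>)"
  proof (rule transI)
    fix f g h assume "(f, g) \<in> same_curve \<Lambda>" "(g, h) \<in> same_curve \<Lambda>"
    then obtain \<phi> \<psi> where *: "f \<in> paths_in \<Lambda>" "h \<in> paths_in \<Lambda>" "\<phi> \<in> reparams" "\<psi> \<in> reparams"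
      "\<forall>t\<in>{0..1}. f t = g (\<phi> t)" "\<forall>t\<in>{0..1}. g t = h (\<psi> t)" by (auto simp: same_curve_iff)
    then have "\<forall>t\<in>{0..1}. f t = h ((\<psi> \<circ> \<phi>) t)" using reparams_in[OF *(3)] by auto
    then show "(f, h) \<in> same_curve \<Lambda>"
      using * reparams_comp[OF *(4) *(3)] unfolding same_curve_iff by blast
  qed
qed

lemma curve_rep_same:
  assumes C: "C \<in> curves \<Lambda>" and f: "f \<in> C"
  shows "(curve_rep C, f) \<in> same_curve \<Lambda>"
proof -
  have "curve_rep C \<in> C" unfolding curve_rep_def using f by (rule someI[of "\<lambda>f. f \<in> C"])
  with C f show ?thesis
    unfolding curves_def by (meson equiv_same_curve quotient_eq_iff)
qed

lemma curve_image_eq: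
  assumes "C \<in> curves \<Lambda>" "f \<in> C"
  shows "curve_image C = path_image f"
proof -
  obtain \<phi> where \<phi>: "\<phi> \<in> reparams" "\<forall>t\<in>{0..1}. curve_rep C t = f (\<phi> t)"
    using curve_rep_same[OF assms] by (auto simp: same_curve_iff)
  have "curve_rep C ` {0..1} = f ` \<phi> ` {0..1}" using \<phi>(2) by (force simp: image_image)
  then show ?thesis using reparams_image[OF \<phi>(1)] by (simp add: curve_image_def path_image_def)
qed

lemma param_dist_le:
  assumes \<alpha>: "\<alpha> \<in> reparams" "\<forall>t\<in>{0..1}. f t = f' (\<alpha> t)"
    and \<beta>: "\<beta> \<in> reparams" "\<forall>t\<in>{0..1}. g t = g' (\<beta> t)"
    and fin: "path f'" "path g'"
  shows "param_dist f' g' \<le> param_dist f g"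
  unfolding param_dist_def
proof (rule cINF_mono)
  show "reparams \<times> reparams \<noteq> {}" using reparams_id by auto
  have bdd: "bdd_above ((\<lambda>t. dist (f' (\<phi> t)) (g' (\<psi> t))) ` {0..1})"
    if "\<phi> \<in> reparams" "\<psi> \<in> reparams" for \<phi> \<psi>
  proof -
    have "continuous_on {0..1} (\<lambda>t. f' (\<phi> t))" "continuous_on {0..1} (\<lambda>t. g' (\<psi> t))"
      using that fin reparams_image[OF that(1)] reparams_image[OF that(2)]
      by (auto simp: path_def reparams_def intro!: continuous_on_compose2[of "{0..1}"])
    then have "compact ((\<lambda>t. dist (f' (\<phi> t)) (g' (\<psi> t))) ` {0..1})"
      by (intro compact_continuous_image continuous_intros) auto
    then show ?thesis by (intro bounded_imp_bdd_above compact_imp_bounded)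
  qed
  show "bdd_below ((\<lambda>(\<phi>, \<psi>). SUP t\<in>{0..1}. dist (f' (\<phi> t)) (g' (\<psi> t))) ` (reparams \<times> reparams))"
  proof (rule bdd_belowI2[of _ 0], clarify)
    fix \<phi> \<psi> assume r: "\<phi> \<in> reparams" "\<psi> \<in> reparams"
    have "0 \<le> dist (f' (\<phi> 0)) (g' (\<psi> 0))" by simp
    also have "\<dots> \<le> (SUP t\<in>{0..1}. dist (f' (\<phi> t)) (g' (\<psi> t)))"
      by (rule cSUP_upper[OF _ bdd[OF r]]) simp
    finally show "0 \<le> (SUP t\<in>{0..1}. dist (f' (\<phi> t)) (g' (\<psi> t)))" .
  qed
  fix m assume "m \<in> reparams \<times> reparams"
  then obtain \<phi> \<psi> where m: "m = (\<phi>, \<psi>)" and r: "\<phi> \<in> reparams" "\<psi> \<in> reparams" by auto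
  have "(SUP t\<in>{0..1}. dist (f (\<phi> t)) (g (\<psi> t))) =
        (SUP t\<in>{0..1}. dist (f' ((\<alpha> \<circ> \<phi>) t)) (g' ((\<beta> \<circ> \<psi>) t)))"
  proof (rule SUP_cong[OF refl])
    fix t :: real assume "t \<in> {0..1}"
    then show "dist (f (\<phi> t)) (g (\<psi> t)) = dist (f' ((\<alpha> \<circ> \<phi>) t)) (g' ((\<beta> \<circ> \<psi>) t))"
      using \<alpha>(2) \<beta>(2) reparams_in[OF r(1)] reparams_in[OF r(2)] by simp
  qed
  then show "\<exists>n\<in>reparams \<times> reparams.
      (case n of (\<phi>, \<psi>) \<Rightarrow> SUP t\<in>{0..1}. dist (f' (\<phi> t)) (g' (\<psi> t)))
      \<le> (case m of (\<phi>, \<psi>) \<Rightarrow> SUP t\<in>{0..1}. dist (f (\<phi> t)) (g (\<psi> t)))"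
    using m reparams_comp[OF \<alpha>(1) r(1)] reparams_comp[OF \<beta>(1) r(2)]
    by (intro bexI[of _ "(\<alpha> \<circ> \<phi>, \<beta> \<circ> \<psi>)"]) auto
qed

lemma curve_dist_eq:
  assumes "C \<in> curves \<Lambda>" "f \<in> C" "D \<in> curves \<Lambda>" "g \<in> D"
  shows "curve_dist C D = param_dist f g"
proof -
  have s: "(curve_rep C, f) \<in> same_curve \<Lambda>" "(curve_rep D, g) \<in> same_curve \<Lambda>"
    using assms curve_rep_same by blast+
  have s': "(f, curve_rep C) \<in> same_curve \<Lambda>" "(g, curve_rep D) \<in> same_curve \<Lambda>"
    using s equiv_same_curve by (meson equivE symE)+
  have p: "path f" "path g" "path (curve_rep C)" "path (curve_rep D)"
    using s by (auto simp: same_curve_def paths_in_def)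
  have "param_dist f g \<le> param_dist (curve_rep C) (curve_rep D)"
    using s p unfolding same_curve_iff by (blast intro: param_dist_le)
  moreover have "param_dist (curve_rep C) (curve_rep D) \<le> param_dist f g"
    using s' p unfolding same_curve_iff by (blast intro: param_dist_le)
  ultimately show ?thesis by (simp add: curve_dist_def)
qed


section \<open>Configurations\<close>

definition configs :: "'a::metric_space set \<Rightarrow> 'a curve set set" where
  "configs \<Lambda> = {F. F \<subseteq> curves \<Lambda> \<and>
     (\<forall>C\<in>curves \<Lambda>. (\<forall>e>0. \<exists>D\<in>F. curve_dist C D < e) \<longrightarrow> C \<in> F)}"

text \<open>The empty set is a configuration; its Hausdorff distance to every other configuration
  is infinite.\<close>

definition hausdorff_edist :: "'a::metric_space curve set \<Rightarrow> 'a curve set \<Rightarrow> ennreal" where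
  "hausdorff_edist F G =
     max (SUP C\<in>F. INF D\<in>G. ennreal (curve_dist C D)) (SUP D\<in>G. INF C\<in>F. ennreal (curve_dist C D))"

definition config_topology :: "'a::metric_space set \<Rightarrow> 'a curve set topology" where
  "config_topology \<Lambda> = topology (\<lambda>U. U \<subseteq> configs \<Lambda> \<and>
     (\<forall>F\<in>U. \<exists>e>0. \<forall>G\<in>configs \<Lambda>. hausdorff_edist F G < e \<longrightarrow> G \<in> U))"

lemma openin_config_topology:
  "openin (config_topology \<Lambda>) U \<longleftrightarrow> U \<subseteq> configs \<Lambda> \<and>
     (\<forall>F\<in>U. \<exists>e>0. \<forall>G\<in>configs \<Lambda>. hausdorff_edist F G < e \<longrightarrow> G \<in> U)"
proof -
  let ?P = "\<lambda>U. U \<subseteq> configs \<Lambda> \<and>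
     (\<forall>F\<in>U. \<exists>e>0. \<forall>G\<in>configs \<Lambda>. hausdorff_edist F G < e \<longrightarrow> G \<in> U)"
  have int: "?P (S \<inter> T)" if S: "?P S" and T: "?P T" for S T
  proof (intro conjI ballI)
    show "S \<inter> T \<subseteq> configs \<Lambda>" using S by blast
    fix F assume "F \<in> S \<inter> T"
    then obtain d e where "d > 0" "e > 0"
      "\<forall>G\<in>configs \<Lambda>. hausdorff_edist F G < d \<longrightarrow> G \<in> S"
      "\<forall>G\<in>configs \<Lambda>. hausdorff_edist F G < e \<longrightarrow> G \<in> T"
      using S T by blast
    then show "\<exists>e>0. \<forall>G\<in>configs \<Lambda>. hausdorff_edist F G < e \<longrightarrow> G \<in> S \<inter> T"
      by (intro exI[of _ "min d e"]) auto
  qed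
  have Un: "?P (\<Union>\<K>)" if K: "\<forall>U\<in>\<K>. ?P U" for \<K>
  proof (intro conjI ballI)
    show "\<Union>\<K> \<subseteq> configs \<Lambda>" using K by blast
    fix F assume "F \<in> \<Union>\<K>"
    then obtain U where U: "U \<in> \<K>" "F \<in> U" by blast
    then obtain e where "e > 0" "\<forall>G\<in>configs \<Lambda>. hausdorff_edist F G < e \<longrightarrow> G \<in> U"
      using K by blast
    then show "\<exists>e>0. \<forall>G\<in>configs \<Lambda>. hausdorff_edist F G < e \<longrightarrow> G \<in> \<Union>\<K>"
      using U by blast
  qed
  have "istopology ?P"
    unfolding istopology_def using int Un by (intro conjI allI impI) presburger+
  then show ?thesis by (simp add: config_topology_def topology_inverse')
qed

lemma topspace_config_topology [simp]: "topspace (config_topology \<Lambda>) = configs \<Lambda>"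
proof
  show "topspace (config_topology \<Lambda>) \<subseteq> configs \<Lambda>"
    by (metis openin_config_topology openin_topspace)
  have "openin (config_topology \<Lambda>) (configs \<Lambda>)"
    unfolding openin_config_topology by (auto intro: exI[of _ 1])
  then show "configs \<Lambda> \<subseteq> topspace (config_topology \<Lambda>)" by (rule openin_subset)
qed

definition config_borel :: "'a::metric_space set \<Rightarrow> 'a curve set measure" where
  "config_borel \<Lambda> = sigma (configs \<Lambda>) {U. openin (config_topology \<Lambda>) U}"


section \<open>Systems of random curves\<close>

definition polyline :: "(nat \<Rightarrow> 'a::real_vector) \<Rightarrow> real \<Rightarrow> 'a" where
  "polyline p x = (let i = nat \<lfloor>x\<rfloor> in p i + (x - real i) *\<^sub>R (p (Suc i) - p i))"

text \<open>A polygonal path follows the polygon with vertices \<open>p 0, \<dots>, p n\<close>.  The time change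
  \<open>\<phi>\<close> may be constant on intervals: closed sets of curves cannot tell apart curves at distance
  zero, so pauses have to be permitted for configurations of polygonal paths to exist.\<close>

definition polygonal_curve :: "real \<Rightarrow> 'a::real_normed_vector curve \<Rightarrow> bool" where
  "polygonal_curve \<delta> C \<longleftrightarrow> (\<exists>f\<in>C. \<exists>n p \<phi>.
     (\<forall>i<n. dist (p i) (p (Suc i)) = \<delta>) \<and>
     continuous_on {0..1} \<phi> \<and> mono_on {0..1} \<phi> \<and> \<phi> ` {0..1} = {0..real n} \<and>
     (\<forall>t\<in>{0..1}. f t = polyline p (\<phi> t)))"

definition random_curve_system ::
    "'a::real_normed_vector set \<Rightarrow> (real \<Rightarrow> 'a curve set measure) \<Rightarrow> bool" where
  "random_curve_system \<Lambda> \<mu> \<longleftrightarrow> (\<forall>\<delta>\<in>{0<..1}.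
     prob_space (\<mu> \<delta>) \<and> sets (\<mu> \<delta>) = sets (config_borel \<Lambda>) \<and>
     (AE F in \<mu> \<delta>. \<forall>C\<in>F. polygonal_curve \<delta> C))"

text \<open>The events below (some curve of the configuration has a given property) need not be
  Borel in the space of configurations.  Probabilities of events are therefore outer
  probabilities; on measurable events these are the ordinary ones.  No measurability assumption
  is then needed, and a hypothesis bounding a probability cannot hold merely because the event
  is not measurable.\<close>

definition Prob :: "'b measure \<Rightarrow> 'b set \<Rightarrow> real" where
  "Prob M E = enn2real (outer_measure_of M E)"

lemma Prob_eq_measure: "E \<in> sets M \<Longrightarrow> Prob M E = measure M E"
  by (simp add: Prob_def measure_def)

definition scaling_limit ::
    "'a::metric_space set \<Rightarrow> (real \<Rightarrow> 'a curve set measure) \<Rightarrow> 'a curve set measure \<Rightarrow> bool" where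
  "scaling_limit \<Lambda> \<mu> \<nu> \<longleftrightarrow>
     prob_space \<nu> \<and> sets \<nu> = sets (config_borel \<Lambda>) \<and>
     (\<exists>\<delta>. (\<forall>n. \<delta> n \<in> {0<..1}) \<and> \<delta> \<longlonglongrightarrow> 0 \<and>
       (\<forall>h B. continuous_map (config_topology \<Lambda>) euclideanreal h \<longrightarrow>
              (\<forall>F\<in>configs \<Lambda>. \<bar>h F\<bar> \<le> B) \<longrightarrow>
              (\<lambda>n. LINT F|\<mu> (\<delta> n). h F) \<longlonglongrightarrow> (LINT F|\<nu>. h F)))"

definition stoch_bounded :: "(real \<Rightarrow> 'b measure) \<Rightarrow> (real \<Rightarrow> 'b \<Rightarrow> ennreal) \<Rightarrow> bool" where
  "stoch_bounded \<mu> X \<longleftrightarrow> (\<forall>\<epsilon>>0. \<exists>u<\<infinity>. \<forall>\<delta>\<in>{0<..1}.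
     Prob (\<mu> \<delta>) {\<omega>\<in>space (\<mu> \<delta>). u \<le> X \<delta> \<omega>} \<le> \<epsilon>)"

definition stoch_bounded_away_from_zero ::
    "(real \<Rightarrow> 'b measure) \<Rightarrow> (real \<Rightarrow> 'b \<Rightarrow> ennreal) \<Rightarrow> bool" where
  "stoch_bounded_away_from_zero \<mu> X \<longleftrightarrow> stoch_bounded \<mu> (\<lambda>\<delta> \<omega>. inverse (X \<delta> \<omega>))"


section \<open>Cylinders\<close>

text \<open>The cylinder with unit axis direction \<open>u\<close>, length \<open>l\<close> and cross-sectional diameter \<open>w\<close>
  whose initial face is centred at \<open>a\<close>.\<close>

definition cylinder :: "'a::real_inner \<Rightarrow> 'a \<Rightarrow> real \<Rightarrow> real \<Rightarrow> 'a set" where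
  "cylinder a u l w =
     {x. 0 \<le> (x - a) \<bullet> u \<and> (x - a) \<bullet> u \<le> l \<and> norm ((x - a) - ((x - a) \<bullet> u) *\<^sub>R u) \<le> w / 2}"

text \<open>Traversal in the long direction: a segment of the curve stays inside the cylinder and
  joins its two faces, in either order.\<close>

definition traverses :: "'a::real_inner curve \<Rightarrow> 'a \<Rightarrow> 'a \<Rightarrow> real \<Rightarrow> real \<Rightarrow> bool" where
  "traverses C a u l w \<longleftrightarrow> (\<exists>f\<in>C. \<exists>t\<^sub>0\<in>{0..1}. \<exists>t\<^sub>1\<in>{0..1}. t\<^sub>0 \<le> t\<^sub>1 \<and>
     f ` {t\<^sub>0..t\<^sub>1} \<subseteq> cylinder a u l w \<and>
     ((f t\<^sub>0 - a) \<bullet> u = 0 \<and> (f t\<^sub>1 - a) \<bullet> u = l \<or> (f t\<^sub>0 - a) \<bullet> u = l \<and> (f t\<^sub>1 - a) \<bullet> u = 0))"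

definition well_separated :: "nat \<Rightarrow> (nat \<Rightarrow> 'a::metric_space set) \<Rightarrow> bool" where
  "well_separated k A \<longleftrightarrow> (\<forall>j<k. \<forall>i<k. i \<noteq> j \<longrightarrow> diameter (A j) \<le> setdist (A j) (A i))"


section \<open>Capacity, Hausdorff dimension, rectifiability\<close>

definition energy :: "real \<Rightarrow> real \<Rightarrow> 'a::metric_space measure \<Rightarrow> ennreal" where
  "energy s l \<mu> = (\<integral>\<^sup>+ x. \<integral>\<^sup>+ y. inverse (ennreal (max (dist x y) l powr s)) \<partial>\<mu> \<partial>\<mu>)"

text \<open>The infimum is over the Borel probability measures on the subspace \<open>A\<close>.  The capacity takes
  values in \<open>[0, \<infinity>]\<close>, where the inverses of \<open>0\<close> and \<open>\<infinity>\<close> are \<open>\<infinity>\<close> and \<open>0\<close>.\<close>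

definition Cap :: "real \<Rightarrow> real \<Rightarrow> 'a::metric_space set \<Rightarrow> ennreal" where
  "Cap s l A = inverse
     (INF \<mu>\<in>{\<mu>. prob_space \<mu> \<and> sets \<mu> = sets (restrict_space borel A)}. energy s l \<mu>)"

text \<open>The infimum over no curves is \<open>\<infinity>\<close>.\<close>

definition min_capacity :: "real \<Rightarrow> real \<Rightarrow> real \<Rightarrow> 'a::metric_space curve set \<Rightarrow> ennreal" where
  "min_capacity s r \<delta> F =
     (INF C\<in>{C\<in>F. r \<le> diameter (curve_image C)}. Cap s \<delta> (curve_image C))"

text \<open>A constant curve has dimension zero and length zero.  Curves of microscopic size converge to
  constant curves, so scaling limits may well contain these (for instance if \<open>F\<^sub>\<delta>\<close> always consists
  of one segment of length \<open>\<delta>\<close>); claims about the dimension and non-rectifiability of the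
  curves in a scaling limit are claims about curves of positive diameter.\<close>

definition hausdorff_premeasure :: "real \<Rightarrow> real \<Rightarrow> 'a::metric_space set \<Rightarrow> ennreal" where
  "hausdorff_premeasure s e A =
     (INF U\<in>{U :: nat \<Rightarrow> 'a set. A \<subseteq> (\<Union>i. U i) \<and> (\<forall>i. bounded (U i) \<and> diameter (U i) \<le> e)}.
        \<Sum>i. ennreal (diameter (U i) powr s))"

definition hausdorff_measure :: "real \<Rightarrow> 'a::metric_space set \<Rightarrow> ennreal" where
  "hausdorff_measure s A = (SUP e\<in>{0<..}. hausdorff_premeasure s e A)"

definition hausdorff_dim :: "'a::metric_space set \<Rightarrow> ennreal" where
  "hausdorff_dim A = (INF s\<in>{s. 0 < s \<and> hausdorff_measure s A = 0}. ennreal s)"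

definition rectifiable_curve :: "'a::metric_space curve \<Rightarrow> bool" where
  "rectifiable_curve C \<longleftrightarrow> (\<exists>f\<in>C. \<exists>B. \<forall>n t. mono_on {..n} t \<longrightarrow> t ` {..n} \<subseteq> {0..1} \<longrightarrow>
     (\<Sum>i<n. dist (f (t i)) (f (t (Suc i)))) \<le> B)"

end

theory Submission
  imports Defs
begin

text \<open>
  Fix a large scale ratio \<open>\<gamma> = m + 1/4\<close>. A piece of a path with end-to-end distance \<open>L\<close> contains \<open>m\<close>
  pieces with end-to-end distance \<open>L / \<gamma>\<close> whose images are separated by a multiple of \<open>L / \<gamma>\<close>, and it contains
  \<open>m + 1\<close> of them unless it is straight, that is, unless it stays in an ellipsoid of width of order
  \<open>L / sqrt \<gamma>\<close>. Iterating gives a tree of pieces. If at most half of the levels along each branch are straight,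
  then the measure that is shared equally among the children of each piece has bounded \<open>s\<close>-energy whenever
  \<open>\<gamma> powr s < sqrt (m * (m + 1))\<close>, and \<open>sqrt (m * (m + 1)) > \<gamma>\<close> makes room for some \<open>s > 1\<close>.

  A straight piece traverses of order \<open>sqrt \<gamma>\<close> well separated cylinders that are also well
  separated from everything inside a given much smaller piece. Nested straight pieces on more than half of \<open>k\<close> levels
  thus have probability at most \<open>\<rho>\<close> to a power of order \<open>k * sqrt \<gamma>\<close>, which for large \<open>\<gamma>\<close> beats the
  number of positions of such a sequence, a power of \<open>\<gamma> ^ k\<close>.

  In the scaling limit the energy bounds survive at every fixed cutoff, and by the Cauchy-Schwarz
  inequality a set that carries measures of bounded energy at arbitrarily small cutoffs has no cheap finite covers.
\<close>

section \<open>Separated runs of a path\<close>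

text \<open>The number 1/4 meets two demands. With at most \<open>m - 1\<close> pieces, and gaps
  adding up to less than \<open>L / 8\<close> between them, the ends would be less than
  \<open>(m + 1/8) * L\<close> apart, so at length \<open>(m + 1/4) * L\<close> there is room for
  \<open>m\<close> pieces. And the square of \<open>m + 1/4\<close> is about m^2 + m/2, less than
  \<open>m * (m + 1)\<close>, so one straight and one other level together gain more pieces than the
  scaling costs.

  The obstacle is that a curve has uncontrollably many pieces on each scale, so the union bound
  cannot run over trees. It runs over the approximate positions of one nested sequence: in dimension
  d, the two ends on each level, rounded at the next scale, cost \<open>\<gamma> ^ (2 * d)\<close>
  per level, and the location of the smallest piece costs another \<open>\<gamma> ^ d\<close> per
  level. Against this stands the gain from a straight piece. Its distance excess is of relative
  order 1 / \<gamma>, hence its relative width is of order 1 / sqrt \<gamma>; cylinders of fixed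
  aspect ratio have length comparable to their width, which is why about sqrt \<gamma> of them fit
  along it.\<close>

definition run :: "(real \<Rightarrow> 'a::metric_space) \<Rightarrow> real \<Rightarrow> real \<Rightarrow> real \<Rightarrow> bool" where
  "run f L a b \<longleftrightarrow> 0 \<le> a \<and> a \<le> b \<and> b \<le> 1 \<and> dist (f a) (f b) = L \<and>
     (\<forall>t\<in>{a..b}. dist (f a) (f t) \<le> L)"

text \<open>The points of the piece lie in an ellipsoid whose foci are its ends. The excess is
  measured in units of the child length \<open>L / \<gamma>\<close>; seven units keep a point
  outside the ellipsoid more than three units away from every start of a child run, which is what an
  extra child needs.\<close>

definition straight :: "(real \<Rightarrow> 'a::metric_space) \<Rightarrow> real \<Rightarrow> real \<Rightarrow> real \<Rightarrow> real \<Rightarrow> bool" where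
  "straight f \<gamma> L a b \<longleftrightarrow> (\<forall>t\<in>{a..b}. dist (f a) (f t) + dist (f t) (f b) \<le> L + 7 * (L / \<gamma>))"

definition separated_runs ::
    "(real \<Rightarrow> 'a::metric_space) \<Rightarrow> real \<Rightarrow> real \<Rightarrow> real \<Rightarrow> real \<Rightarrow> (real \<times> real) set \<Rightarrow> bool" where
  "separated_runs f e L a b Q \<longleftrightarrow> finite Q \<and>
     (\<forall>I\<in>Q. run f L (fst I) (snd I) \<and> a \<le> fst I \<and> snd I \<le> b) \<and>
     (\<forall>I\<in>Q. \<forall>J\<in>Q. I \<noteq> J \<longrightarrow> (\<forall>t\<in>{fst I..snd I}. \<forall>t'\<in>{fst J..snd J}. e \<le> dist (f t) (f t')))"

text \<open>The run ends at the first time the path reaches distance \<open>L\<close> from its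
  start, so the ball condition in \<open>run\<close> holds up to then. That condition localises the
  image: without it, runs with distant starts could still come close to each other.\<close>

lemma run_exists:
  assumes f: "path f" and a: "0 \<le> a" "a \<le> c" "c \<le> 1" and L: "0 \<le> L" "L \<le> dist (f a) (f c)"
  shows "\<exists>b\<in>{a..c}. run f L a b"
proof -
  have cont: "continuous_on {a..c} (\<lambda>t. dist (f a) (f t))"
    using f a by (auto simp: path_def intro!: continuous_intros elim: continuous_on_subset)
  have "compact {t\<in>{a..c}. L \<le> dist (f a) (f t)}"
    using continuous_closed_preimage[OF cont closed_atLeastAtMost closed_atLeast[of L]]
    by (simp add: compact_eq_bounded_closed vimage_def Int_def bounded_subset[OF bounded_closed_interval[of a c]] subset_eq)
  moreover have "{t\<in>{a..c}. L \<le> dist (f a) (f t)} \<noteq> {}" using L a by auto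
  ultimately obtain b where b: "b \<in> {a..c}" "L \<le> dist (f a) (f b)"
    and least: "\<And>t. t \<in> {a..c} \<Longrightarrow> L \<le> dist (f a) (f t) \<Longrightarrow> b \<le> t"
    using compact_attains_inf[of "{t\<in>{a..c}. L \<le> dist (f a) (f t)}"] by auto
  have "\<exists>t\<ge>a. t \<le> b \<and> dist (f a) (f t) = L"
    using b L by (intro IVT' continuous_on_subset[OF cont]) auto
  then have eq: "dist (f a) (f b) = L" using least b by force
  have "dist (f a) (f t) \<le> L" if "t \<in> {a..b}" for t
    using least[of t] that b eq by (cases "t = b") force+
  then show ?thesis using b a eq by (auto simp: run_def)
qed

text \<open>The next run starts at the last time that the path is within \<open>e\<close> of the current run.
  All that follows is then separated from the current run, and the starting points
  form a chain with steps of size at most \<open>L + e\<close>.\<close>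

lemma separated_runs_or_chain:
  assumes f: "path f" and a: "0 \<le> a" "a \<le> b" "b \<le> 1" and L: "0 < L" and e: "0 < e"
  shows "\<exists>Q. separated_runs f e L a b Q \<and> (card Q = n \<or> card Q < n \<and>
           dist (f a) (f b) \<le> real (card Q) * (L + e) + L \<and>
           (\<forall>I\<in>Q. dist (f a) (f (fst I)) + dist (f (fst I)) (f b) \<le> real (card Q) * (L + e) + L))"
  using a
proof (induction n arbitrary: a)
  case 0
  show ?case by (rule exI[of _ "{}"]) (auto simp: separated_runs_def)
next
  case (Suc n)
  show ?case
  proof (cases "L \<le> dist (f a) (f b)")
    case False
    then show ?thesis by (intro exI[of _ "{}"]) (auto simp: separated_runs_def)
  next
    case True
    obtain d where d: "d \<in> {a..b}" and run: "run f L a d"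
      using run_exists[OF f Suc.prems _ True] L by auto
    have contf: "continuous_on {0..1} f" using f by (simp add: path_def)
    have ca: "compact (f ` {a..d})"
      using Suc.prems d by (intro compact_continuous_image continuous_on_subset[OF contf]) auto
    have ne: "f ` {a..d} \<noteq> {}" using d by auto
    let ?g = "\<lambda>t. infdist (f t) (f ` {a..d})"
    have cg: "continuous_on {d..b} ?g"
      using Suc.prems d by (intro continuous_on_infdist continuous_on_subset[OF contf]) auto
    have "compact {t\<in>{d..b}. ?g t \<le> e}"
      using continuous_closed_preimage[OF cg closed_atLeastAtMost closed_atMost[of e]]
      by (simp add: compact_eq_bounded_closed vimage_def Int_def bounded_subset[OF bounded_closed_interval[of d b]] subset_eq)
    moreover have "d \<in> {t\<in>{d..b}. ?g t \<le> e}" using d e by auto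
    ultimately obtain a' where a': "a' \<in> {d..b}" "?g a' \<le> e"
      and last: "\<And>t. t \<in> {d..b} \<Longrightarrow> ?g t \<le> e \<Longrightarrow> t \<le> a'"
      using compact_attains_sup[of "{t\<in>{d..b}. ?g t \<le> e}"] by blast
    have "continuous_on (f ` {a..d}) (dist (f a'))" by (intro continuous_intros)
    then obtain t where t: "t \<in> {a..d}" "\<And>s. s \<in> {a..d} \<Longrightarrow> dist (f a') (f t) \<le> dist (f a') (f s)"
      using continuous_attains_inf[OF ca ne] by blast
    have "dist (f a') (f t) \<le> ?g a'"
      using t ne unfolding infdist_notempty[OF ne] by (intro cINF_greatest) auto
    note t = t(1) this
    have step: "dist (f a) (f a') \<le> L + e"
    proof -
      have "dist (f a) (f t) \<le> L" using run t(1) by (auto simp: run_def)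
      then show ?thesis
        using t(2) a'(2) dist_triangle[of "f a" "f a'" "f t"] by (simp add: dist_commute)
    qed
    \<comment> \<open>If the path is still within \<open>e\<close> of the current run at the final
      time, this run alone is a chain that reaches the end.\<close>
    show ?thesis
    proof (cases "a' = b")
      case True
      have "separated_runs f e L a b {(a, d)}"
        using run d by (auto simp: separated_runs_def)
      then show ?thesis using True step L by (intro exI[of _ "{(a, d)}"]) auto
    next
      case False
      \<comment> \<open>Beyond \<open>a'\<close> the distance to the current run exceeds
        \<open>e\<close> by maximality. At \<open>a'\<close> itself, where the next run begins, only
        continuity gives it, through the closure of the open interval; this needs
        \<open>a' < b\<close>.\<close>
      have later: "e \<le> ?g t" if "t \<in> {a'..b}" for t
      proof -
        have "closed {t\<in>{d..b}. e \<le> ?g t}"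
          using continuous_closed_preimage[OF cg closed_atLeastAtMost closed_atLeast[of e]]
          by (simp add: vimage_def Int_def)
        moreover have "{a'<..<b} \<subseteq> {t\<in>{d..b}. e \<le> ?g t}"
        proof clarify
          fix t assume t: "t \<in> {a'<..<b}"
          then have "t \<in> {d..b}" using a' by auto
          then show "t \<in> {d..b} \<and> e \<le> ?g t" using last[of t] t by force
        qed
        ultimately have "closure {a'<..<b} \<subseteq> {t\<in>{d..b}. e \<le> ?g t}"
          by (rule closure_minimal[rotated])
        then show ?thesis using that False a' by (auto simp: closure_greaterThanLessThan)
      qed
      have sep: "e \<le> dist (f s) (f t)" if "s \<in> {a..d}" "t \<in> {a'..b}" for s t
      proof -
        have "?g t \<le> dist (f t) (f s)" using that by (intro infdist_le) auto
        then show ?thesis using later[OF that(2)] by (simp add: dist_commute)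
      qed
      obtain Q where Q: "separated_runs f e L a' b Q"
        and alt: "card Q = n \<or> card Q < n \<and>
           dist (f a') (f b) \<le> real (card Q) * (L + e) + L \<and>
           (\<forall>I\<in>Q. dist (f a') (f (fst I)) + dist (f (fst I)) (f b) \<le> real (card Q) * (L + e) + L)"
        using Suc.IH[of a'] a' d Suc.prems by auto
      have in': "{fst I..snd I} \<subseteq> {a'..b}" "fst I \<le> snd I" if "I \<in> Q" for I
        using Q that by (auto simp: separated_runs_def run_def)
      have notin: "(a, d) \<notin> Q"
      proof
        assume "(a, d) \<in> Q"
        then have "d \<in> {a'..b}" using in'[of "(a, d)"] by auto
        then show False using sep[of d d] d e by auto
      qed
      have fin: "finite Q" using Q by (simp add: separated_runs_def)
      let ?Q = "insert (a, d) Q"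
      have card: "card ?Q = Suc (card Q)" using notin fin by simp
      have "separated_runs f e L a b ?Q"
        unfolding separated_runs_def
      proof (intro conjI ballI impI)
        fix I assume I: "I \<in> ?Q"
        show "run f L (fst I) (snd I)" using I run Q by (auto simp: separated_runs_def)
        have "a' \<le> fst I \<and> snd I \<le> b" if "I \<in> Q"
          using Q that by (auto simp: separated_runs_def)
        then show "a \<le> fst I" "snd I \<le> b" using I a' d by auto
        fix J t t' assume J: "J \<in> ?Q" "I \<noteq> J" and t: "t \<in> {fst I..snd I}" "t' \<in> {fst J..snd J}"
        consider "I = (a, d)" "J \<in> Q" | "J = (a, d)" "I \<in> Q" | "I \<in> Q" "J \<in> Q"
          using I J by auto
        then show "e \<le> dist (f t) (f t')"
        proof cases
          case 1 then show ?thesis using sep[of t t'] t in'[of J] by auto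
        next
          case 2 then show ?thesis using sep[of t' t] t in'[of I] by (auto simp: dist_commute)
        next
          case 3 then show ?thesis using Q J t unfolding separated_runs_def by blast
        qed
      qed (use fin in simp)
      moreover have "dist (f a) x + dist x (f b) \<le> real (card ?Q) * (L + e) + L"
        if "dist (f a') x + dist x (f b) \<le> real (card Q) * (L + e) + L" for x
        using that step dist_triangle[of "f a" x "f a'"] unfolding card by (simp add: algebra_simps)
      moreover have "dist (f a) (f b) \<le> real (card ?Q) * (L + e) + L"
        if "dist (f a') (f b) \<le> real (card Q) * (L + e) + L"
        using that step dist_triangle[of "f a" "f b" "f a'"] unfolding card by (simp add: algebra_simps)
      ultimately show ?thesis using alt card by (intro exI[of _ ?Q]) auto
    qed
  qed
qed

lemma separated_runs_subset:
  "separated_runs f e L a b Q \<Longrightarrow> R \<subseteq> Q \<Longrightarrow> separated_runs f e L a b R"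
  unfolding separated_runs_def by (meson finite_subset subsetD)

text \<open>If the chain has only \<open>m\<close> links, its length exceeds the distance of its ends by less than
  \<open>L\<close>, so its vertices lie in a thin ellipsoid; a point of the path far from all
  vertices starts an additional run.\<close>

lemma separated_subruns:
  assumes f: "path f" and m: "m \<ge> (1::nat)" and L: "0 < L"
    and r: "run f ((m + 1/4) * L) a b"
  shows "\<exists>Q. separated_runs f (L / (8 * m)) L a b Q \<and>
           (card Q = Suc m \<or> card Q = m \<and> straight f (m + 1/4) ((m + 1/4) * L) a b)"
proof -
  \<comment> \<open>The \<open>m\<close> gaps add up to \<open>L / 8\<close>, half of the surplus
    \<open>L / 4\<close>.\<close>
  define e where "e = L / (8 * real m)"
  have e: "0 < e" "m * e = L / 8" "e \<le> L" using L m by (auto simp: e_def field_simps)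
  have ab: "0 \<le> a" "a \<le> b" "b \<le> 1" and dab: "dist (f a) (f b) = (m + 1/4) * L"
    using r by (auto simp: run_def)
  obtain Q where Q: "separated_runs f e L a b Q" and alt: "card Q = Suc m \<or> card Q < Suc m \<and>
           dist (f a) (f b) \<le> real (card Q) * (L + e) + L \<and>
           (\<forall>I\<in>Q. dist (f a) (f (fst I)) + dist (f (fst I)) (f b) \<le> real (card Q) * (L + e) + L)"
    using separated_runs_or_chain[OF f ab L e(1), of "Suc m"] by blast
  show ?thesis
  proof (cases "card Q = Suc m")
    case True then show ?thesis using Q unfolding e_def by blast
  next
    case False
    have cQ: "card Q = m"
    proof (rule ccontr)
      assume "card Q \<noteq> m"
      then have le: "real (card Q) \<le> m - 1" using alt False by auto
      have "(m + 1/4) * L \<le> real (card Q) * (L + e) + L" using dab alt False by auto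
      also have "\<dots> \<le> (real m - 1) * (L + e) + L"
        using le L e by (intro add_right_mono mult_right_mono) auto
      also have "\<dots> = m * L + m * e - e" by (simp add: algebra_simps)
      finally show False using e L by (simp add: algebra_simps)
    qed
    have near: "dist (f a) (f (fst I)) + dist (f (fst I)) (f b) \<le> m * L + L / 8 + L" if "I \<in> Q" for I
      using alt False that cQ e by (auto simp: algebra_simps)
    show ?thesis
    proof (cases "straight f (m + 1/4) ((m + 1/4) * L) a b")
      case True then show ?thesis using Q cQ unfolding e_def by blast
    next
      case False
      then obtain t where t: "t \<in> {a..b}"
        and far: "dist (f a) (f t) + dist (f t) (f b) > (m + 1/4) * L + 7 * L"
        using m by (auto simp: straight_def not_le)
      \<comment> \<open>A far point cannot be close to the end of the piece, so there is room after
        \<open>t\<close> for a run of length \<open>L\<close>.\<close>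
      have exit: "L \<le> dist (f t) (f b)"
      proof (rule ccontr)
        assume "\<not> L \<le> dist (f t) (f b)"
        then show False
          using far dab dist_triangle[of "f a" "f t" "f b"] L by (simp add: dist_commute)
      qed
      obtain d where d: "d \<in> {t..b}" and rt: "run f L t d"
        using run_exists[OF f _ _ _ _ exit] t ab L by auto
      \<comment> \<open>The distance sum of a chain vertex is at most
        \<open>m * L + L / 8 + L\<close>. That of \<open>t\<close> is larger by more than
        \<open>6 * L\<close>, and the difference is at most twice the distance of the two points. Of
        the \<open>3 * L\<close>, each of the two runs uses up one \<open>L\<close>, and the
        remaining one is at least \<open>e\<close>.\<close>
      have fart: "3 * L < dist (f t) (f (fst I))" if "I \<in> Q" for I
        using near[OF that] far L dist_triangle[of "f a" "f t" "f (fst I)"]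
          dist_triangle[of "f t" "f b" "f (fst I)"]
        by (simp add: dist_commute algebra_simps)
      have sep: "e \<le> dist (f x) (f y)" if "I \<in> Q" "x \<in> {t..d}" "y \<in> {fst I..snd I}" for I x y
      proof -
        have "dist (f t) (f x) \<le> L" using rt that by (auto simp: run_def)
        moreover have "dist (f (fst I)) (f y) \<le> L"
          using Q that by (auto simp: run_def separated_runs_def)
        ultimately show ?thesis
          using fart[OF that(1)] e dist_triangle[of "f t" "f (fst I)" "f x"]
            dist_triangle[of "f x" "f (fst I)" "f y"] by (simp add: dist_commute)
      qed
      have "(t, d) \<notin> Q" using fart[of "(t, d)"] L by auto
      moreover have fin: "finite Q" using Q by (simp add: separated_runs_def)
      ultimately have "card (insert (t, d) Q) = Suc m" using cQ by simp
      moreover have "separated_runs f e L a b (insert (t, d) Q)"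
        unfolding separated_runs_def
      proof (intro conjI ballI impI)
        fix I assume I: "I \<in> insert (t, d) Q"
        show "run f L (fst I) (snd I)" using I rt Q by (auto simp: separated_runs_def)
        have "a \<le> fst I \<and> snd I \<le> b" if "I \<in> Q"
          using Q that by (auto simp: separated_runs_def)
        then show "a \<le> fst I" "snd I \<le> b" using I t d by auto
        fix J x y assume J: "J \<in> insert (t, d) Q" "I \<noteq> J" "x \<in> {fst I..snd I}" "y \<in> {fst J..snd J}"
        consider "I = (t, d)" "J \<in> Q" | "J = (t, d)" "I \<in> Q" | "I \<in> Q" "J \<in> Q"
          using I J by auto
        then show "e \<le> dist (f x) (f y)"
        proof cases
          case 1 then show ?thesis using sep[of J x y] J by auto
        next
          case 2 then show ?thesis using sep[of I y x] J by (auto simp: dist_commute)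
        next
          case 3 then show ?thesis using Q J unfolding separated_runs_def by blast
        qed
      qed (use fin in simp)
      ultimately show ?thesis unfolding e_def by blast
    qed
  qed
qed

section \<open>Energy of the tree measure\<close>

text \<open>All nested sequences count, not only the branches of one tree: then the exceptional
  event does not depend on how children are selected.\<close>

definition history ::
    "(real \<Rightarrow> 'a::metric_space) \<Rightarrow> real \<Rightarrow> real \<Rightarrow> nat \<Rightarrow> (nat \<Rightarrow> real) \<Rightarrow> (nat \<Rightarrow> real) \<Rightarrow> bool" where
  "history f \<gamma> L k A B \<longleftrightarrow> (\<forall>i\<le>k. run f (L / \<gamma> ^ i) (A i) (B i)) \<and>
     (\<forall>i<k. A i \<le> A (Suc i) \<and> B (Suc i) \<le> B i)"

text \<open>The run at level \<open>k\<close> is left out because its mass is determined by the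
  branchings above it.\<close>

definition straight_levels ::
    "(real \<Rightarrow> 'a::metric_space) \<Rightarrow> real \<Rightarrow> real \<Rightarrow> nat \<Rightarrow> (nat \<Rightarrow> real) \<Rightarrow> (nat \<Rightarrow> real) \<Rightarrow> nat set" where
  "straight_levels f \<gamma> L k A B = {i. i < k \<and> straight f \<gamma> (L / \<gamma> ^ i) (A i) (B i)}"

text \<open>Depths below \<open>k\<^sub>0\<close> are exempt. This costs only a constant factor in
  the energy, and the exceptional probabilities for the remaining depths form the tail of a
  geometric series.\<close>

definition sparsely_straight :: "(real \<Rightarrow> 'a::metric_space) \<Rightarrow> real \<Rightarrow> real \<Rightarrow> nat \<Rightarrow> nat \<Rightarrow> bool" where
  "sparsely_straight f \<gamma> L k\<^sub>0 n \<longleftrightarrow> (\<forall>A B k. k\<^sub>0 \<le> k \<longrightarrow> k \<le> n \<longrightarrow> history f \<gamma> L k A B \<longrightarrow>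
     2 * card (straight_levels f \<gamma> L k A B) \<le> k)"

text \<open>Two independent samples choose the same component with probability
  \<open>1 / card Q\<close>, and then contribute at most \<open>M\<close>. Samples from different
  components are at distance at least \<open>e\<close>, so together they contribute at most
  \<open>e powr - s\<close>.\<close>

lemma energy_bind_pmf_of_set:
  fixes p :: "'b \<Rightarrow> 'a::metric_space pmf"
  assumes Q: "finite Q" "Q \<noteq> {}" and e: "0 < e" and s: "0 < s"
    and M: "\<And>c. c \<in> Q \<Longrightarrow> energy s l (measure_pmf (p c)) \<le> M"
    and sep: "\<And>c d x y. \<lbrakk>c \<in> Q; d \<in> Q; c \<noteq> d; x \<in> set_pmf (p c); y \<in> set_pmf (p d)\<rbrakk> \<Longrightarrow> e \<le> dist x y"
  shows "energy s l (measure_pmf (bind_pmf (pmf_of_set Q) p))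
    \<le> M * ennreal (1 / card Q) + ennreal (e powr - s)"
proof -
  let ?k = "\<lambda>x y. inverse (ennreal (max (dist x y) l powr s))"
  let ?n = "ennreal (1 / card Q)" and ?\<kappa> = "ennreal (e powr - s)"
  have far: "?k x y \<le> ?\<kappa>" if "e \<le> dist x y" for x y :: 'a
  proof -
    have "?k x y = ennreal (max (dist x y) l powr - s)"
      using that e by (simp add: inverse_ennreal powr_minus)
    also have "\<dots> \<le> ?\<kappa>" using that e s by (intro ennreal_leI powr_mono2') auto
    finally show ?thesis .
  qed
  have inner: "(\<integral>\<^sup>+ d. \<integral>\<^sup>+ y. ?k x y \<partial>p d \<partial>pmf_of_set Q) \<le> (\<integral>\<^sup>+ y. ?k x y \<partial>p c) * ?n + ?\<kappa>"
    if c: "c \<in> Q" and x: "x \<in> set_pmf (p c)" for c x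
  proof -
    let ?I = "\<integral>\<^sup>+ y. ?k x y \<partial>p c"
    have "(\<integral>\<^sup>+ d. \<integral>\<^sup>+ y. ?k x y \<partial>p d \<partial>pmf_of_set Q) \<le> (\<integral>\<^sup>+ d. ?I * indicator {c} d + ?\<kappa> \<partial>pmf_of_set Q)"
    proof (rule nn_integral_mono_AE, unfold AE_measure_pmf_iff, rule ballI)
      fix d assume "d \<in> set_pmf (pmf_of_set Q)"
      then have d: "d \<in> Q" using Q by simp
      show "(\<integral>\<^sup>+ y. ?k x y \<partial>p d) \<le> ?I * indicator {c} d + ?\<kappa>"
      proof (cases "d = c")
        case False
        have "(\<integral>\<^sup>+ y. ?k x y \<partial>p d) \<le> (\<integral>\<^sup>+ y. ?\<kappa> \<partial>p d)"
          using sep[OF c d] x False by (intro nn_integral_mono_AE) (auto simp: AE_measure_pmf_iff far)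
        then show ?thesis using False by (simp add: measure_pmf.emeasure_space_1[simplified])
      qed simp
    qed
    also have "\<dots> = ?I * ?n + ?\<kappa>"
      using Q c by (simp add: nn_integral_add nn_integral_cmult emeasure_pmf_single
        measure_pmf.emeasure_space_1[simplified])
    finally show ?thesis .
  qed
  have "(\<integral>\<^sup>+ x. \<integral>\<^sup>+ d. \<integral>\<^sup>+ y. ?k x y \<partial>p d \<partial>pmf_of_set Q \<partial>p c) \<le> M * ?n + ?\<kappa>" if c: "c \<in> Q" for c
  proof -
    have "(\<integral>\<^sup>+ x. \<integral>\<^sup>+ d. \<integral>\<^sup>+ y. ?k x y \<partial>p d \<partial>pmf_of_set Q \<partial>p c)
      \<le> (\<integral>\<^sup>+ x. (\<integral>\<^sup>+ y. ?k x y \<partial>p c) * ?n + ?\<kappa> \<partial>p c)"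
      using inner[OF c] by (intro nn_integral_mono_AE) (auto simp: AE_measure_pmf_iff)
    also have "\<dots> = energy s l (measure_pmf (p c)) * ?n + ?\<kappa>"
      by (simp add: nn_integral_add nn_integral_multc energy_def measure_pmf.emeasure_space_1[simplified])
    also have "\<dots> \<le> M * ?n + ?\<kappa>" using M[OF c] by (intro add_right_mono mult_right_mono) auto
    finally show ?thesis .
  qed
  then have "(\<integral>\<^sup>+ c. \<integral>\<^sup>+ x. \<integral>\<^sup>+ d. \<integral>\<^sup>+ y. ?k x y \<partial>p d \<partial>pmf_of_set Q \<partial>p c \<partial>pmf_of_set Q)
      \<le> (\<integral>\<^sup>+ c. M * ?n + ?\<kappa> \<partial>pmf_of_set Q)"
    using Q by (intro nn_integral_mono_AE) (auto simp: AE_measure_pmf_iff)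
  also have "\<dots> = M * ?n + ?\<kappa>" by (simp add: measure_pmf.emeasure_space_1[simplified])
  finally show ?thesis by (simp add: energy_def nn_integral_bind_pmf)
qed

text \<open>\<open>w j A B\<close> is the mass of the piece \<open>{A j..B j}\<close> in the tree in which all children of a
  piece have equal mass.\<close>

lemma tree_energy:
  fixes f :: "real \<Rightarrow> 'a::metric_space" and m :: nat and W :: "nat \<Rightarrow> real" and L :: real
  defines "\<gamma> \<equiv> real m + 1/4"
  defines "w \<equiv> \<lambda>k A B. (1 / real m) ^ card (straight_levels f \<gamma> L k A B) *
      (1 / real (Suc m)) ^ (k - card (straight_levels f \<gamma> L k A B))"
  assumes f: "path f" and m: "m \<ge> 1" and L: "0 < L" and l: "0 < l" and s: "0 < s"
    and W0: "\<And>k. 0 \<le> W k"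
    and W: "\<And>A B k. k \<le> n \<Longrightarrow> history f \<gamma> L k A B \<Longrightarrow> w k A B \<le> W k"
    and j: "j \<le> n" and hist: "history f \<gamma> L j A B"
  shows "\<exists>p. set_pmf p \<subseteq> f ` {A j..B j} \<and> energy s l (measure_pmf p) \<le>
     ennreal (((\<Sum>i=j..<n. W i * (L / \<gamma> ^ Suc i / (8 * real m)) powr - s) + W n * l powr - s) / w j A B)"
  using j hist
proof (induction "n - j" arbitrary: j A B)
  \<comment> \<open>At depth \<open>n\<close> a point mass suffices: the cutoff bounds its energy by
    \<open>l powr - s\<close>.\<close>
  case 0
  then have "j = n" by simp
  have w0: "0 < w n A B" using m by (simp add: w_def)
  have "energy s l (measure_pmf (return_pmf (f (A n)))) = ennreal (l powr - s)"
    using l by (simp add: energy_def inverse_ennreal powr_minus)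
  also have "\<dots> \<le> ennreal (W n * l powr - s / w n A B)"
    using W[of n A B] 0 \<open>j = n\<close> w0 by (intro ennreal_leI) (simp add: pos_le_divide_eq mult.commute[of "W n"] mult_left_mono)
  finally show ?case
    using 0 \<open>j = n\<close> by (intro exI[of _ "return_pmf (f (A n))"]) (auto simp: history_def run_def)
next
  case (Suc d)
  define l' where "l' = L / \<gamma> ^ Suc j"
  define e where "e = l' / (8 * real m)"
  have \<gamma>: "0 < \<gamma>" by (simp add: \<gamma>_def)
  have l': "0 < l'" "L / \<gamma> ^ j = \<gamma> * l'" using L \<gamma> by (simp_all add: l'_def)
  have e: "0 < e" using l' m by (simp add: e_def)
  let ?st = "straight f \<gamma> (L / \<gamma> ^ j) (A j) (B j)"
  have "run f ((m + 1/4) * l') (A j) (B j)"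
    using Suc.prems l' by (auto simp: history_def \<gamma>_def)
  from separated_subruns[OF f m l'(1) this]
  obtain Q0 where Q0: "separated_runs f e l' (A j) (B j) Q0" "card Q0 = Suc m \<or> card Q0 = m \<and> ?st"
    using l'(2) by (auto simp: e_def \<gamma>_def)
  \<comment> \<open>A straight piece may happen to have an extra child. Dropping it makes the number
    of children a function of straightness, as the formula for \<open>w\<close> requires.\<close>
  obtain Q where Q: "separated_runs f e l' (A j) (B j) Q" and cQ: "card Q = (if ?st then m else Suc m)"
  proof (cases "?st \<and> card Q0 = Suc m")
    case True
    then obtain R where "R \<subseteq> Q0" "card R = m"
      using obtain_subset_with_card_n[of m Q0] by auto
    then show ?thesis using that[of R] separated_runs_subset[OF Q0(1)] True by auto
  qed (use Q0 that[of Q0] in auto)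
  have finQ: "finite Q" "Q \<noteq> {}" using Q cQ m by (auto simp: separated_runs_def split: if_splits)
  let ?A = "\<lambda>I. A(Suc j := fst I)" and ?B = "\<lambda>I. B(Suc j := snd I)"
  have hist': "history f \<gamma> L (Suc j) (?A I) (?B I)" if "I \<in> Q" for I
    using Suc.prems(2) Q that
    by (auto simp: history_def separated_runs_def l'_def le_Suc_eq less_Suc_eq)
  have SL: "straight_levels f \<gamma> L (Suc j) (?A I) (?B I) =
      (if ?st then insert j (straight_levels f \<gamma> L j A B) else straight_levels f \<gamma> L j A B)" for I
    by (auto simp: straight_levels_def less_Suc_eq)
  have finS: "finite (straight_levels f \<gamma> L j A B)" "j \<notin> straight_levels f \<gamma> L j A B"
    by (auto simp: straight_levels_def)
  have "straight_levels f \<gamma> L j A B \<subseteq> {..<j}" by (auto simp: straight_levels_def)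
  from card_mono[OF _ this] have cS: "card (straight_levels f \<gamma> L j A B) \<le> j" by simp
  have w': "w (Suc j) (?A I) (?B I) = w j A B / card Q" for I
    using finS cS by (simp add: w_def SL cQ Suc_diff_le)
  have w0: "0 < w j A B" using m by (simp add: w_def)
  \<comment> \<open>Multiplied by the mass of the piece, the branching bound says that mass times
    energy grows from level \<open>Suc j\<close> to level \<open>j\<close> by at most
    \<open>w j A B * e powr - s\<close>. These increments telescope, and replacing \<open>w\<close>
    by \<open>W\<close> makes their sum independent of the branch.\<close>
  define R where "R = (\<lambda>j. (\<Sum>i=j..<n. W i * (L / \<gamma> ^ Suc i / (8 * real m)) powr - s) + W n * l powr - s)"
  have "\<exists>p. set_pmf p \<subseteq> f ` {fst I..snd I} \<and>
      energy s l (measure_pmf p) \<le> ennreal (R (Suc j) / (w j A B / card Q))" if "I \<in> Q" for I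
    using Suc.hyps(1)[OF _ _ hist'[OF that]] Suc.hyps(2) Suc.prems(1) unfolding w' R_def by auto
  then obtain p where p: "\<And>I. I \<in> Q \<Longrightarrow> set_pmf (p I) \<subseteq> f ` {fst I..snd I}"
    and E: "\<And>I. I \<in> Q \<Longrightarrow> energy s l (measure_pmf (p I)) \<le> ennreal (R (Suc j) / (w j A B / card Q))"
    by metis
  let ?p = "bind_pmf (pmf_of_set Q) p"
  have Rpos: "0 \<le> R (Suc j)"
    unfolding R_def using W0 Suc.prems(1) by (intro add_nonneg_nonneg sum_nonneg mult_nonneg_nonneg) auto
  have sep: "e \<le> dist x y"
    if IJ: "I \<in> Q" "J \<in> Q" "I \<noteq> J" and xy: "x \<in> set_pmf (p I)" "y \<in> set_pmf (p J)" for I J x y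
  proof -
    obtain t t' where "t \<in> {fst I..snd I}" "x = f t" "t' \<in> {fst J..snd J}" "y = f t'"
      using p[OF IJ(1)] p[OF IJ(2)] xy by blast
    then show ?thesis using Q IJ unfolding separated_runs_def by blast
  qed
  have "energy s l (measure_pmf ?p)
      \<le> ennreal (R (Suc j) / (w j A B / card Q)) * ennreal (1 / card Q) + ennreal (e powr - s)"
    by (rule energy_bind_pmf_of_set[OF finQ e s E sep])
  also have "\<dots> = ennreal (R (Suc j) / w j A B + e powr - s)"
    using Rpos w0 finQ by (subst ennreal_mult[symmetric]) (auto simp: card_gt_0_iff simp flip: ennreal_plus)
  also have "\<dots> \<le> ennreal (R j / w j A B)"
  proof (rule ennreal_leI)
    have "R j = W j * e powr - s + R (Suc j)"
      using Suc.hyps(2) by (simp add: R_def sum.atLeast_Suc_lessThan e_def l'_def)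
    moreover have "w j A B * e powr - s \<le> W j * e powr - s"
      using W[OF Suc.prems] by (intro mult_right_mono) auto
    ultimately have "(R (Suc j) + w j A B * e powr - s) / w j A B \<le> R j / w j A B"
      using w0 by (intro divide_right_mono) auto
    then show "R (Suc j) / w j A B + e powr - s \<le> R j / w j A B"
      using w0 by (simp add: add_divide_distrib)
  qed
  finally have "energy s l (measure_pmf ?p) \<le> ennreal (R j / w j A B)" .
  moreover have "set_pmf ?p \<subseteq> f ` {A j..B j}"
  proof -
    have "{fst I..snd I} \<subseteq> {A j..B j}" if "I \<in> Q" for I
      using Q that by (auto simp: separated_runs_def)
    then have "set_pmf (p I) \<subseteq> f ` {A j..B j}" if "I \<in> Q" for I
      using p[OF that] image_mono[of "{fst I..snd I}" "{A j..B j}" f] that by blast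
    then show ?thesis using finQ by auto
  qed
  ultimately show ?case unfolding R_def by blast
qed

text \<open>With at most half of its \<open>k\<close> branchings straight, a piece has mass at most
  the \<open>k\<close>-th power of 1 / \<beta>, where \<beta> is the geometric mean of
  \<open>m\<close> and \<open>m + 1\<close>. Up to constants level \<open>i\<close> then contributes
  the \<open>i\<close>-th power of \<open>\<gamma> powr s / \<beta>\<close>, so the series
  converges, uniformly in depth and cutoff.\<close>

lemma sparse_energy:
  fixes m k\<^sub>0 :: nat and L s c :: real
  defines "\<gamma> \<equiv> real m + 1/4"
  assumes m: "m \<ge> 1" and L: "0 < L" and s: "0 < s" "\<gamma> powr s < sqrt (m * (m + 1))" and c: "0 < c"
  shows "\<exists>u>0. \<forall>(f :: real \<Rightarrow> 'a::metric_space) a b l n. path f \<longrightarrow> run f L a b \<longrightarrow> sparsely_straight f \<gamma> L k\<^sub>0 n \<longrightarrow>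
    0 < l \<longrightarrow> c * L / \<gamma> ^ Suc n \<le> l \<longrightarrow>
    (\<exists>p. set_pmf p \<subseteq> path_image f \<and> energy s l (measure_pmf p) \<le> ennreal u)"
proof -
  define \<beta> where "\<beta> = sqrt (m * (m + 1))"
  define x where "x = \<gamma> powr s / \<beta>"
  \<comment> \<open>The first summand is the geometric series over the levels, the second comes from
    the point masses at the cutoff; the factor in front is the price of the depths below
    \<open>k\<^sub>0\<close>.\<close>
  define u where "u = \<beta> ^ k\<^sub>0 * ((L / (8 * m * \<gamma>)) powr - s / (1 - x) + (c * L / \<gamma>) powr - s)"
  have \<beta>sq: "\<beta>\<^sup>2 = real m * real (m + 1)" by (simp add: \<beta>_def algebra_simps)
  have "1 * 1 \<le> real m * real (m + 1)" using m by (intro mult_mono) auto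
  then have \<beta>: "1 \<le> \<beta>" unfolding \<beta>_def by (intro real_le_rsqrt) (simp add: algebra_simps)
  have \<gamma>: "0 < \<gamma>" by (simp add: \<gamma>_def)
  have x: "0 < x" "x < 1" using s \<beta> \<gamma> by (auto simp: x_def \<beta>_def)
  have u: "0 < u"
    unfolding u_def using \<beta> x L m \<gamma> c by (intro mult_pos_pos add_pos_pos) auto
  have geom: "(a / \<gamma> ^ i) powr - s = a powr - s * (\<gamma> powr s) ^ i" if "0 < a" for a i
  proof -
    have "(a / \<gamma> ^ i) powr - s = a powr - s / (\<gamma> ^ i) powr - s"
      using that \<gamma> by (simp add: powr_divide)
    also have "(\<gamma> ^ i) powr - s = inverse ((\<gamma> powr s) ^ i)"
      using \<gamma> by (simp add: powr_minus powr_power powr_realpow[OF \<gamma>, symmetric] powr_powr mult.commute)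
    finally show ?thesis by (simp add: field_simps)
  qed
  have "\<exists>p. set_pmf p \<subseteq> path_image f \<and> energy s l (measure_pmf p) \<le> ennreal u"
    if f: "path f" and r: "run f L a b" and sp: "sparsely_straight f \<gamma> L k\<^sub>0 n"
      and l: "0 < l" "c * L / \<gamma> ^ Suc n \<le> l" for f :: "real \<Rightarrow> 'a" and a b l n
  proof -
    define W where "W k = \<beta> ^ k\<^sub>0 / \<beta> ^ k" for k
    let ?card = "\<lambda>k A B. card (straight_levels f \<gamma> L k A B)"
    have W: "(1 / real m) ^ ?card k A B * (1 / real (Suc m)) ^ (k - ?card k A B) \<le> W k"
      if k: "k \<le> n" and h: "history f \<gamma> L k A B" for A B k
    proof -
      let ?c = "?card k A B"
      have "straight_levels f \<gamma> L k A B \<subseteq> {..<k}" by (auto simp: straight_levels_def)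
      from card_mono[OF _ this] have cS: "?c \<le> k" by simp
      show ?thesis
      proof (cases "k\<^sub>0 \<le> k")
        case True
        then have c2: "2 * ?c \<le> k" using sp k h by (auto simp: sparsely_straight_def)
        have expo: "k - 2 * ?c + k = 2 * (k - ?c)" using c2 by simp
        \<comment> \<open>Comparing squares avoids fractional powers. Sparseness enters when the
          \<open>k - 2 * ?c\<close> surplus factors \<open>m\<close> are traded for
          \<open>Suc m\<close>.\<close>
        have "(\<beta> ^ k)\<^sup>2 = real m ^ k * real (Suc m) ^ k"
          by (simp add: \<beta>sq power_mult[symmetric] mult.commute[of k] power_mult_distrib)
             (simp add: power_mult \<beta>sq power_mult_distrib)
        also have "\<dots> = real m ^ (2 * ?c) * real m ^ (k - 2 * ?c) * real (Suc m) ^ k"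
          using c2 by (simp add: power_add[symmetric])
        also have "\<dots> \<le> real m ^ (2 * ?c) * real (Suc m) ^ (k - 2 * ?c) * real (Suc m) ^ k"
          by (intro mult_right_mono mult_left_mono power_mono) auto
        also have "\<dots> = real m ^ (2 * ?c) * real (Suc m) ^ (2 * (k - ?c))"
          by (simp only: mult.assoc power_add[symmetric] expo)
        also have "\<dots> = (real m ^ ?c * real (Suc m) ^ (k - ?c))\<^sup>2"
          by (simp add: power_mult_distrib power_mult[symmetric] mult.commute del: of_nat_Suc)
        finally have "\<beta> ^ k \<le> real m ^ ?c * real (Suc m) ^ (k - ?c)"
          by (rule power2_le_imp_le) simp
        then have "inverse (real m ^ ?c * real (Suc m) ^ (k - ?c)) \<le> inverse (\<beta> ^ k)"
          using \<beta> by (intro le_imp_inverse_le) auto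
        also have "\<dots> \<le> W k" using \<beta> by (simp add: W_def field_simps)
        finally show ?thesis by (simp add: power_divide inverse_eq_divide del: of_nat_Suc)
      next
        case False
        have "(1 / real m) ^ ?c * (1 / real (Suc m)) ^ (k - ?c) \<le> 1 * 1"
          using m by (intro mult_mono power_le_one) auto
        also have "\<dots> \<le> W k" using \<beta> False by (simp add: W_def power_increasing)
        finally show ?thesis .
      qed
    qed
    have h0: "history f \<gamma> L 0 (\<lambda>_. a) (\<lambda>_. b)" using r by (simp add: history_def)
    have W0: "0 \<le> W k" for k using \<beta> by (simp add: W_def)
    obtain p where p: "set_pmf p \<subseteq> f ` {a..b}"
      and E: "energy s l (measure_pmf p) \<le>
        ennreal ((\<Sum>i=0..<n. W i * (L / \<gamma> ^ Suc i / (8 * real m)) powr - s) + W n * l powr - s)"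
      using tree_energy[where n=n, OF f m L l(1) s(1) W0 W[unfolded \<gamma>_def] le0 h0[unfolded \<gamma>_def]]
      unfolding \<gamma>_def[symmetric] by (auto simp: straight_levels_def)
    have "(\<Sum>i=0..<n. W i * (L / \<gamma> ^ Suc i / (8 * real m)) powr - s)
        = \<beta> ^ k\<^sub>0 * (L / (8 * m * \<gamma>)) powr - s * (\<Sum>i<n. x ^ i)"
      unfolding sum_distrib_left atLeast0LessThan
    proof (rule sum.cong[OF refl])
      fix i
      have "L / \<gamma> ^ Suc i / (8 * real m) = (L / (8 * m * \<gamma>)) / \<gamma> ^ i" by simp
      then have "(L / \<gamma> ^ Suc i / (8 * real m)) powr - s = (L / (8 * m * \<gamma>)) powr - s * (\<gamma> powr s) ^ i"
        using geom[of "L / (8 * m * \<gamma>)" i] L m \<gamma> by (simp only:) simp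
      then show "W i * (L / \<gamma> ^ Suc i / (8 * real m)) powr - s
          = \<beta> ^ k\<^sub>0 * (L / (8 * m * \<gamma>)) powr - s * x ^ i"
        by (simp add: W_def x_def power_divide)
    qed
    also have "\<dots> \<le> \<beta> ^ k\<^sub>0 * (L / (8 * m * \<gamma>)) powr - s * (1 / (1 - x))"
    proof (rule mult_left_mono)
      have "(\<Sum>i<n. x ^ i) = (1 - x ^ n) / (1 - x)" using x by (simp add: sum_gp_strict)
      also have "\<dots> \<le> 1 / (1 - x)" using x by (intro divide_right_mono) auto
      finally show "(\<Sum>i<n. x ^ i) \<le> 1 / (1 - x)" .
    qed (use \<beta> in auto)
    finally have 1: "(\<Sum>i=0..<n. W i * (L / \<gamma> ^ Suc i / (8 * real m)) powr - s)
        \<le> \<beta> ^ k\<^sub>0 * (L / (8 * m * \<gamma>)) powr - s * (1 / (1 - x))" .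
    have "l powr - s \<le> (c * L / \<gamma> / \<gamma> ^ n) powr - s"
      using l s L c \<gamma> by (intro powr_mono2') (auto simp: mult.commute)
    also have "\<dots> = (c * L / \<gamma>) powr - s * (\<gamma> powr s) ^ n"
      using L c \<gamma> by (intro geom) auto
    finally have "W n * l powr - s \<le> W n * ((c * L / \<gamma>) powr - s * (\<gamma> powr s) ^ n)"
      using W0 by (intro mult_left_mono) auto
    also have "\<dots> = \<beta> ^ k\<^sub>0 * (c * L / \<gamma>) powr - s * x ^ n"
      by (simp add: W_def x_def power_divide)
    also have "\<dots> \<le> \<beta> ^ k\<^sub>0 * (c * L / \<gamma>) powr - s * 1"
      using x \<beta> by (intro mult_left_mono power_le_one) auto
    finally have "(\<Sum>i=0..<n. W i * (L / \<gamma> ^ Suc i / (8 * real m)) powr - s) + W n * l powr - s \<le> u"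
      using 1 by (simp add: u_def algebra_simps)
    then have "energy s l (measure_pmf p) \<le> ennreal u"
      using E by (meson ennreal_leI order_trans)
    moreover have "f ` {a..b} \<subseteq> path_image f"
      using r by (auto simp: run_def path_image_def)
    ultimately show ?thesis using p by blast
  qed
  then show ?thesis using u by blast
qed

section \<open>Traversed cylinders along a straight run\<close>

lemma outer_measure_of_le_1:
  assumes "prob_space M" "E \<subseteq> space M"
  shows "outer_measure_of M E \<le> 1"
  using outer_measure_of_mono[OF assms(2), of M] prob_space.emeasure_space_1[OF assms(1)] by simp

lemma Prob_mono:
  assumes M: "prob_space M" and E: "A \<subseteq> B" "B \<subseteq> space M"
  shows "Prob M A \<le> Prob M B"
proof -
  have "outer_measure_of M B < top"
    using outer_measure_of_le_1[OF M E(2)] ennreal_one_less_top by (rule le_less_trans)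
  then show ?thesis unfolding Prob_def
    by (intro enn2real_mono outer_measure_of_mono E)
qed

lemma Prob_hull:
  assumes E: "E \<subseteq> space M"
  obtains B where "B \<in> sets M" "E \<subseteq> B" "Prob M E = measure M B"
  using outer_measure_of_attain[OF E] unfolding Prob_def measure_def by metis

text \<open>Each event is replaced by a measurable hull of the same probability, which reduces the
  bound to subadditivity of the measure.\<close>

lemma Prob_UNION_le:
  assumes M: "prob_space M" and I: "finite I" and E: "\<And>i. i \<in> I \<Longrightarrow> E i \<subseteq> space M"
  shows "Prob M (\<Union>i\<in>I. E i) \<le> (\<Sum>i\<in>I. Prob M (E i))"
proof -
  interpret prob_space M by fact
  have "\<forall>i\<in>I. \<exists>B\<in>sets M. E i \<subseteq> B \<and> Prob M (E i) = measure M B"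
    using Prob_hull[OF E] by metis
  then obtain B where B: "\<And>i. i \<in> I \<Longrightarrow> B i \<in> sets M" "\<And>i. i \<in> I \<Longrightarrow> E i \<subseteq> B i"
    "\<And>i. i \<in> I \<Longrightarrow> Prob M (E i) = measure M (B i)" by metis
  have U: "(\<Union>i\<in>I. B i) \<in> sets M" using B(1) I by auto
  have "Prob M (\<Union>i\<in>I. E i) \<le> Prob M (\<Union>i\<in>I. B i)"
    using B(2) sets.sets_into_space[OF U] by (intro Prob_mono[OF M]) auto
  also have "\<dots> = measure M (\<Union>i\<in>I. B i)" using U by (rule Prob_eq_measure)
  also have "\<dots> \<le> (\<Sum>i\<in>I. measure M (B i))"
    using B(1) I by (intro finite_measure_subadditive_finite) auto
  finally show ?thesis using B(3) by simp
qed

lemma Prob_UNION_le_card: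
  fixes b :: real
  assumes M: "prob_space M" and I: "finite I" and E: "\<And>i. i \<in> I \<Longrightarrow> E i \<subseteq> space M"
    and b: "\<And>i. i \<in> I \<Longrightarrow> Prob M (E i) \<le> b"
  shows "Prob M (\<Union>i\<in>I. E i) \<le> card I * b"
  using Prob_UNION_le[OF M I E] sum_bounded_above[of I "\<lambda>i. Prob M (E i)" b] b by force

section \<open>Cylinders and their axes\<close>

definition perp :: "'a::real_inner \<Rightarrow> 'a \<Rightarrow> 'a" where
  "perp u x = x - (x \<bullet> u) *\<^sub>R u"

lemma cylinder_perp:
  "cylinder a u l w = {x. 0 \<le> (x - a) \<bullet> u \<and> (x - a) \<bullet> u \<le> l \<and> norm (perp u (x - a)) \<le> w / 2}"
  by (simp add: cylinder_def perp_def)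

lemma perp_add_axis: "norm u = 1 \<Longrightarrow> perp u (x + c *\<^sub>R u) = perp u x"
  by (simp add: perp_def inner_add_left algebra_simps flip: power2_norm_eq_inner)

lemma perp_diff: "perp u (x - y) = perp u x - perp u y"
  by (simp add: perp_def inner_diff_left algebra_simps)

lemma norm_le_axis_perp:
  assumes "norm u = 1"
  shows "norm x \<le> \<bar>x \<bullet> u\<bar> + norm (perp u x)"
  using norm_triangle_ineq[of "(x \<bullet> u) *\<^sub>R u" "perp u x"] assms by (simp add: perp_def)

lemma abs_inner_le_norm: "norm u = 1 \<Longrightarrow> \<bar>x \<bullet> u\<bar> \<le> norm x"
  using Cauchy_Schwarz_ineq2[of x u] by simp

lemma cylinder_dist_le:
  assumes u: "norm u = 1" and x: "x \<in> cylinder a u l w" and y: "y \<in> cylinder a u l w"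
  shows "dist x y \<le> l + w"
proof -
  have "\<bar>(x - y) \<bullet> u\<bar> \<le> l"
    using x y by (auto simp: cylinder_def inner_diff_left)
  moreover have "norm (perp u (x - y)) \<le> w"
    using x y norm_triangle_ineq4[of "perp u (x - a)" "perp u (y - a)"]
    by (simp add: cylinder_perp flip: perp_diff)
  ultimately show ?thesis using norm_le_axis_perp[OF u, of "x - y"] by (simp add: dist_norm)
qed

lemma mem_cylinder_base: "0 \<le> l \<Longrightarrow> 0 \<le> w \<Longrightarrow> a \<in> cylinder a u l w"
  by (simp add: cylinder_def)

lemma diameter_cylinder_le:
  assumes "norm u = 1" "0 \<le> l" "0 \<le> w"
  shows "diameter (cylinder a u l w) \<le> l + w"
  using cylinder_dist_le[OF assms(1)] mem_cylinder_base[OF assms(2,3), of a u]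
  by (intro diameter_le) (auto simp: dist_norm)

text \<open>Reflecting the second leg at the axis turns the broken line from \<open>p\<close> over \<open>y\<close> to \<open>q\<close> into a
  single vector with transverse component \<open>2 perp\<close>.\<close>

lemma ellipsoid_perp:
  assumes u: "norm u = 1" and d: "0 \<le> d"
    and y: "norm y + norm (d *\<^sub>R u - y) \<le> d + k"
  shows "4 * (norm (perp u y))\<^sup>2 \<le> 2 * d * k + k\<^sup>2"
proof -
  define v where "v = perp u y"
  define a where "a = y \<bullet> u"
  have uu: "u \<bullet> u = 1" using u by (simp flip: power2_norm_eq_inner)
  have vu: "v \<bullet> u = 0" "u \<bullet> v = 0"
    by (simp_all add: v_def perp_def inner_diff_left inner_diff_right uu inner_commute)
  have sq: "(norm (x *\<^sub>R u + z *\<^sub>R v))\<^sup>2 = x\<^sup>2 + z\<^sup>2 * (norm v)\<^sup>2" for x z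
    unfolding power2_norm_eq_inner
    by (simp add: inner_add_left inner_add_right uu vu power2_eq_square)
  have "(norm (d *\<^sub>R u - y))\<^sup>2 = (norm ((d - a) *\<^sub>R u + (-1) *\<^sub>R v))\<^sup>2"
    by (simp add: v_def perp_def a_def algebra_simps)
  also have "\<dots> = (norm ((d - a) *\<^sub>R u + 1 *\<^sub>R v))\<^sup>2" unfolding sq by simp
  finally have refl: "norm (d *\<^sub>R u - y) = norm ((d - a) *\<^sub>R u + v)" by simp
  have "d *\<^sub>R u + 2 *\<^sub>R v = y + ((d - a) *\<^sub>R u + v)"
    by (simp add: v_def perp_def a_def algebra_simps scaleR_2) (simp flip: scaleR_left_distrib)
  then have "norm (d *\<^sub>R u + 2 *\<^sub>R v) \<le> d + k"
    using norm_triangle_ineq[of y "(d - a) *\<^sub>R u + v"] y refl by simp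
  then have "(norm (d *\<^sub>R u + 2 *\<^sub>R v))\<^sup>2 \<le> (d + k)\<^sup>2" by (intro power_mono) auto
  then have "d\<^sup>2 + 4 * (norm v)\<^sup>2 \<le> (d + k)\<^sup>2" using sq[of d 2] by simp
  then show ?thesis unfolding power2_sum v_def by (simp add: algebra_simps)
qed

text \<open>Take the first time the axial coordinate reaches the far face and, before it, the last
  time at the near face. In between, the coordinate stays between the faces by the intermediate
  value theorem.\<close>

lemma traverses_of_axis:
  fixes f :: "real \<Rightarrow> 'a::real_inner"
  assumes f: "path f" "f \<in> C" and u: "norm u = 1" and ab: "0 \<le> a" "a \<le> b" "b \<le> 1" and l: "0 \<le> l"
    and ends: "(f a - p) \<bullet> u \<le> s" "s + l \<le> (f b - p) \<bullet> u"
    and perp: "\<And>t. t \<in> {a..b} \<Longrightarrow> norm (perp u (f t - p)) \<le> w / 2"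
  shows "traverses C (p + s *\<^sub>R u) u l w"
proof -
  let ?g = "\<lambda>t. (f t - p) \<bullet> u"
  have cont: "continuous_on {a..b} ?g"
    using f(1) ab by (auto simp: path_def intro!: continuous_intros elim: continuous_on_subset)
  obtain t1 where t1: "a \<le> t1" "t1 \<le> b" "?g t1 = s + l"
    using IVT'[of ?g a "s + l" b] ends l ab cont by auto
  define S1 where "S1 = {t\<in>{a..b}. ?g t = s + l}"
  have "compact S1"
    using continuous_closed_preimage[OF cont closed_atLeastAtMost closed_singleton[of "s + l"]]
    by (simp add: S1_def compact_eq_bounded_closed vimage_def Int_def bounded_subset[OF bounded_closed_interval[of a b]] subset_eq)
  moreover have "t1 \<in> S1" using t1 by (simp add: S1_def)
  ultimately obtain e where e: "e \<in> S1" and least: "\<And>t. t \<in> S1 \<Longrightarrow> e \<le> t"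
    using compact_attains_inf[of S1] by blast
  have le: "?g t \<le> s + l" if t: "t \<in> {a..e}" for t
  proof (rule ccontr)
    assume "\<not> ?g t \<le> s + l"
    then obtain t' where "a \<le> t'" "t' \<le> t" "?g t' = s + l"
      using IVT'[of ?g a "s + l" t] ends l t e continuous_on_subset[OF cont, of "{a..t}"]
      by (auto simp: S1_def)
    then have "t' \<in> S1" "t' \<noteq> e \<or> t = e" using t e by (auto simp: S1_def)
    then show False using least[of t'] \<open>t' \<le> t\<close> t e \<open>\<not> ?g t \<le> s + l\<close> by (auto simp: S1_def)
  qed
  have cont': "continuous_on {a..e} ?g" using cont e by (auto simp: S1_def elim: continuous_on_subset)
  define S0 where "S0 = {t\<in>{a..e}. ?g t = s}"
  have "compact S0"
    using continuous_closed_preimage[OF cont' closed_atLeastAtMost closed_singleton[of s]]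
    by (simp add: S0_def compact_eq_bounded_closed vimage_def Int_def bounded_subset[OF bounded_closed_interval[of a e]] subset_eq)
  moreover obtain t0 where "t0 \<in> S0"
    using IVT'[of ?g a s e] ends l e cont' by (auto simp: S0_def S1_def)
  ultimately obtain c where c: "c \<in> S0" and greatest: "\<And>t. t \<in> S0 \<Longrightarrow> t \<le> c"
    using compact_attains_sup[of S0] by blast
  have ge: "s \<le> ?g t" if t: "t \<in> {c..e}" for t
  proof (rule ccontr)
    assume "\<not> s \<le> ?g t"
    then obtain t' where "t \<le> t'" "t' \<le> e" "?g t' = s"
      using IVT'[of ?g t s e] l t e c continuous_on_subset[OF cont', of "{t..e}"]
      by (auto simp: S1_def S0_def)
    then have "t' \<in> S0" using t c by (auto simp: S0_def)
    then have "t' = t" using greatest[of t'] \<open>t \<le> t'\<close> t by auto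
    then show False using \<open>?g t' = s\<close> \<open>\<not> s \<le> ?g t\<close> by auto
  qed
  have axis: "(x - (p + s *\<^sub>R u)) \<bullet> u = (x - p) \<bullet> u - s" for x
    using u by (simp add: inner_diff_left inner_add_left flip: power2_norm_eq_inner)
  have pp: "perp u (x - (p + s *\<^sub>R u)) = perp u (x - p)" for x
    using perp_add_axis[OF u, of "x - p" "- s"] by (simp add: algebra_simps)
  have ce: "a \<le> c" "c \<le> e" "e \<le> b" "?g c = s" "?g e = s + l" using c e by (auto simp: S0_def S1_def)
  have "f ` {c..e} \<subseteq> cylinder (p + s *\<^sub>R u) u l w"
  proof clarify
    fix t assume t: "t \<in> {c..e}"
    then have "t \<in> {a..e}" "t \<in> {a..b}" using ce by auto
    then show "f t \<in> cylinder (p + s *\<^sub>R u) u l w"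
      using le[of t] ge[OF t] perp[of t] by (simp add: cylinder_perp axis pp)
  qed
  then show ?thesis unfolding traverses_def
    using f(2) ce ab by (intro bexI[of _ f] bexI[of _ c] bexI[of _ e]) (auto simp: axis)
qed

text \<open>All smaller scales are located near \<open>x\<close>. The cylinders of level \<open>L\<close> therefore lie along the first or
  along the last half of the segment from \<open>p\<close> to \<open>q\<close>, whichever is far from \<open>x\<close>.\<close>

definition slot :: "real \<Rightarrow> real \<Rightarrow> 'a::real_inner \<Rightarrow> 'a \<Rightarrow> 'a \<Rightarrow> real \<Rightarrow> nat \<Rightarrow> real" where
  "slot c \<sigma> x p q L i =
     (if L / 2 \<le> (x - p) \<bullet> sgn (q - p) then L / 8 else 5 * L / 8) + i * (c * L * (2 + 1 / \<sigma>))"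

definition slot_base :: "real \<Rightarrow> real \<Rightarrow> 'a::real_inner \<Rightarrow> 'a \<Rightarrow> 'a \<Rightarrow> real \<Rightarrow> nat \<Rightarrow> 'a" where
  "slot_base c \<sigma> x p q L i = p + slot c \<sigma> x p q L i *\<^sub>R sgn (q - p)"

definition slot_cylinder :: "real \<Rightarrow> real \<Rightarrow> 'a::real_inner \<Rightarrow> 'a \<Rightarrow> 'a \<Rightarrow> real \<Rightarrow> nat \<Rightarrow> 'a set" where
  "slot_cylinder c \<sigma> x p q L i =
     cylinder (slot_base c \<sigma> x p q L i) (sgn (q - p)) (c * L) (c * L / \<sigma>)"

text \<open>The slots occupy an axial interval of length \<open>L / 8\<close>. Either choice is at
  axial distance at least \<open>L / 8\<close> from \<open>x\<close> and keeps away from the ends of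
  the run, which are known only approximately. The spacing leaves gaps of
  \<open>c * L + c * L / \<sigma>\<close>, an upper bound for the diameter of a cylinder.\<close>

lemma slot_bounds:
  assumes c: "0 < c" "0 < \<sigma>" "real N * (c * (2 + 1 / \<sigma>)) \<le> 1 / 8" and L: "0 < L" and i: "i < N"
  shows "slot c \<sigma> x p q L i \<ge> (if L / 2 \<le> (x - p) \<bullet> sgn (q - p) then L / 8 else 5 * L / 8)"
    "slot c \<sigma> x p q L i + c * L \<le> (if L / 2 \<le> (x - p) \<bullet> sgn (q - p) then L / 4 else 3 * L / 4)"
proof -
  have pos: "0 \<le> c * L * (2 + 1 / \<sigma>)" using c L by (intro mult_nonneg_nonneg) auto
  then show "slot c \<sigma> x p q L i \<ge> (if L / 2 \<le> (x - p) \<bullet> sgn (q - p) then L / 8 else 5 * L / 8)"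
    by (simp add: slot_def)
  let ?D = "c * L * (2 + 1 / \<sigma>)"
  have "c * L \<le> ?D" using c L by (simp add: field_simps)
  then have "i * ?D + c * L \<le> i * ?D + ?D" by (rule add_left_mono)
  also have "\<dots> = real (Suc i) * ?D" by (simp only: of_nat_Suc distrib_right)
  also have "\<dots> \<le> real N * (c * L * (2 + 1 / \<sigma>))"
    using i pos by (intro mult_right_mono) auto
  also have "\<dots> = real N * (c * (2 + 1 / \<sigma>)) * L" by (simp add: algebra_simps)
  also have "\<dots> \<le> 1 / 8 * L" using c L by (intro mult_right_mono) auto
  finally have X: "i * ?D + c * L \<le> 1 / 8 * L" .
  define X where "X = i * ?D"
  show "slot c \<sigma> x p q L i + c * L \<le> (if L / 2 \<le> (x - p) \<bullet> sgn (q - p) then L / 4 else 3 * L / 4)"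
    using X unfolding slot_def X_def[symmetric] by auto
qed

text \<open>The points \<open>p\<close> and \<open>q\<close> stand for rounded ends of the run, so
  that finitely many cylinders will do for all curves. The value of \<open>c\<close> makes the
  cylinder radius \<open>4 * L / sqrt \<gamma>\<close>, a bound for the transverse extent of the
  ellipsoid, and the aspect ratio then fixes the length.\<close>

lemma straight_run_traverses:
  fixes f :: "real \<Rightarrow> 'a::real_inner"
  assumes f: "path f" "f \<in> C" and r: "run f L a b" and st: "straight f \<gamma> L a b"
    and p: "dist (f a) p \<le> L / \<gamma>" and q: "dist (f b) q \<le> L / \<gamma>"
    and \<gamma>: "100 \<le> \<gamma>" and L: "0 < L" and \<sigma>: "0 < \<sigma>" and c: "c = 8 * \<sigma> / sqrt \<gamma>"
    and N: "real N * (c * (2 + 1 / \<sigma>)) \<le> 1 / 8" and i: "i < N"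
  shows "traverses C (slot_base c \<sigma> x p q L i) (sgn (q - p)) (c * L) (c * L / \<sigma>)"
proof -
  define d where "d = dist p q"
  define u where "u = sgn (q - p)"
  define e where "e = L / \<gamma>"
  have e: "0 < e" "e \<le> L / 100" using L \<gamma> by (auto simp: e_def field_simps)
  have fab: "dist (f a) (f b) = L" using r by (simp add: run_def)
  have d1: "L - 2 * e \<le> d"
    using fab p q dist_triangle[of "f a" "f b" p] dist_triangle[of p "f b" q]
    by (simp add: d_def e_def dist_commute)
  have d2: "d \<le> L + 2 * e"
    using fab p q dist_triangle[of p q "f a"] dist_triangle[of "f a" q "f b"]
    by (simp add: d_def e_def dist_commute)
  have d0: "0 < d" using d1 e L by linarith
  then have u: "norm u = 1" by (auto simp: u_def d_def norm_sgn)
  have qp: "q - p = d *\<^sub>R u" using d0 by (simp add: u_def sgn_div_norm d_def dist_norm norm_minus_commute)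
  have c0: "0 < c" using \<sigma> \<gamma> by (simp add: c)
  note sb = slot_bounds[OF c0 \<sigma> N L i, of x p q]
  show ?thesis unfolding slot_base_def u_def[symmetric]
  proof (rule traverses_of_axis[OF f u])
    show "0 \<le> a" "a \<le> b" "b \<le> 1" using r by (auto simp: run_def)
    show "0 \<le> c * L" using c0 L by simp
    have "(f a - p) \<bullet> u \<le> e"
      using abs_inner_le_norm[OF u, of "f a - p"] p by (simp add: dist_norm e_def)
    also have "e \<le> slot c \<sigma> x p q L i" using sb(1) e L by (auto split: if_splits)
    finally show "(f a - p) \<bullet> u \<le> slot c \<sigma> x p q L i" .
    have "slot c \<sigma> x p q L i + c * L \<le> 3 * L / 4" using sb(2) L by (auto split: if_splits)
    also have "\<dots> \<le> d - e" using d1 e L by linarith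
    also have "d = (q - p) \<bullet> u" using u by (simp add: qp flip: power2_norm_eq_inner)
    also have "(q - p) \<bullet> u - e \<le> (f b - p) \<bullet> u"
      using abs_inner_le_norm[OF u, of "f b - q"] q by (simp add: dist_norm e_def inner_diff_left)
    finally show "slot c \<sigma> x p q L i + c * L \<le> (f b - p) \<bullet> u" .
    fix t assume t: "t \<in> {a..b}"
    have "dist (f a) (f t) + dist (f t) (f b) \<le> L + 7 * e"
      using st t by (auto simp: straight_def e_def)
    \<comment> \<open>Of the \<open>11 * e\<close>, seven come from straightness, two from moving
      the foci to \<open>p\<close> and \<open>q\<close>, and two from
      \<open>d \<ge> L - 2 * e\<close>.\<close>
    then have "norm (f t - p) + norm (d *\<^sub>R u - (f t - p)) \<le> d + 11 * e"
      using d1 p q dist_triangle[of "f t" p "f a"] dist_triangle[of "f t" q "f b"]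
      unfolding qp[symmetric] by (simp add: dist_norm e_def norm_minus_commute)
    from ellipsoid_perp[OF u less_imp_le[OF d0] this]
    have "4 * (norm (perp u (f t - p)))\<^sup>2 \<le> 2 * d * (11 * e) + (11 * e)\<^sup>2" .
    also have "\<dots> = 22 * (d * e) + 121 * (e * e)" by (simp add: power2_eq_square)
    also have "\<dots> \<le> 22 * (2 * L * e) + 121 * (L / 100 * e)"
      using d2 e L by (intro add_mono mult_left_mono mult_right_mono) auto
    also have "\<dots> \<le> 4 * (16 * L * e)" using L e by simp
    also have "16 * L * e = (4 * L / sqrt \<gamma>)\<^sup>2"
      using \<gamma> by (simp add: e_def power_divide power2_eq_square)
    finally have "(norm (perp u (f t - p)))\<^sup>2 \<le> (4 * L / sqrt \<gamma>)\<^sup>2" by simp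
    then have "norm (perp u (f t - p)) \<le> 4 * L / sqrt \<gamma>"
      by (rule power2_le_imp_le) (use L \<gamma> in auto)
    then show "norm (perp u (f t - p)) \<le> c * L / \<sigma> / 2" using \<sigma> by (simp add: c)
  qed
qed

lemma slot_cylinder_axis:
  assumes u: "p \<noteq> q" and y: "y \<in> slot_cylinder c \<sigma> x p q L i"
  shows "slot c \<sigma> x p q L i \<le> (y - p) \<bullet> sgn (q - p)" "(y - p) \<bullet> sgn (q - p) \<le> slot c \<sigma> x p q L i + c * L"
    "norm (perp (sgn (q - p)) (y - p)) \<le> c * L / \<sigma> / 2"
proof -
  let ?u = "sgn (q - p)" and ?s = "slot c \<sigma> x p q L i"
  have u: "norm ?u = 1" using u by (simp add: norm_sgn)
  have axis: "(y - (p + ?s *\<^sub>R ?u)) \<bullet> ?u = (y - p) \<bullet> ?u - ?s"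
    using u by (simp add: inner_diff_left inner_add_left flip: power2_norm_eq_inner)
  have "perp ?u (y - (p + ?s *\<^sub>R ?u)) = perp ?u (y - p)"
    using perp_add_axis[OF u, of "y - p" "- ?s"] by (simp add: algebra_simps)
  then show "?s \<le> (y - p) \<bullet> ?u" "(y - p) \<bullet> ?u \<le> ?s + c * L" "norm (perp ?u (y - p)) \<le> c * L / \<sigma> / 2"
    using y by (auto simp: slot_cylinder_def slot_base_def cylinder_perp axis)
qed

lemma slot_cylinder_far:
  assumes c: "0 < c" "0 < \<sigma>" "real N * (c * (2 + 1 / \<sigma>)) \<le> 1 / 8" and L: "0 < L" and i: "i < N"
    and pq: "p \<noteq> q" and y: "y \<in> slot_cylinder c \<sigma> x p q L i"
  shows "L / 8 \<le> dist y x"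
proof -
  let ?u = "sgn (q - p)"
  note sb = slot_bounds[OF c L i, of x p q]
  have "L / 8 \<le> \<bar>(y - p) \<bullet> ?u - (x - p) \<bullet> ?u\<bar>"
    using sb slot_cylinder_axis[OF pq y] L by (auto split: if_splits)
  also have "\<dots> = \<bar>(y - x) \<bullet> ?u\<bar>" by (simp add: inner_diff_left)
  also have "\<dots> \<le> norm (y - x)" using pq by (intro abs_inner_le_norm) (simp add: norm_sgn)
  finally show ?thesis by (simp add: dist_norm)
qed

lemma slot_cylinder_near:
  assumes c: "0 < c" "0 < \<sigma>" "real N * (c * (2 + 1 / \<sigma>)) \<le> 1 / 8" and L: "0 < L" and i: "i < N"
    and pq: "p \<noteq> q" and y: "y \<in> slot_cylinder c \<sigma> x p q L i"
  shows "dist y p \<le> L"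
proof -
  let ?u = "sgn (q - p)"
  note sb = slot_bounds[OF c L i, of x p q]
  have "1 * (c * (2 + 1 / \<sigma>)) \<le> real N * (c * (2 + 1 / \<sigma>))"
    using i c by (intro mult_right_mono) auto
  from order_trans[OF this c(3)] have "c * (2 + 1 / \<sigma>) \<le> 1 / 8" by (simp only: mult_1)
  then have "c * (2 + 1 / \<sigma>) * L \<le> 1 / 8 * L" using L by (intro mult_right_mono) auto
  moreover have "c * L / \<sigma> \<le> c * (2 + 1 / \<sigma>) * L" using c L by (simp add: field_simps)
  ultimately have "c * L / \<sigma> \<le> L / 8" by simp
  then have "norm (perp ?u (y - p)) \<le> L / 8 / 2"
    using slot_cylinder_axis(3)[OF pq y] by (elim order_trans) (intro divide_right_mono, auto)
  moreover have "\<bar>(y - p) \<bullet> ?u\<bar> \<le> 3 * L / 4"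
    using sb slot_cylinder_axis[OF pq y] L by (auto split: if_splits)
  moreover have "norm (y - p) \<le> \<bar>(y - p) \<bullet> ?u\<bar> + norm (perp ?u (y - p))"
    using pq by (intro norm_le_axis_perp) (simp add: norm_sgn)
  ultimately show ?thesis using L by (simp add: dist_norm)
qed

lemma slot_cylinder_same_level:
  assumes c: "0 < c" "0 < \<sigma>" and L: "0 < L" and i: "i < j" and pq: "p \<noteq> q"
    and y: "y \<in> slot_cylinder c \<sigma> x p q L i" and z: "z \<in> slot_cylinder c \<sigma> x p q L j"
  shows "c * L + c * L / \<sigma> \<le> dist y z"
proof -
  let ?u = "sgn (q - p)" and ?D = "c * L * (2 + 1 / \<sigma>)"
  have "real (Suc i) * ?D \<le> real j * ?D" using i c L by (intro mult_right_mono) auto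
  then have "i * ?D + ?D \<le> real j * ?D" by (simp only: of_nat_Suc distrib_right mult_1)
  then have "slot c \<sigma> x p q L i + ?D \<le> slot c \<sigma> x p q L j"
    unfolding slot_def by linarith
  moreover have "?D = c * L + (c * L + c * L / \<sigma>)" by (simp add: algebra_simps)
  ultimately have "c * L + c * L / \<sigma> \<le> (z - p) \<bullet> ?u - (y - p) \<bullet> ?u"
    using slot_cylinder_axis(2)[OF pq y] slot_cylinder_axis(1)[OF pq z] by linarith
  also have "\<dots> = (z - y) \<bullet> ?u" by (simp add: inner_diff_left)
  also have "\<dots> \<le> norm (z - y)"
    using pq abs_inner_le_norm[of ?u "z - y"] by (simp add: norm_sgn)
  finally show ?thesis by (simp add: dist_norm norm_minus_commute)
qed

text \<open>The coarse cylinder is at distance at least \<open>L / 8\<close> from \<open>x\<close>,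
  the fine one lies within \<open>5 * L'\<close> of \<open>x\<close>, and \<open>L'\<close> is at
  most \<open>L / 100\<close>. As \<open>N \<ge> 2\<close>, length plus width of the coarse cylinder
  is at most \<open>L / 16\<close>, and this dominates both diameters.\<close>

lemma slot_cylinder_cross_level:
  assumes c: "0 < c" "0 < \<sigma>" "real N * (c * (2 + 1 / \<sigma>)) \<le> 1 / 8" and N: "2 \<le> N"
    and L: "0 < L'" "100 * L' \<le> L" and i: "i < N" "j < N" and pq: "p \<noteq> q" "p' \<noteq> q'"
    and x: "dist p' x \<le> 4 * L'"
    and y: "y \<in> slot_cylinder c \<sigma> x p q L i" and z: "z \<in> slot_cylinder c \<sigma> x p' q' L' j"
  shows "c * L + c * L / \<sigma> \<le> dist y z"
proof -
  have L0: "0 < L" using L by linarith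
  have "2 * (c * (2 + 1 / \<sigma>)) \<le> real N * (c * (2 + 1 / \<sigma>))"
    using N c by (intro mult_right_mono) auto
  from order_trans[OF this c(3)] have "c * (2 + 1 / \<sigma>) \<le> 1 / 16" by linarith
  then have "c * (2 + 1 / \<sigma>) * L \<le> 1 / 16 * L" using L0 by (intro mult_right_mono) auto
  moreover have "c * L + c * L / \<sigma> \<le> c * (2 + 1 / \<sigma>) * L" using c L0 by (simp add: field_simps)
  ultimately have "c * L + c * L / \<sigma> \<le> L / 16" by simp
  also have "L / 16 \<le> L / 8 - 5 * L'" using L by linarith
  also have "\<dots> \<le> dist y x - dist z x"
    using slot_cylinder_far[OF c L0 i(1) pq(1) y] slot_cylinder_near[OF c L(1) i(2) pq(2) z] x
      dist_triangle[of z x p'] by (simp add: dist_commute)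
  also have "\<dots> \<le> dist y z" using dist_triangle[of y x z] by (simp add: dist_commute)
  finally show ?thesis .
qed

section \<open>The probability of many nested straight runs\<close>

text \<open>A cubic grid of mesh \<open>\<eta> / d\<close>. The constant must not depend on
  \<open>\<eta>\<close>, because the same bound has to serve at every depth.\<close>

lemma finite_net_cball:
  assumes R: "0 < R"
  shows "\<exists>c>0. \<forall>\<eta>. 0 < \<eta> \<longrightarrow> \<eta> \<le> 1 \<longrightarrow> (\<exists>X. finite X \<and> real (card X) \<le> (c / \<eta>) ^ DIM('a) \<and>
    (\<forall>y\<in>cball (0::'a::euclidean_space) R. \<exists>x\<in>X. dist y x \<le> \<eta>))"
proof -
  define d where "d = real DIM('a)"
  have d: "1 \<le> d" using DIM_positive[where 'a='a] unfolding d_def by linarith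
  have "\<exists>X. finite X \<and> real (card X) \<le> ((2 * R * d + 5) / \<eta>) ^ DIM('a) \<and>
    (\<forall>y\<in>cball (0::'a) R. \<exists>x\<in>X. dist y x \<le> \<eta>)" if \<eta>: "0 < \<eta>" "\<eta> \<le> 1" for \<eta>
  proof -
    define h where "h = \<eta> / d"
    define N where "N = \<lceil>R / h\<rceil> + 1"
    define G where "G = (Basis :: 'a set) \<rightarrow>\<^sub>E {- N..N}"
    define P where "P k = (\<Sum>b\<in>Basis. (h * of_int (k b)) *\<^sub>R b)" for k :: "'a \<Rightarrow> int"
    have h: "0 < h" "d * h = \<eta>" using d \<eta> by (auto simp: h_def)
    have N: "0 \<le> N" "real_of_int N \<le> R / h + 2" "R / h \<le> of_int N - 1"
    proof -
      have "0 \<le> R / h" using h R by simp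
      then show "0 \<le> N" unfolding N_def by (simp add: add_nonneg_nonneg)
      show "real_of_int N \<le> R / h + 2"
        using of_int_ceiling_le_add_one[of "R / h"] unfolding N_def of_int_add of_int_1 by linarith
      show "R / h \<le> of_int N - 1"
        using le_of_int_ceiling[of "R / h"] unfolding N_def of_int_add of_int_1 by linarith
    qed
    have fin: "finite G" unfolding G_def by (intro finite_PiE) auto
    have "card (P ` G) \<le> card G" using fin by (rule card_image_le)
    also have "card G = nat (2 * N + 1) ^ DIM('a)"
      unfolding G_def by (simp add: card_PiE algebra_simps)
    finally have "real (card (P ` G)) \<le> real (nat (2 * N + 1)) ^ DIM('a)"
      by (simp only: of_nat_power[symmetric] of_nat_le_iff)
    also have "\<dots> \<le> ((2 * R * d + 5) / \<eta>) ^ DIM('a)"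
    proof (rule power_mono)
      have "real (nat (2 * N + 1)) = 2 * of_int N + 1" using N by simp
      also have "\<dots> \<le> 2 * (R / h + 2) + 1" using N(2) by (intro add_mono mult_left_mono) auto
      also have "\<dots> = 2 * R * d / \<eta> + 5" using d by (simp add: h_def)
      also have "\<dots> \<le> 2 * R * d / \<eta> + 5 / \<eta>" using \<eta> by (simp add: field_simps)
      finally show "real (nat (2 * N + 1)) \<le> (2 * R * d + 5) / \<eta>" by (simp add: add_divide_distrib)
    qed simp
    finally have card: "real (card (P ` G)) \<le> ((2 * R * d + 5) / \<eta>) ^ DIM('a)" .
    have "\<exists>x\<in>P ` G. dist y x \<le> \<eta>" if y: "y \<in> cball 0 R" for y
    proof -
      define k where "k = restrict (\<lambda>b. \<lfloor>y \<bullet> b / h\<rfloor>) Basis"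
      have "k b \<in> {- N..N}" if b: "b \<in> Basis" for b
      proof -
        have "\<bar>y \<bullet> b\<bar> \<le> R" using Basis_le_norm[OF b, of y] y by simp
        then have "\<bar>y \<bullet> b / h\<bar> \<le> R / h" using h by (simp add: abs_div divide_right_mono)
        then have "- (y \<bullet> b / h) \<le> R / h" "y \<bullet> b / h \<le> R / h" by (simp_all only: abs_le_iff)
        then have "of_int (- N) \<le> y \<bullet> b / h" "y \<bullet> b / h \<le> of_int N"
          using N(3) unfolding of_int_minus by linarith+
        then have "- N \<le> \<lfloor>y \<bullet> b / h\<rfloor>" "\<lfloor>y \<bullet> b / h\<rfloor> \<le> N"
          by (auto simp: le_floor_iff floor_le_iff)
        then show ?thesis using b by (simp add: k_def)
      qed
      then have kG: "k \<in> G" by (auto simp: G_def k_def)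
      have coord: "\<bar>(y - P k) \<bullet> b\<bar> \<le> h" if b: "b \<in> Basis" for b
      proof -
        have "P k \<bullet> b = h * of_int \<lfloor>y \<bullet> b / h\<rfloor>"
          using b by (simp add: P_def inner_sum_left inner_Basis k_def if_distrib sum.If_cases cong: if_cong)
        moreover have "h * of_int \<lfloor>y \<bullet> b / h\<rfloor> \<le> h * (y \<bullet> b / h)"
          "h * (y \<bullet> b / h) \<le> h * (of_int \<lfloor>y \<bullet> b / h\<rfloor> + 1)"
          using h by (intro mult_left_mono, linarith, simp)+
        ultimately show ?thesis using h by (auto simp: inner_diff_left algebra_simps abs_le_iff)
      qed
      have "norm (y - P k) \<le> (\<Sum>b\<in>Basis. \<bar>(y - P k) \<bullet> b\<bar>)" by (rule norm_le_l1)
      also have "\<dots> \<le> d * h" using sum_mono[OF coord] unfolding d_def by simp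
      finally show ?thesis using kG h by (auto simp: dist_norm)
    qed
    then show ?thesis using fin card by (intro exI[of _ "P ` G"]) auto
  qed
  then show ?thesis using R d by (intro exI[of _ "2 * R * d + 5"]) (auto intro: add_nonneg_pos)
qed

lemma history_nested:
  assumes h: "history f \<gamma> L k A B" and "i \<le> j" "j \<le> k"
  shows "A i \<le> A j \<and> B j \<le> B i"
  using assms(2,3)
proof (induction j rule: dec_induct)
  case (step n)
  then have "A n \<le> A (Suc n) \<and> B (Suc n) \<le> B n" using h by (auto simp: history_def)
  with step show ?case by auto
qed simp

lemma curve_repD:
  assumes "C \<in> curves \<Lambda>"
  shows "curve_rep C \<in> C" "path (curve_rep C)" "path_image (curve_rep C) \<subseteq> \<Lambda>"
proof -
  obtain f where f: "f \<in> C" using assms equiv_same_curve unfolding curves_def by (metis in_quotient_imp_non_empty ex_in_conv)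
  then show "curve_rep C \<in> C" unfolding curve_rep_def by (rule someI[of "\<lambda>f. f \<in> C"])
  show "path (curve_rep C)" "path_image (curve_rep C) \<subseteq> \<Lambda>"
    using curve_rep_same[OF assms f] by (auto simp: same_curve_def paths_in_def)
qed

text \<open>The hypothesis for one cutoff and one measure. Collections have at least two members so
  that each contains subcollections of sizes one and two, which settles the sign of the
  constants.\<close>

definition traversal_bound :: "real \<Rightarrow> real \<Rightarrow> real \<Rightarrow> real \<Rightarrow> 'a::real_inner curve set measure \<Rightarrow> bool" where
  "traversal_bound \<sigma> K \<rho> \<delta> M \<longleftrightarrow> (\<forall>n\<ge>2. \<forall>a u l. (\<forall>j<n. norm (u j) = 1 \<and> \<delta> \<le> l j) \<longrightarrow>
     well_separated n (\<lambda>j. cylinder (a j) (u j) (l j) (l j / \<sigma>)) \<longrightarrow>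
     Prob M {F \<in> space M. \<forall>j<n. \<exists>C\<in>F. traverses C (a j) (u j) (l j) (l j / \<sigma>)} \<le> K * \<rho> ^ n)"

text \<open>The failure of \<open>sparsely_straight\<close> at a single depth.\<close>

definition dense_runs :: "real \<Rightarrow> real \<Rightarrow> nat \<Rightarrow> 'a::metric_space curve \<Rightarrow> bool" where
  "dense_runs \<gamma> L k C \<longleftrightarrow> (\<exists>A B. history (curve_rep C) \<gamma> L k A B \<and>
     k < 2 * card (straight_levels (curve_rep C) \<gamma> L k A B))"

text \<open>The cylinders of all scales in \<open>S\<close> together form one well separated family,
  because everything finer than a given scale is clustered near \<open>x\<close> and the slots avoid
  \<open>x\<close>. A single application of the hypothesis thus multiplies the gains of all levels,
  without any independence.\<close>

lemma Prob_multiscale_traversal: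
  fixes p q :: "nat \<Rightarrow> 'a::real_inner"
  assumes tb: "traversal_bound \<sigma> K \<rho> \<delta> M"
    and \<delta>: "0 < \<delta>" and \<sigma>: "0 < \<sigma>" and \<gamma>: "100 \<le> \<gamma>" and L: "0 < L" and c: "0 < c"
    and N: "2 \<le> N" "real N * (c * (2 + 1 / \<sigma>)) \<le> 1 / 8"
    and S: "finite S" "S \<noteq> {}" and \<delta>L: "\<And>j. j \<in> S \<Longrightarrow> \<delta> \<le> c * (L / \<gamma> ^ j)"
    and pq: "\<And>j. j \<in> S \<Longrightarrow> p j \<noteq> q j \<and> dist (p j) x \<le> 4 * (L / \<gamma> ^ j)"
  shows "Prob M {F \<in> space M. \<forall>j\<in>S. \<forall>i<N. \<exists>C\<in>F. traverses C (slot_base c \<sigma> x (p j) (q j) (L / \<gamma> ^ j) i)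
      (sgn (q j - p j)) (c * (L / \<gamma> ^ j)) (c * (L / \<gamma> ^ j) / \<sigma>)} \<le> K * \<rho> ^ (card S * N)"
proof -
  define n where "n = card S * N"
  define Lj where "Lj j = L / \<gamma> ^ j" for j
  have Lpos: "0 < Lj j" for j using L \<gamma> by (simp add: Lj_def)
  obtain h where h: "bij_betw h {0..<n} (S \<times> {..<N})"
    using ex_bij_betw_nat_finite[of "S \<times> {..<N}"] S by (auto simp: n_def card_cartesian_product)
  have hin: "fst (h j) \<in> S" "snd (h j) < N" if "j < n" for j
    using bij_betwE[OF h] that by (auto simp: mem_Times_iff)
  have n2: "2 \<le> n"
    using S N mult_le_mono[of 1 "card S" 2 N] by (simp add: n_def Suc_le_eq card_gt_0_iff)
  let ?a = "\<lambda>m. slot_base c \<sigma> x (p (fst (h m))) (q (fst (h m))) (Lj (fst (h m))) (snd (h m))"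
  let ?u = "\<lambda>m. sgn (q (fst (h m)) - p (fst (h m)))"
  let ?l = "\<lambda>m. c * Lj (fst (h m))"
  have Lmono: "100 * Lj j \<le> Lj i" if "i < j" for i j
  proof -
    have "100 * \<gamma> ^ i \<le> \<gamma> * \<gamma> ^ i" using \<gamma> by (intro mult_right_mono) auto
    also have "\<dots> \<le> \<gamma> ^ j" using \<gamma> that power_increasing[of "Suc i" j \<gamma>] by simp
    finally show ?thesis using L \<gamma> by (simp add: Lj_def field_simps)
  qed
  let ?D = "\<lambda>j. c * Lj j + c * Lj j / \<sigma>"
  have Dmono: "?D j \<le> ?D i" if "i < j" for i j
    using Lmono[OF that] Lpos[of j] c \<sigma>
    by (intro add_mono divide_right_mono mult_left_mono) auto
  \<comment> \<open>Separation is measured against the cylinder of index \<open>m\<close>; where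
    that is the finer one, the bound for the coarser one is stronger still.\<close>
  have sep: "?D (fst (h m)) \<le> dist y z"
    if m: "m < n" "m' < n" "m \<noteq> m'" and yz: "y \<in> cylinder (?a m) (?u m) (?l m) (?l m / \<sigma>)"
      "z \<in> cylinder (?a m') (?u m') (?l m') (?l m' / \<sigma>)" for m m' y z
  proof -
    obtain j i j' i' where hm: "h m = (j, i)" "h m' = (j', i')" by fastforce
    have jS: "j \<in> S" "j' \<in> S" "i < N" "i' < N" using hin[OF m(1)] hin[OF m(2)] hm by auto
    have ne: "(j, i) \<noteq> (j', i')"
      using h m hm by (metis atLeastLessThan_iff bij_betw_def inj_on_def le0)
    have y: "y \<in> slot_cylinder c \<sigma> x (p j) (q j) (Lj j) i"
      and z: "z \<in> slot_cylinder c \<sigma> x (p j') (q j') (Lj j') i'"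
      using yz hm by (auto simp: slot_cylinder_def)
    have pq': "p j \<noteq> q j" "p j' \<noteq> q j'" "dist (p j) x \<le> 4 * Lj j" "dist (p j') x \<le> 4 * Lj j'"
      using pq jS by (auto simp: Lj_def)
    consider "j < j'" | "j' < j" | "j = j'" "i < i'" | "j = j'" "i' < i"
      using ne by (cases j j' rule: linorder_cases; cases i i' rule: linorder_cases) auto
    then have "?D j \<le> dist y z"
    proof cases
      case 1
      show ?thesis
        by (rule slot_cylinder_cross_level[OF c \<sigma> N(2,1) Lpos Lmono[OF 1] jS(3,4) pq'(1,2,4) y z])
    next
      case 2
      have "?D j \<le> ?D j'" by (rule Dmono[OF 2])
      also have "\<dots> \<le> dist z y"
        by (rule slot_cylinder_cross_level[OF c \<sigma> N(2,1) Lpos Lmono[OF 2] jS(4,3) pq'(2,1,3) z y])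
      finally show ?thesis by (simp add: dist_commute)
    next
      case 3
      then show ?thesis using slot_cylinder_same_level[OF c \<sigma> Lpos 3(2) pq'(1) y] z by simp
    next
      case 4
      then show ?thesis using slot_cylinder_same_level[OF c \<sigma> Lpos 4(2) pq'(1) _ y, of z] z
        by (simp add: dist_commute)
    qed
    then show ?thesis using hm by simp
  qed
  have unit: "norm (?u m) = 1" if "m < n" for m
    using pq[OF hin(1)[OF that]] by (auto simp: norm_sgn)
  have ws: "well_separated n (\<lambda>m. cylinder (?a m) (?u m) (?l m) (?l m / \<sigma>))"
    unfolding well_separated_def
  proof (intro allI impI)
    fix m m' assume m: "m < n" "m' < n" "m' \<noteq> m"
    have w: "0 \<le> ?l m" "0 \<le> ?l m / \<sigma>" for m
      using c Lpos[of "fst (h m)"] \<sigma> by simp_all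
    have "norm (?u m) = 1" using m by (intro unit)
    then have "diameter (cylinder (?a m) (?u m) (?l m) (?l m / \<sigma>)) \<le> ?D (fst (h m))"
      by (intro diameter_cylinder_le w)
    also have "\<dots> \<le> setdist (cylinder (?a m) (?u m) (?l m) (?l m / \<sigma>))
        (cylinder (?a m') (?u m') (?l m') (?l m' / \<sigma>))"
    proof (rule le_setdistI)
      show "cylinder (?a m) (?u m) (?l m) (?l m / \<sigma>) \<noteq> {}"
        "cylinder (?a m') (?u m') (?l m') (?l m' / \<sigma>) \<noteq> {}"
        using mem_cylinder_base[OF w(1,2)] by blast+
    qed (use sep m in auto)
    finally show "diameter (cylinder (?a m) (?u m) (?l m) (?l m / \<sigma>)) \<le>
        setdist (cylinder (?a m) (?u m) (?l m) (?l m / \<sigma>)) (cylinder (?a m') (?u m') (?l m') (?l m' / \<sigma>))" .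
  qed
  have "{F \<in> space M. \<forall>j\<in>S. \<forall>i<N. \<exists>C\<in>F. traverses C (slot_base c \<sigma> x (p j) (q j) (L / \<gamma> ^ j) i)
      (sgn (q j - p j)) (c * (L / \<gamma> ^ j)) (c * (L / \<gamma> ^ j) / \<sigma>)}
    = {F \<in> space M. \<forall>m<n. \<exists>C\<in>F. traverses C (?a m) (?u m) (?l m) (?l m / \<sigma>)}" (is "?E1 = ?E2")
  proof -
    define P where "P F j i \<longleftrightarrow> (\<exists>C\<in>F. traverses C (slot_base c \<sigma> x (p j) (q j) (Lj j) i)
      (sgn (q j - p j)) (c * Lj j) (c * Lj j / \<sigma>))" for F j i
    have "(\<forall>j\<in>S. \<forall>i<N. P F j i) \<longleftrightarrow> (\<forall>m<n. P F (fst (h m)) (snd (h m)))" for F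
    proof
      assume R: "\<forall>m<n. P F (fst (h m)) (snd (h m))"
      show "\<forall>j\<in>S. \<forall>i<N. P F j i"
      proof (intro ballI allI impI)
        fix j i assume "j \<in> S" "i < N"
        then have "(j, i) \<in> h ` {0..<n}" using h by (simp add: bij_betw_def)
        then obtain m where "m < n" "h m = (j, i)" by auto
        then show "P F j i" using R[rule_format, of m] by simp
      qed
    qed (use hin in blast)
    then show ?thesis unfolding P_def Lj_def by auto
  qed
  moreover have "Prob M ?E2 \<le> K * \<rho> ^ n"
    using tb[unfolded traversal_bound_def, rule_format, OF n2 _ ws] unit hin \<delta>L by (auto simp: Lj_def)
  ultimately show ?thesis by (simp add: n_def)
qed

text \<open>A union bound over codes of nested sequences. A code consists of a net point near the
  start of the last run and, for each level, a straightness flag and the two ends, rounded in units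
  of that scale. There are \<open>card X * (2 * (card Z)\<^sup>2) ^ k\<close> codes, and one with
  more than \<open>k / 2\<close> flags set has probability at most
  \<open>K * sqrt (\<rho> ^ N) ^ k\<close>.\<close>

lemma Prob_dense_runs:
  fixes M :: "'a::euclidean_space curve set measure" and K \<rho> \<sigma> \<delta> \<gamma> L c :: real
  assumes M: "prob_space M" "space M = configs \<Lambda>" and tb: "traversal_bound \<sigma> K \<rho> \<delta> M"
    and K: "0 \<le> K" and \<rho>: "0 < \<rho>" "\<rho> < 1"
    and \<delta>: "0 < \<delta>" and \<sigma>: "0 < \<sigma>" and \<gamma>: "100 \<le> \<gamma>" and L: "0 < L" and c: "c = 8 * \<sigma> / sqrt \<gamma>"
    and N: "2 \<le> N" "real N * (c * (2 + 1 / \<sigma>)) \<le> 1 / 8"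
    and \<delta>L: "\<And>j. j < k \<Longrightarrow> \<delta> \<le> c * (L / \<gamma> ^ j)"
    and X: "finite X" "\<And>y. y \<in> \<Lambda> \<Longrightarrow> \<exists>x\<in>X. dist y x \<le> L / \<gamma> ^ k"
    and Z: "finite Z" "\<And>y::'a. y \<in> cball 0 3 \<Longrightarrow> \<exists>z\<in>Z. dist y z \<le> 1 / \<gamma>"
  shows "Prob M {F \<in> space M. \<exists>C\<in>F. dense_runs \<gamma> L k C}
    \<le> card X * K * (2 * (card Z)\<^sup>2 * sqrt (\<rho> ^ N)) ^ k"
proof -
  define Lj where "Lj j = L / \<gamma> ^ j" for j
  have Lpos: "0 < Lj j" for j using L \<gamma> by (simp add: Lj_def)
  have c0: "0 < c" using \<sigma> \<gamma> by (simp add: c)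
  define I where "I = X \<times> ({..<k} \<rightarrow>\<^sub>E (UNIV :: bool set) \<times> Z \<times> Z)"
  define S where "S g = {j. j < k \<and> fst (g j)}" for g :: "nat \<Rightarrow> bool \<times> 'a \<times> 'a"
  define p where "p x g j = x + Lj j *\<^sub>R fst (snd (g j))" for x and g :: "nat \<Rightarrow> bool \<times> 'a \<times> 'a" and j
  define q where "q x g j = x + Lj j *\<^sub>R snd (snd (g j))" for x and g :: "nat \<Rightarrow> bool \<times> 'a \<times> 'a" and j
  \<comment> \<open>Codes that no dense sequence can produce get the empty event; the conditions on
    positions are those that separation of the cylinders relies on.\<close>
  define E where "E = (\<lambda>(x, g). if k < 2 * card (S g) \<and>
      (\<forall>j\<in>S g. p x g j \<noteq> q x g j \<and> dist (p x g j) x \<le> 4 * Lj j)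
    then {F \<in> space M. \<forall>j\<in>S g. \<forall>i<N. \<exists>C\<in>F.
      traverses C (slot_base c \<sigma> x (p x g j) (q x g j) (Lj j) i)
      (sgn (q x g j - p x g j)) (c * Lj j) (c * Lj j / \<sigma>)} else {})"
  have finI: "finite I" unfolding I_def using X Z by (intro finite_cartesian_product finite_PiE) auto
  have cardI: "card I = card X * (2 * (card Z)\<^sup>2) ^ k"
    by (simp add: I_def card_cartesian_product card_PiE power2_eq_square)
  have bound: "Prob M (E e) \<le> K * sqrt (\<rho> ^ N) ^ k" if "e \<in> I" for e
  proof (cases "k < 2 * card (S (snd e)) \<and>
      (\<forall>j\<in>S (snd e). p (fst e) (snd e) j \<noteq> q (fst e) (snd e) j \<and> dist (p (fst e) (snd e) j) (fst e) \<le> 4 * Lj j)")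
    case True
    obtain x g where e: "e = (x, g)" by fastforce
    have S: "finite (S g)" by (simp add: S_def)
    have "S g \<noteq> {}" using True e by force
    have cond: "k < 2 * card (S g) \<and> (\<forall>j\<in>S g. p x g j \<noteq> q x g j \<and> dist (p x g j) x \<le> 4 * Lj j)"
      using True unfolding e fst_conv snd_conv .
    have Ee: "E e = {F \<in> space M. \<forall>j\<in>S g. \<forall>i<N. \<exists>C\<in>F.
      traverses C (slot_base c \<sigma> x (p x g j) (q x g j) (Lj j) i)
      (sgn (q x g j - p x g j)) (c * Lj j) (c * Lj j / \<sigma>)}"
      unfolding E_def e case_prod_conv using cond by (rule if_P)
    have \<delta>S: "\<delta> \<le> c * (L / \<gamma> ^ j)" if "j \<in> S g" for j using that \<delta>L by (simp add: S_def)
    have pq: "p x g j \<noteq> q x g j \<and> dist (p x g j) x \<le> 4 * (L / \<gamma> ^ j)" if "j \<in> S g" for j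
      using cond that unfolding Lj_def by blast
    have "Prob M (E e) \<le> K * \<rho> ^ (card (S g) * N)"
      unfolding Ee Lj_def
      by (rule Prob_multiscale_traversal[where p="p x g" and q="q x g" and x=x,
        OF tb \<delta> \<sigma> \<gamma> L c0 N S \<open>S g \<noteq> {}\<close> \<delta>S pq])
    also have "\<dots> \<le> K * sqrt (\<rho> ^ N) ^ k"
    proof (rule mult_left_mono[OF power2_le_imp_le K])
      have kS: "k \<le> 2 * card (S g)" using cond by simp
      \<comment> \<open>The exponent is at least \<open>k / 2\<close>, and \<open>k\<close> may be
        odd, so the powers are compared after squaring.\<close>
      have sq: "(sqrt (\<rho> ^ N))\<^sup>2 = \<rho> ^ N" using \<rho> by (intro real_sqrt_pow2) simp
      have "(\<rho> ^ (card (S g) * N))\<^sup>2 = \<rho> ^ (N * (2 * card (S g)))"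
        by (subst power_mult[symmetric], rule arg_cong[where f="power \<rho>"]) simp
      also have "\<dots> \<le> \<rho> ^ (N * k)" using \<rho> kS by (intro power_decreasing mult_le_mono) auto
      also have "\<dots> = ((sqrt (\<rho> ^ N))\<^sup>2) ^ k" by (simp only: power_mult sq)
      also have "\<dots> = (sqrt (\<rho> ^ N) ^ k)\<^sup>2" by (metis power_mult mult.commute)
      finally show "(\<rho> ^ (card (S g) * N))\<^sup>2 \<le> (sqrt (\<rho> ^ N) ^ k)\<^sup>2" .
    qed (use \<rho> in auto)
    finally show ?thesis .
  next
    case False
    then have "E e = {}" by (auto simp: E_def split: prod.splits)
    then show ?thesis using K \<rho> by (simp add: Prob_def)
  qed
  have "{F \<in> space M. \<exists>C\<in>F. dense_runs \<gamma> L k C} \<subseteq> (\<Union>e\<in>I. E e)"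
  proof clarify
    fix F C assume F: "F \<in> space M" "C \<in> F" and "dense_runs \<gamma> L k C"
    define f where "f = curve_rep C"
    obtain A B where h: "history f \<gamma> L k A B" and dense: "k < 2 * card (straight_levels f \<gamma> L k A B)"
      using \<open>dense_runs \<gamma> L k C\<close> by (auto simp: dense_runs_def f_def)
    have "C \<in> curves \<Lambda>" using F M(2) by (auto simp: configs_def)
    note f = curve_repD[OF this, folded f_def]
    have run: "run f (Lj j) (A j) (B j)" if "j \<le> k" for j
      using h that by (auto simp: history_def Lj_def)
    have "f (A k) \<in> \<Lambda>" using f(3) run[of k] by (force simp: path_image_def run_def)
    then obtain x where x: "x \<in> X" "dist (f (A k)) x \<le> Lj k" using X(2) by (auto simp: Lj_def)
    \<comment> \<open>The start of run \<open>k\<close> lies in run \<open>j\<close>, hence within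
      \<open>Lj j\<close> of its start; the net error is at most another \<open>Lj j\<close>, and
      the length of the run a third. This is why \<open>Z\<close> covers the ball of radius
      3.\<close>
    have near: "dist (f (A j)) x \<le> 2 * Lj j" "dist (f (B j)) x \<le> 3 * Lj j" if "j \<le> k" for j
    proof -
      have "A k \<in> {A j..B j}"
        using history_nested[OF h that] run[of k] by (auto simp: run_def)
      then have "dist (f (A j)) (f (A k)) \<le> Lj j" "dist (f (A j)) (f (B j)) = Lj j"
        using run[OF that] by (auto simp: run_def)
      moreover have "Lj k \<le> Lj j"
        using that \<gamma> L unfolding Lj_def by (intro divide_left_mono power_increasing) auto
      ultimately show "dist (f (A j)) x \<le> 2 * Lj j" "dist (f (B j)) x \<le> 3 * Lj j"
        using x dist_triangle[of "f (A j)" x "f (A k)"] dist_triangle[of "f (B j)" x "f (A j)"]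
        by (simp_all add: dist_commute)
    qed
    \<comment> \<open>Positions relative to \<open>x\<close> in units of \<open>Lj j\<close> let the
      single net \<open>Z\<close> serve all scales, with error
      \<open>Lj j / \<gamma>\<close>.\<close>
    have approx: "\<exists>z\<in>Z. dist y (x + Lj j *\<^sub>R z) \<le> Lj j / \<gamma>" if "dist y x \<le> 3 * Lj j" for y j
    proof -
      have "norm ((y - x) /\<^sub>R Lj j) \<le> 3"
        using that Lpos[of j] unfolding norm_scaleR dist_norm by (simp add: divide_simps mult.commute)
      then obtain z where z: "z \<in> Z" "dist ((y - x) /\<^sub>R Lj j) z \<le> 1 / \<gamma>"
        using Z(2)[of "(y - x) /\<^sub>R Lj j"] unfolding mem_cball_0 by blast
      have "y - (x + Lj j *\<^sub>R z) = Lj j *\<^sub>R ((y - x) /\<^sub>R Lj j - z)"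
        using Lpos[of j] by (simp add: algebra_simps)
      then have "dist y (x + Lj j *\<^sub>R z) = Lj j * dist ((y - x) /\<^sub>R Lj j) z"
        using Lpos[of j] by (simp add: dist_norm)
      also have "\<dots> \<le> Lj j * (1 / \<gamma>)" using z Lpos[of j] by (intro mult_left_mono) auto
      finally show ?thesis using z by auto
    qed
    have "\<exists>z. z \<in> Z \<and> dist (f (A j)) (x + Lj j *\<^sub>R z) \<le> Lj j / \<gamma>" if "j \<le> k" for j
      using approx[of "f (A j)" j] near(1)[OF that] Lpos[of j] by force
    then obtain P where P: "\<And>j. j \<le> k \<Longrightarrow> P j \<in> Z \<and> dist (f (A j)) (x + Lj j *\<^sub>R P j) \<le> Lj j / \<gamma>"
      by metis
    have "\<exists>z. z \<in> Z \<and> dist (f (B j)) (x + Lj j *\<^sub>R z) \<le> Lj j / \<gamma>" if "j \<le> k" for j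
      using approx[of "f (B j)" j] near(2)[OF that] by force
    then obtain Q where Q: "\<And>j. j \<le> k \<Longrightarrow> Q j \<in> Z \<and> dist (f (B j)) (x + Lj j *\<^sub>R Q j) \<le> Lj j / \<gamma>"
      by metis
    define g where "g = restrict (\<lambda>j. (straight f \<gamma> (Lj j) (A j) (B j), P j, Q j)) {..<k}"
    have gI: "(x, g) \<in> I" using x P Q by (auto simp: I_def g_def)
    have Sg: "S g = straight_levels f \<gamma> L k A B"
      by (auto simp: S_def g_def straight_levels_def Lj_def)
    have pj: "dist (f (A j)) (p x g j) \<le> Lj j / \<gamma>" "dist (f (B j)) (q x g j) \<le> Lj j / \<gamma>" if "j < k" for j
      using P[of j] Q[of j] that by (auto simp: p_def q_def g_def)
    have small: "Lj j / \<gamma> \<le> Lj j / 100" for j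
      using Lpos[of j] \<gamma> by (intro divide_left_mono) auto
    have ok: "p x g j \<noteq> q x g j" "dist (p x g j) x \<le> 4 * Lj j" if "j < k" for j
    proof -
      have "dist (f (A j)) (f (B j)) = Lj j" using run[of j] that by (auto simp: run_def)
      moreover have pj': "dist (f (A j)) (p x g j) \<le> Lj j / 100" "dist (f (B j)) (q x g j) \<le> Lj j / 100"
        using pj[OF that] small[of j] by (meson order_trans)+
      ultimately show "p x g j \<noteq> q x g j"
        using Lpos[of j] dist_triangle[of "f (A j)" "f (B j)" "p x g j"]
        by (auto simp: dist_commute)
      show "dist (p x g j) x \<le> 4 * Lj j"
        using pj' Lpos[of j] near[of j] that dist_triangle[of "p x g j" x "f (A j)"]
        by (auto simp: dist_commute)
    qed
    have "F \<in> E (x, g)"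
      unfolding E_def case_prod_conv
    proof (subst if_P, intro conjI ballI)
      show "k < 2 * card (S g)" using dense Sg by simp
      show "F \<in> {F \<in> space M. \<forall>j\<in>S g. \<forall>i<N. \<exists>C\<in>F.
        traverses C (slot_base c \<sigma> x (p x g j) (q x g j) (Lj j) i)
        (sgn (q x g j - p x g j)) (c * Lj j) (c * Lj j / \<sigma>)}"
      proof (intro CollectI conjI ballI allI impI F(1))
        fix j i assume j: "j \<in> S g" and i: "i < N"
        have jk: "j < k" and st: "straight f \<gamma> (Lj j) (A j) (B j)"
          using j by (auto simp: Sg straight_levels_def Lj_def)
        have "traverses C (slot_base c \<sigma> x (p x g j) (q x g j) (Lj j) i)
            (sgn (q x g j - p x g j)) (c * Lj j) (c * Lj j / \<sigma>)"
          using jk by (intro straight_run_traverses[OF f(2,1) run st pj[OF jk] \<gamma> Lpos \<sigma> c N(2) i]) auto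
        then show "\<exists>C\<in>F. traverses C (slot_base c \<sigma> x (p x g j) (q x g j) (Lj j) i)
            (sgn (q x g j - p x g j)) (c * Lj j) (c * Lj j / \<sigma>)" using F by blast
      qed
    qed (use ok in \<open>auto simp: S_def\<close>)
    then show "F \<in> (\<Union>e\<in>I. E e)" using gI by blast
  qed
  moreover have Esub: "E e \<subseteq> space M" for e by (auto simp: E_def split: prod.splits)
  ultimately have "Prob M {F \<in> space M. \<exists>C\<in>F. dense_runs \<gamma> L k C} \<le> Prob M (\<Union>e\<in>I. E e)"
    by (intro Prob_mono M(1) UN_least)
  also have "\<dots> \<le> card I * (K * sqrt (\<rho> ^ N) ^ k)"
    by (rule Prob_UNION_le_card[OF M(1) finI Esub bound])
  also have "\<dots> = card X * K * (2 * (card Z)\<^sup>2 * sqrt (\<rho> ^ N)) ^ k"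
    by (simp add: cardI power_mult_distrib)
  finally show ?thesis .
qed

section \<open>Choice of the scale ratio\<close>

lemma power_times_exp_sqrt_small:
  fixes A b e :: real
  assumes b: "0 < b" and e: "0 < e"
  shows "\<forall>\<^sub>F m in sequentially. A * (real m + 1/4) ^ p * exp (- (b * sqrt (real m + 1/4))) \<le> e"
proof -
  let ?y = "\<lambda>m. b * sqrt (real m + 1/4)"
  have "filterlim (\<lambda>m. real m + 1/4) at_top sequentially"
    by (rule filterlim_at_top_mono[OF filterlim_real_sequentially]) simp
  then have "filterlim (\<lambda>m. sqrt (real m + 1/4)) at_top sequentially"
    by (rule filterlim_compose[OF sqrt_at_top])
  then have y: "filterlim ?y at_top sequentially"
    by (rule filterlim_tendsto_pos_mult_at_top[OF tendsto_const b])
  \<comment> \<open>In the variable \<open>?y m\<close> the power \<open>p\<close> becomes the power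
    \<open>2 * p\<close>, which loses against the exponential.\<close>
  have "((\<lambda>m. (A / b ^ (2 * p)) * (?y m ^ (2 * p) / exp (?y m))) \<longlongrightarrow> (A / b ^ (2 * p)) * 0) sequentially"
    by (rule tendsto_mult_left[OF filterlim_compose[OF tendsto_power_div_exp_0 y]])
  moreover have eq: "(A / b ^ (2 * p)) * (?y m ^ (2 * p) / exp (?y m))
      = A * (real m + 1/4) ^ p * exp (- ?y m)" for m
  proof -
    have "(sqrt (real m + 1/4))\<^sup>2 = real m + 1/4" by simp
    then have "sqrt (real m + 1/4) ^ (2 * p) = (real m + 1/4) ^ p" by (simp only: power_mult)
    then have Y: "?y m ^ (2 * p) = b ^ (2 * p) * (real m + 1/4) ^ p" by (simp only: power_mult_distrib)
    have gen: "A / B * (B * x / E) = A * x * inverse E" if "0 < B" for B x E :: real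
      using that by (simp add: divide_inverse)
    show ?thesis unfolding Y exp_minus by (rule gen) (use b in simp)
  qed
  ultimately have "(\<lambda>m. A * (real m + 1/4) ^ p * exp (- ?y m)) \<longlonglongrightarrow> 0" by (simp only: eq mult_zero_right)
  then have "\<forall>\<^sub>F m in sequentially. A * (real m + 1/4) ^ p * exp (- ?y m) < e"
    using e by (rule order_tendstoD)
  then show ?thesis by eventually_elim simp
qed

text \<open>Only order of sqrt \<gamma> slots fit, where \<gamma> is \<open>real m + 1/4\<close>, so
  the gain decays exponentially in sqrt \<gamma>; this still beats every power of \<gamma>.\<close>

lemma exists_scale_ratio:
  fixes \<sigma> \<rho> A :: real
  assumes \<sigma>: "0 < \<sigma>" and \<rho>: "0 < \<rho>" "\<rho> < 1" and A: "0 \<le> A"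
  shows "\<exists>m N. 100 \<le> m \<and> 2 \<le> N \<and>
    real N * (8 * \<sigma> / sqrt (real m + 1/4) * (2 + 1 / \<sigma>)) \<le> 1 / 8 \<and>
    A * (real m + 1/4) ^ p * sqrt (\<rho> ^ N) \<le> 1 / 2"
proof -
  \<comment> \<open>With this value the condition that the slots fit reads
    \<open>real N \<le> sqrt (real m + 1/4) / \<kappa>\<close>.\<close>
  define \<kappa> where "\<kappa> = 64 * (2 * \<sigma> + 1)"
  define b where "b = - ln \<rho>"
  have \<kappa>: "0 < \<kappa>" and b: "0 < b" using \<sigma> \<rho> by (auto simp: \<kappa>_def b_def)
  \<comment> \<open>The factor \<open>exp (b / 2)\<close> pays for rounding down in
    \<open>N\<close>; the rate is halved by the square root of \<open>\<rho> ^ N\<close>.\<close>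
  have "\<forall>\<^sub>F m in sequentially. A * exp (b / 2) * (real m + 1/4) ^ p
      * exp (- (b / (2 * \<kappa>) * sqrt (real m + 1/4))) \<le> 1 / 2"
    using b \<kappa> by (intro power_times_exp_sqrt_small) auto
  moreover have "\<forall>\<^sub>F m in sequentially. max 100 (nat \<lceil>(2 * \<kappa>)\<^sup>2\<rceil>) \<le> m"
    by (rule eventually_ge_at_top)
  ultimately have "\<forall>\<^sub>F m in sequentially. A * exp (b / 2) * (real m + 1/4) ^ p
      * exp (- (b / (2 * \<kappa>) * sqrt (real m + 1/4))) \<le> 1 / 2 \<and> max 100 (nat \<lceil>(2 * \<kappa>)\<^sup>2\<rceil>) \<le> m"
    by (rule eventually_conj)
  then obtain m where mm: "A * exp (b / 2) * (real m + 1/4) ^ p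
      * exp (- (b / (2 * \<kappa>) * sqrt (real m + 1/4))) \<le> 1 / 2 \<and> max 100 (nat \<lceil>(2 * \<kappa>)\<^sup>2\<rceil>) \<le> m"
    using eventually_happens'[OF sequentially_bot] by blast
  note small = conjunct1[OF mm]
  have m: "100 \<le> m" "nat \<lceil>(2 * \<kappa>)\<^sup>2\<rceil> \<le> m" using conjunct2[OF mm] by simp_all
  let ?g = "sqrt (real m + 1/4)"
  define N where "N = nat \<lfloor>?g / \<kappa>\<rfloor>"
  have "(2 * \<kappa>)\<^sup>2 \<le> real m + 1/4" using m by linarith
  then have g: "2 * \<kappa> \<le> ?g" by (rule real_le_rsqrt)
  then have g2: "2 \<le> ?g / \<kappa>" using \<kappa> by (simp add: field_simps)
  have N: "real N \<le> ?g / \<kappa>" "?g / \<kappa> - 1 \<le> real N" "2 \<le> N"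
    using g2 unfolding N_def by (linarith, linarith, simp add: le_nat_iff le_floor_iff)
  have "real N * (8 * \<sigma> / ?g * (2 + 1 / \<sigma>)) \<le> ?g / \<kappa> * (8 * \<sigma> / ?g * (2 + 1 / \<sigma>))"
    using N \<sigma> by (intro mult_right_mono) auto
  also have "\<dots> = 8 * (\<sigma> * (2 + 1 / \<sigma>)) / \<kappa>" using g \<kappa> by simp
  also have "\<sigma> * (2 + 1 / \<sigma>) = 2 * \<sigma> + 1" using \<sigma> by (simp add: distrib_left)
  also have "8 * (2 * \<sigma> + 1) / \<kappa> = 1 / 8" using \<sigma> by (simp add: \<kappa>_def)
  finally have 1: "real N * (8 * \<sigma> / ?g * (2 + 1 / \<sigma>)) \<le> 1 / 8" .
  have "\<rho> ^ N = exp (- (b * N))" using \<rho> by (simp add: b_def exp_of_nat_mult flip: mult.commute[of "real N"])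
  also have "\<dots> \<le> exp (- (b * (?g / \<kappa> - 1)))" using N b by simp
  also have "\<dots> = (exp (b / 2) * exp (- (b / (2 * \<kappa>) * ?g)))\<^sup>2"
  proof -
    have "- (b * (?g / \<kappa> - 1)) = 2 * (b / 2 + - (b / (2 * \<kappa>) * ?g))"
      using \<kappa> by (simp add: right_diff_distrib)
    then show ?thesis by (simp only: exp_double exp_add)
  qed
  finally have "sqrt (\<rho> ^ N) \<le> exp (b / 2) * exp (- (b / (2 * \<kappa>) * ?g))"
    by (rule real_le_lsqrt[rotated]) auto
  then have "A * (real m + 1/4) ^ p * sqrt (\<rho> ^ N)
      \<le> A * (real m + 1/4) ^ p * (exp (b / 2) * exp (- (b / (2 * \<kappa>) * ?g)))"
    using A by (intro mult_left_mono) auto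
  also have "\<dots> \<le> 1 / 2" using small by (simp add: mult_ac)
  finally have 2: "A * (real m + 1/4) ^ p * sqrt (\<rho> ^ N) \<le> 1 / 2" .
  show ?thesis by (rule exI[of _ m], rule exI[of _ N], intro conjI m(1) N(3) 1 2)
qed

text \<open>Here \<open>m\<close> and \<open>c\<close> are found before \<open>L\<close>, which
  enters only through \<open>B\<close>: a single critical exponent will then serve curves of all
  sizes.\<close>

lemma Prob_dense_runs_small:
  fixes \<Lambda> :: "'a::euclidean_space set" and \<sigma> \<rho> K :: real
  assumes \<Lambda>: "bounded \<Lambda>" and \<sigma>: "0 < \<sigma>" and \<rho>: "0 < \<rho>" "\<rho> < 1" and K: "0 \<le> K"
  shows "\<exists>m c. 100 \<le> m \<and> 0 < c \<and> (\<forall>L>0. \<exists>B\<ge>0. \<forall>\<delta> k M. 0 < \<delta> \<longrightarrow> prob_space M \<longrightarrow> space M = configs \<Lambda> \<longrightarrow>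
    traversal_bound \<sigma> K \<rho> \<delta> M \<longrightarrow> (\<forall>j<k. \<delta> \<le> c * (L / (real m + 1/4) ^ j)) \<longrightarrow>
    Prob M {F \<in> space M. \<exists>C\<in>F. dense_runs (real m + 1/4) L k C} \<le> B * (1/2) ^ k)"
proof -
  let ?d = "DIM('a)"
  obtain R where R: "0 < R" "\<Lambda> \<subseteq> cball 0 R"
    using \<Lambda> bounded_pos[of \<Lambda>] by (auto simp: subset_eq)
  obtain a where a: "0 < a" and nets: "\<forall>\<eta>. 0 < \<eta> \<longrightarrow> \<eta> \<le> 1 \<longrightarrow> (\<exists>X. finite X \<and> real (card X) \<le> (a / \<eta>) ^ ?d \<and>
    (\<forall>y\<in>cball (0::'a) R. \<exists>x\<in>X. dist y x \<le> \<eta>))"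
    using finite_net_cball[OF R(1), where 'a='a] by (elim exE conjE) (rule that)
  obtain z where z: "0 < z" and nets3: "\<forall>\<eta>. 0 < \<eta> \<longrightarrow> \<eta> \<le> 1 \<longrightarrow> (\<exists>X. finite X \<and> real (card X) \<le> (z / \<eta>) ^ ?d \<and>
    (\<forall>y\<in>cball (0::'a) 3. \<exists>x\<in>X. dist y x \<le> \<eta>))"
    using finite_net_cball[of 3, OF zero_less_numeral, where 'a='a] by (elim exE conjE) (rule that)
  have A0: "0 \<le> 2 * (z ^ ?d)\<^sup>2" by simp
  \<comment> \<open>Of the exponent \<open>3 * ?d\<close>, one \<open>?d\<close> pays for refining
    the net \<open>X\<close> by one level and \<open>2 * ?d\<close> for rounding the two
    ends.\<close>
  obtain m N where m: "100 \<le> m" and N: "2 \<le> N"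
      "real N * (8 * \<sigma> / sqrt (real m + 1/4) * (2 + 1 / \<sigma>)) \<le> 1 / 8"
    and small: "2 * (z ^ ?d)\<^sup>2 * (real m + 1/4) ^ (3 * ?d) * sqrt (\<rho> ^ N) \<le> 1 / 2"
    using exists_scale_ratio[OF \<sigma> \<rho> A0, of "3 * ?d"] by (elim exE conjE) (rule that)
  define \<gamma> where "\<gamma> = real m + 1/4"
  define c where "c = 8 * \<sigma> / sqrt \<gamma>"
  have \<gamma>: "100 \<le> \<gamma>" using m by (simp add: \<gamma>_def)
  have c: "0 < c" using \<sigma> \<gamma> by (simp add: c_def)
  have \<gamma>1: "0 < 1 / \<gamma>" "1 / \<gamma> \<le> 1" using \<gamma> by auto
  obtain Z :: "'a set" where Z: "finite Z" "real (card Z) \<le> (z / (1 / \<gamma>)) ^ ?d"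
    "\<And>y. y \<in> cball 0 3 \<Longrightarrow> \<exists>x\<in>Z. dist y x \<le> 1 / \<gamma>" using nets3[rule_format, OF \<gamma>1] by blast
  have key: "\<exists>B\<ge>0. \<forall>\<delta> k M. 0 < \<delta> \<longrightarrow> prob_space M \<longrightarrow> space M = configs \<Lambda> \<longrightarrow>
    traversal_bound \<sigma> K \<rho> \<delta> M \<longrightarrow> (\<forall>j<k. \<delta> \<le> c * (L / \<gamma> ^ j)) \<longrightarrow>
    Prob M {F \<in> space M. \<exists>C\<in>F. dense_runs \<gamma> L k C} \<le> B * (1/2) ^ k" if L: "0 < L" for L
  proof (intro exI[of _ "(a * (1 + 1 / L)) ^ ?d * K"] conjI allI impI)
    show "0 \<le> (a * (1 + 1 / L)) ^ ?d * K" using a L K by simp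
    fix \<delta> k and M :: "'a curve set measure"
    assume \<delta>: "0 < \<delta>" and M: "prob_space M" "space M = configs \<Lambda>" and tb: "traversal_bound \<sigma> K \<rho> \<delta> M"
      and \<delta>L: "\<forall>j<k. \<delta> \<le> c * (L / \<gamma> ^ j)"
    \<comment> \<open>Nets are available for radii up to 1. The term \<open>1 + 1 / L\<close> in the
      constant covers both values of the minimum.\<close>
    define \<eta> where "\<eta> = min 1 (L / \<gamma> ^ k)"
    have \<eta>: "0 < \<eta>" "\<eta> \<le> 1" using L \<gamma> by (auto simp: \<eta>_def)
    obtain X :: "'a set" where X: "finite X" "real (card X) \<le> (a / \<eta>) ^ ?d"
      "\<And>y. y \<in> cball 0 R \<Longrightarrow> \<exists>x\<in>X. dist y x \<le> \<eta>" using nets[rule_format, OF \<eta>] by blast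
    have X': "\<exists>x\<in>X. dist y x \<le> L / \<gamma> ^ k" if "y \<in> \<Lambda>" for y
      using X(3)[of y] R(2) that by (fastforce simp: \<eta>_def)
    have "a / \<eta> \<le> a * (1 + 1 / L) * \<gamma> ^ k"
    proof (cases "1 \<le> L / \<gamma> ^ k")
      case True
      have "1 * 1 \<le> (1 + 1 / L) * \<gamma> ^ k" using \<gamma> L by (intro mult_mono one_le_power) auto
      then show ?thesis using True a by (simp add: \<eta>_def mult.assoc)
    next
      case False
      then have "a / \<eta> = a * (1 / L) * \<gamma> ^ k" using L \<gamma> by (simp add: \<eta>_def)
      also have "\<dots> \<le> a * (1 + 1 / L) * \<gamma> ^ k" using a L \<gamma> by (intro mult_right_mono mult_left_mono) auto
      finally show ?thesis .
    qed
    then have "(a / \<eta>) ^ ?d \<le> (a * (1 + 1 / L) * \<gamma> ^ k) ^ ?d" using a \<eta> by (intro power_mono) auto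
    also have "\<dots> = (a * (1 + 1 / L)) ^ ?d * (\<gamma> ^ ?d) ^ k"
      by (simp only: power_mult_distrib power_mult[symmetric]) (simp only: mult.commute)
    finally have cX: "real (card X) \<le> (a * (1 + 1 / L)) ^ ?d * (\<gamma> ^ ?d) ^ k" using X(2) by linarith
    have "(real (card Z))\<^sup>2 \<le> ((z * \<gamma>) ^ ?d)\<^sup>2" using Z(2) by (intro power_mono) auto
    also have "\<dots> = (z ^ ?d)\<^sup>2 * \<gamma> ^ (2 * ?d)"
      by (simp only: power_mult_distrib power_mult[symmetric]) (simp only: mult.commute)
    finally have cZ: "(real (card Z))\<^sup>2 \<le> (z ^ ?d)\<^sup>2 * \<gamma> ^ (2 * ?d)" .
    have "Prob M {F \<in> space M. \<exists>C\<in>F. dense_runs \<gamma> L k C}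
        \<le> card X * K * (2 * (card Z)\<^sup>2 * sqrt (\<rho> ^ N)) ^ k"
      using \<delta>L N(2) by (intro Prob_dense_runs[OF M tb K \<rho> \<delta> \<sigma> \<gamma> L c_def N(1) _ _ X(1) X' Z(1,3)])
        (auto simp: c_def \<gamma>_def)
    also have "\<dots> \<le> ((a * (1 + 1 / L)) ^ ?d * (\<gamma> ^ ?d) ^ k) * K * (2 * ((z ^ ?d)\<^sup>2 * \<gamma> ^ (2 * ?d)) * sqrt (\<rho> ^ N)) ^ k"
      using cX cZ K \<rho> a L \<gamma> by (intro mult_mono power_mono mult_nonneg_nonneg) auto
    also have "\<dots> = (a * (1 + 1 / L)) ^ ?d * K * (\<gamma> ^ ?d * (2 * ((z ^ ?d)\<^sup>2 * \<gamma> ^ (2 * ?d)) * sqrt (\<rho> ^ N))) ^ k"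
    proof -
      have "x * y ^ k * K * w ^ k = x * K * (y * w) ^ k" for x y w :: real
        by (simp add: power_mult_distrib)
      then show ?thesis .
    qed
    also have "\<gamma> ^ ?d * (2 * ((z ^ ?d)\<^sup>2 * \<gamma> ^ (2 * ?d)) * sqrt (\<rho> ^ N)) = 2 * (z ^ ?d)\<^sup>2 * \<gamma> ^ (3 * ?d) * sqrt (\<rho> ^ N)"
    proof -
      have "\<gamma> ^ (3 * ?d) = \<gamma> ^ ?d * \<gamma> ^ (2 * ?d)" by (simp flip: power_add)
      moreover have "g * (2 * (x * h) * y) = 2 * x * (g * h) * y" for g h x y :: real by simp
      ultimately show ?thesis by (simp only:)
    qed
    also have "(a * (1 + 1 / L)) ^ ?d * K * (2 * (z ^ ?d)\<^sup>2 * \<gamma> ^ (3 * ?d) * sqrt (\<rho> ^ N)) ^ k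
        \<le> (a * (1 + 1 / L)) ^ ?d * K * (1 / 2) ^ k"
      using small a z L K \<rho> \<gamma> unfolding \<gamma>_def[symmetric]
      by (intro mult_left_mono power_mono mult_nonneg_nonneg zero_le_power) auto
    finally show "Prob M {F \<in> space M. \<exists>C\<in>F. dense_runs \<gamma> L k C} \<le> (a * (1 + 1 / L)) ^ ?d * K * (1 / 2) ^ k" .
  qed
  show ?thesis
    by (rule exI[of _ m], rule exI[of _ c], intro conjI m c allI impI, rule key[unfolded \<gamma>_def])
qed

text \<open>Discrete measures suffice for all lower bounds on capacities, and they can be moved by arbitrary
  maps without any question of measurability.\<close>

definition energy_le :: "real \<Rightarrow> real \<Rightarrow> real \<Rightarrow> 'a::metric_space set \<Rightarrow> bool" where
  "energy_le s l u A \<longleftrightarrow> (\<exists>p. set_pmf p \<subseteq> A \<and> energy s l (measure_pmf p) \<le> ennreal u)"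

lemma diameter_imp_run:
  assumes C: "C \<in> curves \<Lambda>" and r: "0 < r" "r \<le> diameter (curve_image C)"
  shows "\<exists>a b. run (curve_rep C) (r / 2) a b"
proof -
  let ?f = "curve_rep C"
  have f: "path ?f" using curve_repD[OF C] by simp
  have "bounded (curve_image C)"
    unfolding curve_image_def using f by (intro compact_imp_bounded compact_path_image)
  then obtain x y where "x \<in> curve_image C" "y \<in> curve_image C" "r / 2 < dist x y"
    using diameter_lower_bounded[of "curve_image C" "r / 2"] r by force
  then obtain s t where st: "s \<in> {0..1}" "t \<in> {0..1}" "r / 2 < dist (?f s) (?f t)"
    by (auto simp: curve_image_def path_image_def)
  show ?thesis
  proof (cases "s \<le> t")
    case True
    then show ?thesis using run_exists[OF f, of s t "r / 2"] st r by auto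
  next
    case False
    then show ?thesis using run_exists[OF f, of t s "r / 2"] st r by (auto simp: dist_commute)
  qed
qed

text \<open>The exponent \<open>dmin\<close> solves \<open>\<gamma> powr dmin = \<beta>\<close> and
  is fixed before \<open>r\<close>, \<open>s\<close> and \<open>\<epsilon>\<close>. A curve of high
  energy has dense runs at some depth from \<open>k0\<close> on, and these probabilities add up to
  at most \<open>2 * B * (1/2) ^ k0\<close>, whatever the cutoff; so \<open>u\<close> is uniform in
  the cutoff too.\<close>

lemma Prob_high_energy_small:
  fixes \<Lambda> :: "'a::euclidean_space set" and \<sigma> \<rho> K :: real
  assumes \<Lambda>: "bounded \<Lambda>" and \<sigma>: "0 < \<sigma>" and \<rho>: "0 < \<rho>" "\<rho> < 1" and K: "0 \<le> K"
  shows "\<exists>dmin>1. \<forall>r>0. \<forall>s. 0 < s \<longrightarrow> s < dmin \<longrightarrow> (\<forall>\<epsilon>>0. \<exists>u>0. \<forall>\<delta> M. 0 < \<delta> \<longrightarrow> prob_space M \<longrightarrow>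
    space M = configs \<Lambda> \<longrightarrow> traversal_bound \<sigma> K \<rho> \<delta> M \<longrightarrow>
    Prob M {F \<in> space M. \<exists>C\<in>F. r \<le> diameter (curve_image C) \<and> \<not> energy_le s \<delta> u (curve_image C)} \<le> \<epsilon>)"
proof -
  obtain m c where m: "100 \<le> m" and c: "0 < c"
    and small: "\<forall>L>0. \<exists>B\<ge>0. \<forall>\<delta> k M. 0 < \<delta> \<longrightarrow> prob_space M \<longrightarrow> space M = configs \<Lambda> \<longrightarrow>
    traversal_bound \<sigma> K \<rho> \<delta> M \<longrightarrow> (\<forall>j<k. \<delta> \<le> c * (L / (real m + 1/4) ^ j)) \<longrightarrow>
    Prob M {F \<in> space M. \<exists>C\<in>F. dense_runs (real m + 1/4) L k C} \<le> B * (1/2) ^ k"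
    using Prob_dense_runs_small[OF assms] by (elim exE conjE) (rule that)
  define \<gamma> where "\<gamma> = real m + 1/4"
  define \<beta> where "\<beta> = sqrt (m * (m + 1))"
  have \<gamma>: "100 \<le> \<gamma>" using m by (simp add: \<gamma>_def)
  have "\<gamma>\<^sup>2 < real m * real (m + 1)" using m by (simp add: \<gamma>_def power2_eq_square algebra_simps)
  then have \<beta>: "\<gamma> < \<beta>" unfolding \<beta>_def by (intro real_less_rsqrt) (simp add: algebra_simps)
  define dmin where "dmin = ln \<beta> / ln \<gamma>"
  have dmin: "1 < dmin" using \<beta> \<gamma> by (simp add: dmin_def)
  have main: "\<exists>u>0. \<forall>\<delta> M. 0 < \<delta> \<longrightarrow> prob_space M \<longrightarrow>
    space M = configs \<Lambda> \<longrightarrow> traversal_bound \<sigma> K \<rho> \<delta> M \<longrightarrow>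
    Prob M {F \<in> space M. \<exists>C\<in>F. r \<le> diameter (curve_image C) \<and> \<not> energy_le s \<delta> u (curve_image C)} \<le> \<epsilon>"
    if r: "0 < r" and s: "0 < s" "s < dmin" and \<epsilon>: "0 < \<epsilon>" for r s \<epsilon>
  proof -
    define L where "L = r / 2"
    have L: "0 < L" using r by (simp add: L_def)
    obtain B where B: "0 \<le> B" and PB: "\<forall>\<delta> k M. 0 < \<delta> \<longrightarrow> prob_space M \<longrightarrow> space M = configs \<Lambda> \<longrightarrow>
      traversal_bound \<sigma> K \<rho> \<delta> M \<longrightarrow> (\<forall>j<k. \<delta> \<le> c * (L / \<gamma> ^ j)) \<longrightarrow>
      Prob M {F \<in> space M. \<exists>C\<in>F. dense_runs \<gamma> L k C} \<le> B * (1/2) ^ k"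
      using small[rule_format, OF L, folded \<gamma>_def] by (elim exE conjE) (rule that)
    have "(\<lambda>k. 2 * B * (1/2) ^ k) \<longlonglongrightarrow> 2 * B * 0"
      by (intro tendsto_mult tendsto_const LIMSEQ_realpow_zero) auto
    then have "\<forall>\<^sub>F k in sequentially. 2 * B * (1/2) ^ k < \<epsilon>"
      using \<epsilon> by (intro order_tendstoD) auto
    then obtain k0 where k0: "2 * B * (1/2) ^ k0 < \<epsilon>" by (auto simp: eventually_sequentially)
    have "\<gamma> powr s < \<gamma> powr dmin" using s \<gamma> by simp
    also have "\<dots> = \<beta>" using \<gamma> \<beta> by (simp add: dmin_def powr_def)
    finally have \<gamma>s: "\<gamma> powr s < \<beta>" .
    obtain u where u: "0 < u" and E: "\<forall>(f :: real \<Rightarrow> 'a) a b l n. path f \<longrightarrow> run f L a b \<longrightarrow> sparsely_straight f \<gamma> L k0 n \<longrightarrow>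
      0 < l \<longrightarrow> c * L / \<gamma> ^ Suc n \<le> l \<longrightarrow> (\<exists>p. set_pmf p \<subseteq> path_image f \<and> energy s l (measure_pmf p) \<le> ennreal u)"
      using sparse_energy[OF order_trans[OF _ m] L s(1) \<gamma>s[unfolded \<beta>_def \<gamma>_def] c, of k0, where 'a='a, folded \<gamma>_def]
      by (elim meta_impE exE conjE; (rule that)?) auto
    have key: "Prob M {F \<in> space M. \<exists>C\<in>F. r \<le> diameter (curve_image C) \<and> \<not> energy_le s \<delta> u (curve_image C)} \<le> \<epsilon>"
      if \<delta>: "0 < \<delta>" and M: "prob_space M" "space M = configs \<Lambda>" and tb: "traversal_bound \<sigma> K \<rho> \<delta> M" for \<delta> M
    proof -
      have "(\<lambda>n. c * L / \<gamma> ^ n) \<longlonglongrightarrow> 0"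
        using \<gamma> by (intro LIMSEQ_divide_realpow_zero) auto
      then have "\<forall>\<^sub>F n in sequentially. c * L / \<gamma> ^ n < \<delta>" using \<delta> by (rule order_tendstoD)
      then obtain n0 where "\<forall>n\<ge>n0. c * L / \<gamma> ^ n < \<delta>" by (auto simp: eventually_sequentially)
      then have "c * L / \<gamma> ^ Suc n0 \<le> \<delta>" by (meson le_SucI less_imp_le order_refl)
      \<comment> \<open>The depth at which the cylinders reach the cutoff. On all levels below
        \<open>n\<close> they are at least \<open>\<delta>\<close> long, so the hypothesis applies,
        and at depth \<open>n\<close> the cutoff is large enough for the last term of the energy
        bound.\<close>
      define n where "n = (LEAST n. c * L / \<gamma> ^ Suc n \<le> \<delta>)"
      have n: "c * L / \<gamma> ^ Suc n \<le> \<delta>"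
        unfolding n_def by (rule LeastI[of "\<lambda>n. c * L / \<gamma> ^ Suc n \<le> \<delta>"]) fact
      have below: "\<delta> \<le> c * (L / \<gamma> ^ j)" if "j < n" for j
      proof -
        have "\<delta> < c * L / \<gamma> ^ Suc j"
          using not_less_Least[of j "\<lambda>n. c * L / \<gamma> ^ Suc n \<le> \<delta>"] that by (simp add: n_def)
        also have "\<dots> \<le> c * L / \<gamma> ^ j"
          using c L \<gamma> by (intro divide_left_mono power_increasing) auto
        finally show ?thesis by simp
      qed
      have "{F \<in> space M. \<exists>C\<in>F. r \<le> diameter (curve_image C) \<and> \<not> energy_le s \<delta> u (curve_image C)}
        \<subseteq> (\<Union>k\<in>{k0..n}. {F \<in> space M. \<exists>C\<in>F. dense_runs \<gamma> L k C})"
      proof clarify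
        fix F C assume F: "F \<in> space M" "C \<in> F" and d: "r \<le> diameter (curve_image C)"
          and ne: "\<not> energy_le s \<delta> u (curve_image C)"
        have C: "C \<in> curves \<Lambda>" using F M(2) by (auto simp: configs_def)
        note f = curve_repD[OF C]
        obtain a b where "run (curve_rep C) L a b"
          using diameter_imp_run[OF C r d] by (auto simp: L_def)
        then have "\<not> sparsely_straight (curve_rep C) \<gamma> L k0 n"
          using E[rule_format, OF f(2) _ _ \<delta> n] ne by (auto simp: energy_le_def curve_image_def)
        then obtain A B k where "k0 \<le> k" "k \<le> n" "history (curve_rep C) \<gamma> L k A B"
          "k < 2 * card (straight_levels (curve_rep C) \<gamma> L k A B)"
          by (auto simp: sparsely_straight_def not_le)
        then have "dense_runs \<gamma> L k C" by (auto simp: dense_runs_def)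
        then show "F \<in> (\<Union>k\<in>{k0..n}. {F \<in> space M. \<exists>C\<in>F. dense_runs \<gamma> L k C})"
          using F \<open>k0 \<le> k\<close> \<open>k \<le> n\<close> by auto
      qed
      then have "Prob M {F \<in> space M. \<exists>C\<in>F. r \<le> diameter (curve_image C) \<and> \<not> energy_le s \<delta> u (curve_image C)}
        \<le> Prob M (\<Union>k\<in>{k0..n}. {F \<in> space M. \<exists>C\<in>F. dense_runs \<gamma> L k C})"
        by (rule Prob_mono[OF M(1)]) auto
      also have "\<dots> \<le> (\<Sum>k\<in>{k0..n}. Prob M {F \<in> space M. \<exists>C\<in>F. dense_runs \<gamma> L k C})"
        by (rule Prob_UNION_le[OF M(1)]) auto
      also have "\<dots> \<le> (\<Sum>k\<in>{k0..n}. B * (1/2) ^ k)"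
        using below by (intro sum_mono PB[rule_format, OF \<delta> M tb]) auto
      also have "\<dots> = B * (\<Sum>k\<in>{k0..n}. (1/2) ^ k)" by (simp add: sum_distrib_left)
      also have "\<dots> \<le> B * (2 * (1/2) ^ k0)"
        by (intro mult_left_mono B) (auto simp: sum_gp)
      also have "\<dots> \<le> \<epsilon>" using k0 by simp
      finally show ?thesis .
    qed
    show ?thesis by (rule exI[of _ u], intro conjI allI impI u key)
  qed
  show ?thesis by (rule exI[of _ dmin], intro conjI allI impI dmin main)
qed

section \<open>Energy, capacity and Hausdorff measure\<close>

lemma ennreal_inverse_antimono:
  assumes "a \<le> b"
  shows "inverse b \<le> inverse (a::ennreal)"
proof (cases "a = 0 \<or> b = top")
  case False
  then obtain p q where "0 < p" "0 < q" "a = ennreal p" "b = ennreal q"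
    using assms by (cases a; cases b) (auto simp: less_le top_unique)
  then show ?thesis using assms by (simp add: inverse_ennreal)
qed auto

lemma energy_antimono_cutoff:
  assumes "0 \<le> s" "l \<le> l'"
  shows "energy s l' M \<le> energy s l M"
  unfolding energy_def using assms
  by (intro nn_integral_mono ennreal_inverse_antimono ennreal_leI powr_mono2) (auto simp: le_max_iff_disj)

lemma energy_le_mono_cutoff:
  assumes "0 \<le> s" "l \<le> l'" "energy_le s l u A"
  shows "energy_le s l' u A"
  using assms(3) energy_antimono_cutoff[OF assms(1,2)] unfolding energy_le_def
  by (meson order_trans)

text \<open>For every \<open>x > 0\<close>, be it below or above 1,
  \<open>x powr - s \<le> 1 + x powr - s'\<close>; integration against a probability measure turns
  the constant into the additional 1.\<close>

lemma energy_le_lower_exponent: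
  assumes s: "0 \<le> s" "s \<le> s'" and l: "0 < l" and u: "0 \<le> u" "energy_le s' l u A"
  shows "energy_le s l (1 + u) A"
proof -
  obtain p where p: "set_pmf p \<subseteq> A" "energy s' l (measure_pmf p) \<le> ennreal u"
    using u by (auto simp: energy_le_def)
  have k: "inverse (ennreal (x powr s)) \<le> 1 + inverse (ennreal (x powr s'))" if x: "0 < x" for x
  proof -
    have "x powr - s \<le> 1 + x powr - s'"
    proof (cases "1 \<le> x")
      case True
      then have "x powr - s \<le> x powr 0" using s by (intro powr_mono) auto
      then show ?thesis using x by (simp add: add_increasing2)
    next
      case False
      then have "x powr - s \<le> x powr - s'" using s x by (intro powr_mono') auto
      then show ?thesis by simp
    qed
    then have "ennreal (x powr - s) \<le> 1 + ennreal (x powr - s')"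
      by (metis ennreal_1 ennreal_leI ennreal_plus powr_ge_zero zero_le_one)
    then show ?thesis using x by (simp add: inverse_ennreal powr_minus)
  qed
  have "energy s l (measure_pmf p) \<le>
      (\<integral>\<^sup>+ x. \<integral>\<^sup>+ y. 1 + inverse (ennreal (max (dist x y) l powr s')) \<partial>p \<partial>p)"
    unfolding energy_def using l by (intro nn_integral_mono k) auto
  also have "\<dots> = 1 + energy s' l (measure_pmf p)"
    by (simp add: energy_def nn_integral_add measure_pmf.emeasure_space_1[simplified])
  also have "\<dots> \<le> 1 + ennreal u" using p by (intro add_left_mono)
  also have "\<dots> = ennreal (1 + u)" using u by simp
  finally show ?thesis using p by (auto simp: energy_le_def)
qed

text \<open>Pushed forward to the Borel sets of the subspace, the discrete measure keeps its energy
  and competes in the infimum.\<close>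

lemma Cap_ge_of_energy_le:
  fixes A :: "'a::euclidean_space set"
  assumes "energy_le s l u A"
  shows "inverse (ennreal u) \<le> Cap s l A"
proof -
  obtain p where p: "set_pmf p \<subseteq> A" "energy s l (measure_pmf p) \<le> ennreal u"
    using assms by (auto simp: energy_le_def)
  obtain x0 where x0: "x0 \<in> A" using p(1) set_pmf_not_empty[of p] by blast
  \<comment> \<open>Every map out of a discrete space is measurable, but it has to take all its
    values in \<open>A\<close>; \<open>x0\<close> is the default off the support.\<close>
  define g where "g x = (if x \<in> A then x else x0)" for x
  define M where "M = distr (measure_pmf p) (restrict_space borel A) g"
  have g: "g \<in> measure_pmf p \<rightarrow>\<^sub>M restrict_space borel A"
    using x0 by (auto simp: measurable_def space_restrict_space g_def)
  interpret M: prob_space M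
    unfolding M_def using g by (rule measure_pmf.prob_space_distr)
  have sM: "sets M = sets (restrict_space borel A)" by (simp add: M_def)
  let ?k = "\<lambda>x y. inverse (ennreal (max (dist x y) l powr s))"
  have km: "(\<lambda>z. ?k (fst z) (snd z)) \<in> borel_measurable (M \<Otimes>\<^sub>M M)"
  proof -
    have id: "(\<lambda>x. x) \<in> M \<rightarrow>\<^sub>M borel"
      by (subst measurable_cong_sets[OF sM refl]) (rule measurable_restrict_space1, simp)
    have [measurable]: "fst \<in> M \<Otimes>\<^sub>M M \<rightarrow>\<^sub>M borel" "snd \<in> M \<Otimes>\<^sub>M M \<rightarrow>\<^sub>M borel"
      using measurable_compose[OF measurable_fst[of M M] id] measurable_compose[OF measurable_snd[of M M] id]
      by simp_all
    show ?thesis by measurable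
  qed
  have "energy s l M = (\<integral>\<^sup>+ x. \<integral>\<^sup>+ y. ?k x y \<partial>M \<partial>M)" by (simp add: energy_def)
  also have "\<dots> = (\<integral>\<^sup>+ x. \<integral>\<^sup>+ y. ?k (g x) y \<partial>M \<partial>p)"
    unfolding M_def using M.borel_measurable_nn_integral[of ?k M] km
    by (subst nn_integral_distr[OF g]) (simp_all add: M_def split_beta')
  also have "\<dots> = (\<integral>\<^sup>+ x. \<integral>\<^sup>+ y. ?k (g x) (g y) \<partial>p \<partial>p)"
    unfolding M_def by (subst nn_integral_distr[OF g]) (auto intro!: measurable_restrict_space1)
  also have "\<dots> = energy s l (measure_pmf p)"
    unfolding energy_def using p(1)
    by (intro nn_integral_cong_AE; simp add: AE_measure_pmf_iff)
      (auto intro!: nn_integral_cong_AE simp: AE_measure_pmf_iff g_def)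
  finally have "(INF \<mu>\<in>{\<mu>. prob_space \<mu> \<and> sets \<mu> = sets (restrict_space borel A)}. energy s l \<mu>) \<le> ennreal u"
    using p(2) M.prob_space_axioms sM by (intro INF_lower2[of M]) auto
  then show ?thesis unfolding Cap_def by (rule ennreal_inverse_antimono)
qed

text \<open>Assign each point to one cell. Pairs in a common cell already give energy at least the
  sum of \<open>d i powr - s * (pmf P i)\<^sup>2\<close>, and the masses \<open>pmf P i\<close> sum
  to 1, so the Cauchy-Schwarz inequality with weights \<open>d i powr s\<close> applies.\<close>

lemma energy_lower_bound_cover:
  fixes d :: "nat \<Rightarrow> real"
  assumes I: "finite I" and d: "\<And>i. i \<in> I \<Longrightarrow> 0 < d i \<and> l \<le> d i" and s: "0 \<le> s" and u: "0 \<le> u"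
    and W: "\<And>i x y. i \<in> I \<Longrightarrow> x \<in> W i \<Longrightarrow> y \<in> W i \<Longrightarrow> dist x y \<le> d i"
    and p: "set_pmf p \<subseteq> (\<Union>i\<in>I. W i)" "energy s l (measure_pmf p) \<le> ennreal u"
  shows "1 \<le> u * (\<Sum>i\<in>I. d i powr s)"
proof -
  define c where "c x = (SOME i. i \<in> I \<and> x \<in> W i)" for x
  have c: "c x \<in> I \<and> x \<in> W (c x)" if "x \<in> set_pmf p" for x
    unfolding c_def using p(1) that by (intro someI_ex[of "\<lambda>i. i \<in> I \<and> x \<in> W i"]) auto
  define P where "P = map_pmf c p"
  have setP: "set_pmf P \<subseteq> I" using c by (auto simp: P_def)
  have finP: "finite (set_pmf P)" using setP I by (rule finite_subset)
  let ?S = "\<Sum>i\<in>I. d i powr s"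
  have "I \<noteq> {}" using setP set_pmf_not_empty[of P] by blast
  moreover have "0 < d i powr s" if "i \<in> I" for i using d[OF that] by simp
  ultimately have S: "0 < ?S" using I by (intro sum_pos) auto
  have sumP: "(\<Sum>i\<in>I. pmf P i) = 1" using I setP by (rule sum_pmf_eq_1)
  have "ennreal (\<Sum>i\<in>I. d i powr - s * (pmf P i)\<^sup>2) = (\<integral>\<^sup>+ i. ennreal (d i powr - s) * ennreal (pmf P i) \<partial>P)"
  proof -
    have "(\<integral>\<^sup>+ i. ennreal (d i powr - s) * ennreal (pmf P i) \<partial>P)
        = (\<Sum>i\<in>set_pmf P. ennreal (d i powr - s) * ennreal (pmf P i) * ennreal (pmf P i))"
      using finP by (intro nn_integral_measure_pmf_finite) auto
    also have "\<dots> = (\<Sum>i\<in>I. ennreal (d i powr - s) * ennreal (pmf P i) * ennreal (pmf P i))"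
      using setP I by (intro sum.mono_neutral_left) (auto simp: set_pmf_iff)
    also have "\<dots> = (\<Sum>i\<in>I. ennreal (d i powr - s * (pmf P i)\<^sup>2))"
      by (simp add: ennreal_mult power2_eq_square mult.assoc)
    finally show ?thesis by (simp add: sum_ennreal)
  qed
  also have "\<dots> = (\<integral>\<^sup>+ i. \<integral>\<^sup>+ j. ennreal (d i powr - s) * indicator {i} j \<partial>P \<partial>P)"
    by (simp add: nn_integral_cmult emeasure_pmf_single)
  also have "\<dots> = (\<integral>\<^sup>+ x. \<integral>\<^sup>+ y. ennreal (d (c x) powr - s) * indicator {c x} (c y) \<partial>p \<partial>p)"
    by (simp add: P_def)
  also have "\<dots> \<le> energy s l (measure_pmf p)"
    unfolding energy_def
  proof (intro nn_integral_mono_AE, unfold AE_measure_pmf_iff, intro ballI nn_integral_mono_AE, unfold AE_measure_pmf_iff, intro ballI)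
    fix x y assume xy: "x \<in> set_pmf p" "y \<in> set_pmf p"
    show "ennreal (d (c x) powr - s) * indicator {c x} (c y) \<le> inverse (ennreal (max (dist x y) l powr s))"
    proof (cases "c y = c x")
      case True
      have di: "0 < d (c x)" "max (dist x y) l \<le> d (c x)"
        using c[OF xy(1)] c[OF xy(2)] True W d by auto
      have "ennreal (d (c x) powr - s) = inverse (ennreal (d (c x) powr s))"
        using di by (simp add: inverse_ennreal powr_minus)
      also have "\<dots> \<le> inverse (ennreal (max (dist x y) l powr s))"
        using di s by (intro ennreal_inverse_antimono ennreal_leI powr_mono2) (auto simp: le_max_iff_disj)
      finally show ?thesis using True by simp
    qed simp
  qed
  also have "\<dots> \<le> ennreal u" by fact
  finally have le: "(\<Sum>i\<in>I. d i powr - s * (pmf P i)\<^sup>2) \<le> u" using u by simp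
  have "1 / ?S = (\<Sum>i\<in>I. 2 * pmf P i / ?S - d i powr s / ?S\<^sup>2)"
  proof -
    have "(\<Sum>i\<in>I. 2 * pmf P i / ?S - d i powr s / ?S\<^sup>2)
        = 2 * (\<Sum>i\<in>I. pmf P i) / ?S - ?S / ?S\<^sup>2"
      by (simp only: sum_subtractf sum_divide_distrib sum_distrib_left)
    also have "\<dots> = 1 / ?S" using S by (simp only: sumP) (simp add: power2_eq_square)
    finally show ?thesis ..
  qed
  also have "\<dots> \<le> (\<Sum>i\<in>I. d i powr - s * (pmf P i)\<^sup>2)"
  proof (rule sum_mono)
    fix i assume i: "i \<in> I"
    have D: "0 < d i powr s" using d[OF i] by simp
    \<comment> \<open>The Cauchy-Schwarz inequality as a completed square, with the total
      \<open>?S\<close> in the place of \<open>T\<close>.\<close>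
    have square: "(m - D / T)\<^sup>2 / D = inverse D * m\<^sup>2 - (2 * m / T - D / T\<^sup>2)"
      if "0 < D" "0 < T" for m D T :: real
      using that by (simp add: power2_eq_square field_simps)
    have "0 \<le> (pmf P i - d i powr s / ?S)\<^sup>2 / d i powr s" using D by simp
    also have "\<dots> = d i powr - s * (pmf P i)\<^sup>2 - (2 * pmf P i / ?S - d i powr s / ?S\<^sup>2)"
      unfolding powr_minus by (rule square[OF D S])
    finally show "2 * pmf P i / ?S - d i powr s / ?S\<^sup>2 \<le> d i powr - s * (pmf P i)\<^sup>2" by simp
  qed
  finally have "1 / ?S \<le> u" using le by linarith
  then show ?thesis using S by (simp add: field_simps)
qed

text \<open>A cheap cover is fattened to an open one. Compactness leaves finitely many sets, and
  only then can a cutoff below all their sizes be selected. The measure may change with the cutoff,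
  so no limit measure has to be constructed.\<close>

lemma hausdorff_measure_pos_of_energy_le:
  assumes A: "compact A" and s: "0 < s" and u: "0 < u"
    and E: "\<And>l\<^sub>0. 0 < l\<^sub>0 \<Longrightarrow> \<exists>l. 0 < l \<and> l \<le> l\<^sub>0 \<and> energy_le s l u A"
  shows "hausdorff_measure s A \<noteq> 0"
proof -
  \<comment> \<open>One \<kappa> bounds the sum over the given cover, a second one pays for the
    fattening; together they make \<open>1 / u\<close>.\<close>
  define \<kappa> where "\<kappa> = 1 / (2 * u)"
  have \<kappa>: "0 < \<kappa>" using u by (simp add: \<kappa>_def)
  have "ennreal \<kappa> \<le> hausdorff_premeasure s 1 A"
    unfolding hausdorff_premeasure_def
  proof (rule INF_greatest, clarify)
    fix U :: "nat \<Rightarrow> 'a set"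
    assume cover: "A \<subseteq> (\<Union>i. U i)" and U: "\<forall>i. bounded (U i) \<and> diameter (U i) \<le> 1"
    show "ennreal \<kappa> \<le> (\<Sum>i. ennreal (diameter (U i) powr s))"
    proof (rule ccontr)
      assume "\<not> ennreal \<kappa> \<le> (\<Sum>i. ennreal (diameter (U i) powr s))"
      then have small: "(\<Sum>i. ennreal (diameter (U i) powr s)) < ennreal \<kappa>" by simp
      \<comment> \<open>The summable extra term inside the power keeps the total under control and
        makes \<open>d i\<close> exceed the diameter, even where that is zero.\<close>
      define d where "d i = (diameter (U i) powr s + \<kappa> * (1/2) ^ Suc i) powr (1 / s)" for i
      have D0: "0 \<le> diameter (U i)" for i using U by (intro diameter_ge_0) auto
      have ds: "d i powr s = diameter (U i) powr s + \<kappa> * (1/2) ^ Suc i" for i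
        using s \<kappa> by (simp add: d_def powr_powr add_nonneg_nonneg)
      have d0: "0 < d i" for i
        using \<kappa> unfolding d_def by (intro powr_gt_zero[THEN iffD2]) (metis add_nonneg_pos powr_ge_zero mult_pos_pos zero_less_power half_gt_zero zero_less_one less_numeral_extra(3))
      have dlt: "diameter (U i) < d i" for i
      proof -
        have "diameter (U i) powr s < d i powr s" unfolding ds using \<kappa> by simp
        then show ?thesis using D0 d0[of i] s by (meson not_less powr_mono2 less_imp_le)
      qed
      define V where "V i = (\<Union>x\<in>U i. ball x ((d i - diameter (U i)) / 2))" for i
      have VU: "U i \<subseteq> V i" for i using dlt by (force simp: V_def)
      have "open (V i)" for i by (auto simp: V_def)
      moreover have "A \<subseteq> (\<Union>i\<in>UNIV. V i)" using cover VU by blast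
      ultimately obtain I where I: "finite I" "A \<subseteq> (\<Union>i\<in>I. V i)"
        using compactE_image[OF A, of UNIV V] by metis
      have Vd: "dist x y \<le> d i" if xV: "x \<in> V i" and yV: "y \<in> V i" for i x y
      proof -
        obtain a where a: "a \<in> U i" "dist a x < (d i - diameter (U i)) / 2"
          using xV by (auto simp: V_def)
        obtain b where b: "b \<in> U i" "dist b y < (d i - diameter (U i)) / 2"
          using yV by (auto simp: V_def)
        note ab = a b
        then have "dist a b \<le> diameter (U i)" using U by (intro diameter_bounded_bound) auto
        then show ?thesis
          using ab dist_triangle[of x y a] dist_triangle[of a y b] by (simp add: dist_commute)
      qed
      define l0 where "l0 = Min (insert 1 (d ` I))"
      have l0: "0 < l0" "\<And>i. i \<in> I \<Longrightarrow> l0 \<le> d i" using I d0 by (auto simp: l0_def)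
      obtain l p where l: "l \<le> l0" and p: "set_pmf p \<subseteq> A" "energy s l (measure_pmf p) \<le> ennreal u"
        using E[OF l0(1)] by (auto simp: energy_le_def)
      have "1 \<le> u * (\<Sum>i\<in>I. d i powr s)"
        using d0 l0 l s u p I(2) Vd by (intro energy_lower_bound_cover[OF I(1), of d l s u V p]) force+
      also have "(\<Sum>i\<in>I. d i powr s) < \<kappa> + \<kappa>"
      proof -
        have "ennreal (\<Sum>i\<in>I. diameter (U i) powr s) = (\<Sum>i\<in>I. ennreal (diameter (U i) powr s))" by simp
        also have "\<dots> \<le> (\<Sum>i. ennreal (diameter (U i) powr s))" using I(1) by (intro sum_le_suminf) auto
        also have "\<dots> < ennreal \<kappa>" by (rule small)
        finally have 1: "(\<Sum>i\<in>I. diameter (U i) powr s) < \<kappa>" using \<kappa> by (simp add: ennreal_less_iff sum_nonneg)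
        have "(\<Sum>i\<in>I. (1/2 :: real) ^ Suc i) \<le> (\<Sum>i. (1/2) ^ Suc i)"
          using I(1) power_half_series by (intro sum_le_suminf) (auto simp: sums_iff)
        also have "\<dots> = 1" using power_half_series by (simp add: sums_iff)
        finally have "\<kappa> * (\<Sum>i\<in>I. (1/2) ^ Suc i) \<le> \<kappa>" using \<kappa> by simp
        then show ?thesis using 1 unfolding ds sum.distrib sum_distrib_left by simp
      qed
      finally show False using u by (simp add: \<kappa>_def)
    qed
  qed
  also have "\<dots> \<le> hausdorff_measure s A"
    unfolding hausdorff_measure_def by (rule SUP_upper) simp
  finally show ?thesis using \<kappa> by auto
qed

section \<open>Rectifiable curves have dimension at most one\<close>

lemma hausdorff_premeasure_antimono: "e \<le> e' \<Longrightarrow> hausdorff_premeasure s e' A \<le> hausdorff_premeasure s e A"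
  unfolding hausdorff_premeasure_def by (rule INF_superset_mono) (auto intro: order_trans)

text \<open>Cut the curve into arcs of diameter at most \<open>e\<close>. The diameters add up to at
  most the length bound, so their \<open>s\<close>-th powers add up to at most
  \<open>e powr (s - 1)\<close> times it, which tends to zero with \<open>e\<close>.\<close>

lemma rectifiable_imp_hausdorff_measure_0:
  assumes C: "C \<in> curves \<Lambda>" and rect: "rectifiable_curve C" and s: "1 < s"
  shows "hausdorff_measure s (curve_image C) = 0"
proof -
  obtain f B where fC: "f \<in> C" and len: "\<And>n t. mono_on {..n} t \<Longrightarrow> t ` {..n} \<subseteq> {0..1} \<Longrightarrow>
     (\<Sum>i<n. dist (f (t i)) (f (t (Suc i)))) \<le> B"
    using rect by (auto simp: rectifiable_curve_def)
  have f: "path f" using curve_rep_same[OF C fC] by (simp add: same_curve_def paths_in_def)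
  have B: "0 \<le> B" using len[of 0 "\<lambda>_. 0"] by (simp add: monotone_on_def)
  have bound: "hausdorff_premeasure s e (curve_image C) \<le> ennreal (e powr (s - 1) * B)" if e: "0 < e" for e
  proof -
    have contf: "continuous_on {0..1} f" using f by (simp add: path_def)
    then obtain \<eta> where \<eta>: "0 < \<eta>" "\<And>x y. x \<in> {0..1} \<Longrightarrow> y \<in> {0..1} \<Longrightarrow> dist y x < \<eta> \<Longrightarrow> dist (f y) (f x) < e"
      using compact_uniformly_continuous[OF contf compact_Icc] e unfolding uniformly_continuous_on_def by metis
    obtain n :: nat where n: "0 < n" "1 / real n < \<eta>" using \<eta>(1) real_arch_inverse[of \<eta>] by (auto simp: inverse_eq_divide)
    define J where "J i = {real i / n..real (Suc i) / n}" for i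
    have J01: "J i \<subseteq> {0..1}" "compact (J i)" "J i \<noteq> {}" if "i < n" for i
    proof -
      have "real (Suc i) / n \<le> 1" using that by simp
      then show "J i \<subseteq> {0..1}" by (auto simp: J_def intro: order_trans)
    qed (auto simp: J_def divide_right_mono)
    have cA: "compact (f ` J i)" if "i < n" for i
      using J01[OF that] by (intro compact_continuous_image continuous_on_subset[OF contf]) auto
    have "\<exists>x y. x \<in> J i \<and> y \<in> J i \<and> x \<le> y \<and> diameter (f ` J i) = dist (f x) (f y)" if i: "i < n" for i
    proof -
      obtain x y where xy: "x \<in> J i" "y \<in> J i" "dist (f x) (f y) = diameter (f ` J i)"
        using diameter_compact_attained[OF cA[OF i]] J01(3)[OF i] by auto
      show ?thesis
      proof (cases "x \<le> y")
        case True then show ?thesis using xy by metis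
      next
        case False then show ?thesis using xy by (metis dist_commute linear)
      qed
    qed
    then obtain p q where pq: "\<And>i. i < n \<Longrightarrow> p i \<in> J i \<and> q i \<in> J i \<and> p i \<le> q i \<and> diameter (f ` J i) = dist (f (p i)) (f (q i))"
      by metis
    \<comment> \<open>The points at which the diameters are attained, ordered within each arc,
      interlace to one monotone sequence, to which the length bound applies. The default 1 is the
      value at the final index \<open>2 * n\<close>.\<close>
    define t where "t k = (if k div 2 < n then if even k then p (k div 2) else q (k div 2) else 1)" for k
    have "p i \<in> {0..1} \<and> q i \<in> {0..1}" if "i < n" for i
      using pq[OF that] J01(1)[OF that] by blast
    then have t01: "t k \<in> {0..1}" for k by (simp add: t_def)
    have "t k \<le> t (Suc k)" for k
    proof (cases "even k")
      case True
      then have "Suc k div 2 = k div 2" by auto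
      then show ?thesis using True pq[of "k div 2"] by (auto simp: t_def)
    next
      case False
      then have k: "Suc k div 2 = Suc (k div 2)" by presburger
      show ?thesis
      proof (cases "Suc (k div 2) < n")
        case True
        then have "q (k div 2) \<le> p (Suc (k div 2))"
          using pq[of "k div 2"] pq[of "Suc (k div 2)"] by (auto simp: J_def)
        then show ?thesis using True False k by (auto simp: t_def)
      next
        case F: False
        then have "t (Suc k) = 1" using k by (simp add: t_def)
        then show ?thesis using t01[of k] by simp
      qed
    qed
    then have "mono t" by (simp add: mono_iff_le_Suc)
    then have "mono_on {..2 * n} t" by (rule mono_imp_mono_on)
    then have "(\<Sum>k<2 * n. dist (f (t k)) (f (t (Suc k)))) \<le> B"
      using t01 by (intro len) auto
    moreover have "(\<Sum>i<m. dist (f (p i)) (f (q i))) \<le> (\<Sum>k<2 * m. dist (f (t k)) (f (t (Suc k))))" if "m \<le> n" for m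
      using that
    proof (induction m)
      case (Suc m)
      have "t (2 * m) = p m" "t (Suc (2 * m)) = q m" using Suc.prems by (simp_all add: t_def)
      then show ?case using Suc by (simp add: add_increasing2)
    qed simp
    ultimately have len': "(\<Sum>i<n. dist (f (p i)) (f (q i))) \<le> B" by force
    have diam: "diameter (f ` J i) \<le> e" if i: "i < n" for i
    proof -
      have "p i \<in> {0..1}" "q i \<in> {0..1}" using pq[OF i] J01(1)[OF i] by auto
      moreover have "dist (p i) (q i) < \<eta>"
      proof -
        have "\<bar>p i - q i\<bar> \<le> real (Suc i) / n - real i / n" using pq[OF i] by (auto simp: J_def)
        also have "\<dots> = 1 / n" by (simp add: diff_divide_distrib[symmetric])
        finally show ?thesis using n by (simp add: dist_real_def)
      qed
      ultimately show ?thesis using \<eta>(2) pq[OF i] by (metis less_imp_le)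
    qed
    define U where "U i = (if i < n then f ` J i else {})" for i
    have "curve_image C \<subseteq> (\<Union>i. U i)"
    proof
      fix z assume "z \<in> curve_image C"
      then obtain x where x: "x \<in> {0..1}" "z = f x"
        using curve_image_eq[OF C fC] by (auto simp: path_image_def)
      \<comment> \<open>At the right end the floor would give \<open>n\<close>, one beyond the last
        arc.\<close>
      define i where "i = (if x = 1 then n - 1 else nat \<lfloor>x * n\<rfloor>)"
      have "i < n \<and> x \<in> J i"
      proof (cases "x = 1")
        case True then show ?thesis using n by (auto simp: i_def J_def)
      next
        case False
        have "0 \<le> x * n" "x * n < n" using x False n by auto
        then have "i < n" "real i \<le> x * n" "x * n \<le> real (Suc i)" using False unfolding i_def by (simp_all, linarith+)
        then show ?thesis using n by (auto simp: J_def field_simps)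
      qed
      then show "z \<in> (\<Union>i. U i)" using x by (auto simp: U_def intro!: exI[of _ i])
    qed
    moreover have "bounded (U i) \<and> diameter (U i) \<le> e" for i
      using cA[of i] diam[of i] e by (auto simp: U_def compact_imp_bounded)
    ultimately have "hausdorff_premeasure s e (curve_image C) \<le> (\<Sum>i. ennreal (diameter (U i) powr s))"
      unfolding hausdorff_premeasure_def by (intro INF_lower) auto
    also have "\<dots> = (\<Sum>i<n. ennreal (diameter (U i) powr s))"
      using s by (intro suminf_finite) (auto simp: U_def)
    also have "\<dots> = ennreal (\<Sum>i<n. diameter (U i) powr s)" by simp
    also have "\<dots> \<le> ennreal (e powr (s - 1) * B)"
    proof (rule ennreal_leI)
      have "(\<Sum>i<n. diameter (U i) powr s) \<le> (\<Sum>i<n. e powr (s - 1) * dist (f (p i)) (f (q i)))"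
      proof (rule sum_mono)
        fix i assume i: "i \<in> {..<n}"
        then have D: "diameter (U i) = dist (f (p i)) (f (q i))" "diameter (U i) \<le> e"
          using pq[of i] diam[of i] by (auto simp: U_def)
        have "diameter (U i) powr s = diameter (U i) powr (s - 1) * diameter (U i)"
          using D powr_mult_base[of "diameter (U i)" "s - 1"] by (simp add: mult.commute)
        also have "\<dots> \<le> e powr (s - 1) * diameter (U i)"
          using D s by (intro mult_right_mono powr_mono2) auto
        finally show "diameter (U i) powr s \<le> e powr (s - 1) * dist (f (p i)) (f (q i))" using D by simp
      qed
      also have "\<dots> = e powr (s - 1) * (\<Sum>i<n. dist (f (p i)) (f (q i)))" by (simp add: sum_distrib_left)
      also have "\<dots> \<le> e powr (s - 1) * B" using len' by (intro mult_left_mono) auto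
      finally show "(\<Sum>i<n. diameter (U i) powr s) \<le> e powr (s - 1) * B" .
    qed
    finally show ?thesis .
  qed
  have "hausdorff_premeasure s e (curve_image C) \<le> 0" if e: "0 < e" for e
  proof (rule tendsto_lowerbound)
    have "((\<lambda>x. x powr (s - 1) * B) \<longlongrightarrow> 0 powr (s - 1) * B) (at_right 0)"
      using s eventually_mono[OF eventually_at_right_real[OF e], of "\<lambda>x. 0 \<le> x"]
      by (intro tendsto_mult tendsto_powr' tendsto_const tendsto_ident_at) auto
    then have "((\<lambda>x. ennreal (x powr (s - 1) * B)) \<longlongrightarrow> ennreal 0) (at_right 0)"
      using s by (intro tendsto_ennrealI) simp
    then show "((\<lambda>x. ennreal (x powr (s - 1) * B)) \<longlongrightarrow> 0) (at_right 0)" by simp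
    have "\<forall>\<^sub>F x in at_right 0. x \<in> {0<..<e}" by (rule eventually_at_right_real[OF e])
    then show "\<forall>\<^sub>F x in at_right 0. hausdorff_premeasure s e (curve_image C) \<le> ennreal (x powr (s - 1) * B)"
    proof eventually_elim
      case (elim x)
      have "hausdorff_premeasure s e (curve_image C) \<le> hausdorff_premeasure s x (curve_image C)"
        using elim by (intro hausdorff_premeasure_antimono) auto
      also have "\<dots> \<le> ennreal (x powr (s - 1) * B)" using elim by (intro bound) auto
      finally show ?case .
    qed
  qed auto
  then show ?thesis by (simp add: hausdorff_measure_def)
qed

section \<open>The distance of curves\<close>

lemma bdd_above_reparam_dist:
  assumes "path f" "path g" "\<phi> \<in> reparams" "\<psi> \<in> reparams"
  shows "bdd_above ((\<lambda>t. dist (f (\<phi> t)) (g (\<psi> t))) ` {0..1})"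
proof -
  have "continuous_on {0..1} (\<lambda>t. f (\<phi> t))" "continuous_on {0..1} (\<lambda>t. g (\<psi> t))"
    using assms reparams_image[OF assms(3)] reparams_image[OF assms(4)]
    by (auto simp: path_def reparams_def intro!: continuous_on_compose2[of "{0..1}"])
  then have "compact ((\<lambda>t. dist (f (\<phi> t)) (g (\<psi> t))) ` {0..1})"
    by (intro compact_continuous_image continuous_intros) auto
  then show ?thesis by (intro bounded_imp_bdd_above compact_imp_bounded)
qed

lemma reparam_dist_SUP_nonneg:
  assumes "path f" "path g" "\<phi> \<in> reparams" "\<psi> \<in> reparams"
  shows "0 \<le> (SUP t\<in>{0..1}. dist (f (\<phi> t)) (g (\<psi> t)))"
  by (rule order_trans[OF zero_le_dist cSUP_upper[OF _ bdd_above_reparam_dist[OF assms], of 0]]) simp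

text \<open>Composition with the inverse of the first reparametrisation merges the two into a single
  one on the second path.\<close>

lemma param_dist_lessD:
  assumes f: "path f" "path g" and less: "param_dist f g < e"
  shows "\<exists>\<alpha>\<in>reparams. \<forall>t\<in>{0..1}. dist (f t) (g (\<alpha> t)) < e"
proof -
  have "(\<lambda>(\<phi>, \<psi>). SUP t\<in>{0..1}. dist (f (\<phi> t)) (g (\<psi> t))) ` (reparams \<times> reparams) \<noteq> {}"
    using reparams_id by blast
  from cInf_lessD[OF this less[unfolded param_dist_def]]
  obtain \<phi> \<psi> where r: "\<phi> \<in> reparams" "\<psi> \<in> reparams"
    and sup: "(SUP t\<in>{0..1}. dist (f (\<phi> t)) (g (\<psi> t))) < e" by auto
  let ?i = "inv_into {0..1} \<phi>"
  have i: "?i \<in> reparams" using r(1) by (rule reparams_inv)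
  have "dist (f t) (g ((\<psi> \<circ> ?i) t)) < e" if t: "t \<in> {0..1}" for t
  proof -
    have "\<phi> (?i t) = t" using r(1) t by (auto simp: reparams_def bij_betw_inv_into_right)
    then have "dist (f t) (g ((\<psi> \<circ> ?i) t)) = dist (f (\<phi> (?i t))) (g (\<psi> (?i t)))" by simp
    also have "\<dots> \<le> (SUP t\<in>{0..1}. dist (f (\<phi> t)) (g (\<psi> t)))"
      by (rule cSUP_upper[OF reparams_in[OF i t] bdd_above_reparam_dist[OF f r]])
    finally show ?thesis using sup by simp
  qed
  then show ?thesis using reparams_comp[OF r(2) i] by blast
qed

lemma param_dist_leI:
  assumes f: "path f" "path g" and \<alpha>: "\<alpha> \<in> reparams" "\<And>t. t \<in> {0..1} \<Longrightarrow> dist (f t) (g (\<alpha> t)) \<le> e"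
  shows "param_dist f g \<le> e"
proof -
  have "param_dist f g \<le> (SUP t\<in>{0..1}. dist (f t) (g (\<alpha> t)))"
    unfolding param_dist_def
  proof (rule cINF_lower2)
    show "bdd_below ((\<lambda>(\<phi>, \<psi>). SUP t\<in>{0..1}. dist (f (\<phi> t)) (g (\<psi> t))) ` (reparams \<times> reparams))"
      by (rule bdd_belowI2[of _ 0]) (auto intro: reparam_dist_SUP_nonneg[OF f])
    show "(\<lambda>t. t, \<alpha>) \<in> reparams \<times> reparams" using reparams_id \<alpha> by simp
  qed simp
  also have "\<dots> \<le> e" using \<alpha>(2) by (intro cSUP_least) auto
  finally show ?thesis .
qed

lemma curve_dist_lessD:
  assumes "C \<in> curves \<Lambda>" "D \<in> curves \<Lambda>" "curve_dist C D < e"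
  shows "\<exists>\<alpha>\<in>reparams. \<forall>t\<in>{0..1}. dist (curve_rep C t) (curve_rep D (\<alpha> t)) < e"
  using assms curve_repD(2) unfolding curve_dist_def by (blast intro: param_dist_lessD)

lemma curve_dist_nonneg:
  assumes "C \<in> curves \<Lambda>" "D \<in> curves \<Lambda>"
  shows "0 \<le> curve_dist C D"
  unfolding curve_dist_def param_dist_def
  using reparams_id reparam_dist_SUP_nonneg[OF curve_repD(2)[OF assms(1)] curve_repD(2)[OF assms(2)]]
  by (intro cINF_greatest) auto

lemma curve_dist_commute_le:
  assumes C: "C \<in> curves \<Lambda>" and D: "D \<in> curves \<Lambda>"
  shows "curve_dist D C \<le> curve_dist C D"
proof (rule field_le_epsilon)
  fix e :: real assume "0 < e"
  then obtain \<alpha> where \<alpha>: "\<alpha> \<in> reparams"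
    "\<forall>t\<in>{0..1}. dist (curve_rep C t) (curve_rep D (\<alpha> t)) < curve_dist C D + e"
    using curve_dist_lessD[OF C D, of "curve_dist C D + e"] by auto
  let ?i = "inv_into {0..1} \<alpha>"
  have i: "?i \<in> reparams" using \<alpha>(1) by (rule reparams_inv)
  show "curve_dist D C \<le> curve_dist C D + e"
    unfolding curve_dist_def[of D C]
  proof (rule param_dist_leI[OF curve_repD(2)[OF D] curve_repD(2)[OF C] i])
    fix t :: real assume t: "t \<in> {0..1}"
    have "\<alpha> (?i t) = t" using \<alpha>(1) t by (auto simp: reparams_def bij_betw_inv_into_right)
    then show "dist (curve_rep D t) (curve_rep C (?i t)) \<le> curve_dist C D + e"
      using \<alpha>(2) reparams_in[OF i t] by (metis dist_commute less_imp_le)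
  qed
qed

lemma curve_dist_commute:
  "C \<in> curves \<Lambda> \<Longrightarrow> D \<in> curves \<Lambda> \<Longrightarrow> curve_dist C D = curve_dist D C"
  by (intro antisym curve_dist_commute_le)

lemma curve_dist_triangle:
  assumes C: "C \<in> curves \<Lambda>" and D: "D \<in> curves \<Lambda>" and E: "E \<in> curves \<Lambda>"
  shows "curve_dist C E \<le> curve_dist C D + curve_dist D E"
proof (rule field_le_epsilon)
  fix e :: real assume e: "0 < e"
  obtain \<alpha> where \<alpha>: "\<alpha> \<in> reparams"
    "\<forall>t\<in>{0..1}. dist (curve_rep C t) (curve_rep D (\<alpha> t)) < curve_dist C D + e / 2"
    using curve_dist_lessD[OF C D, of "curve_dist C D + e / 2"] e by auto
  obtain \<beta> where \<beta>: "\<beta> \<in> reparams"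
    "\<forall>t\<in>{0..1}. dist (curve_rep D t) (curve_rep E (\<beta> t)) < curve_dist D E + e / 2"
    using curve_dist_lessD[OF D E, of "curve_dist D E + e / 2"] e by auto
  show "curve_dist C E \<le> curve_dist C D + curve_dist D E + e"
    unfolding curve_dist_def[of C E]
  proof (rule param_dist_leI[OF curve_repD(2)[OF C] curve_repD(2)[OF E] reparams_comp[OF \<beta>(1) \<alpha>(1)]])
    fix t :: real assume t: "t \<in> {0..1}"
    have "dist (curve_rep C t) (curve_rep D (\<alpha> t)) < curve_dist C D + e / 2"
      "dist (curve_rep D (\<alpha> t)) (curve_rep E (\<beta> (\<alpha> t))) < curve_dist D E + e / 2"
      using \<alpha>(2) \<beta>(2) t reparams_in[OF \<alpha>(1) t] by blast+
    then show "dist (curve_rep C t) (curve_rep E ((\<beta> \<circ> \<alpha>) t)) \<le> curve_dist C D + curve_dist D E + e"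
      using dist_triangle[of "curve_rep C t" "curve_rep E (\<beta> (\<alpha> t))" "curve_rep D (\<alpha> t)"] by simp
  qed
qed

text \<open>Moving all points by at most \<open>l / 2\<close> changes distances by at most
  \<open>l\<close>, so distances truncated at \<open>l\<close> shrink by a factor of at most
  two.\<close>

lemma energy_le_perturb:
  assumes l: "0 < l" and s: "0 \<le> s" and near: "\<And>x. x \<in> A \<Longrightarrow> \<exists>y\<in>B. dist x y \<le> l / 2"
    and E: "energy_le s l u A" and u: "0 \<le> u"
  shows "energy_le s l (2 powr s * u) B"
proof -
  obtain p where p: "set_pmf p \<subseteq> A" "energy s l (measure_pmf p) \<le> ennreal u"
    using E by (auto simp: energy_le_def)
  obtain h where h: "\<And>x. x \<in> A \<Longrightarrow> h x \<in> B \<and> dist x (h x) \<le> l / 2" using near by metis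
  have k: "inverse (ennreal (max (dist (h x) (h y)) l powr s)) \<le> ennreal (2 powr s) * inverse (ennreal (max (dist x y) l powr s))"
    if xy: "x \<in> A" "y \<in> A" for x y
  proof -
    have "dist x y \<le> dist (h x) (h y) + l"
      using h[OF xy(1)] h[OF xy(2)] dist_triangle[of x y "h x"] dist_triangle[of "h x" y "h y"]
      by (simp add: dist_commute)
    then have "max (dist x y) l \<le> 2 * max (dist (h x) (h y)) l" using l by (simp add: max_def)
    then have "max (dist x y) l powr s \<le> (2 * max (dist (h x) (h y)) l) powr s"
      using s l by (intro powr_mono2) (auto simp: le_max_iff_disj)
    then have a: "max (dist x y) l powr s \<le> 2 powr s * max (dist (h x) (h y)) l powr s"
      using l by (simp add: powr_mult)
    have pos: "0 < max (dist x y) l powr s" "0 < max (dist (h x) (h y)) l powr s" using l by (auto simp: max_def)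
    then have "inverse (max (dist (h x) (h y)) l powr s) \<le> 2 powr s * inverse (max (dist x y) l powr s)"
      using a by (simp add: field_simps)
    then have "ennreal (inverse (max (dist (h x) (h y)) l powr s)) \<le> ennreal (2 powr s * inverse (max (dist x y) l powr s))"
      by (rule ennreal_leI)
    then show ?thesis using pos by (simp add: inverse_ennreal ennreal_mult)
  qed
  have "energy s l (measure_pmf (map_pmf h p)) =
      (\<integral>\<^sup>+ x. \<integral>\<^sup>+ y. inverse (ennreal (max (dist (h x) (h y)) l powr s)) \<partial>p \<partial>p)"
    by (simp add: energy_def)
  also have "\<dots> \<le> (\<integral>\<^sup>+ x. \<integral>\<^sup>+ y. ennreal (2 powr s) * inverse (ennreal (max (dist x y) l powr s)) \<partial>p \<partial>p)"
  proof (intro nn_integral_mono_AE, unfold AE_measure_pmf_iff, intro ballI nn_integral_mono_AE,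
      unfold AE_measure_pmf_iff, intro ballI)
    fix x y assume "x \<in> set_pmf p" "y \<in> set_pmf p"
    then show "inverse (ennreal (max (dist (h x) (h y)) l powr s))
        \<le> ennreal (2 powr s) * inverse (ennreal (max (dist x y) l powr s))"
      using p(1) by (intro k) auto
  qed
  also have "\<dots> = ennreal (2 powr s) * energy s l (measure_pmf p)"
    by (simp add: energy_def nn_integral_cmult)
  also have "\<dots> \<le> ennreal (2 powr s) * ennreal u" using p(2) by (intro mult_left_mono) auto
  also have "\<dots> = ennreal (2 powr s * u)" using u by (simp add: ennreal_mult)
  finally show ?thesis unfolding energy_le_def using h p(1) by (intro exI[of _ "map_pmf h p"]) auto
qed

lemma compact_curve_image: "C \<in> curves \<Lambda> \<Longrightarrow> compact (curve_image C)"
  unfolding curve_image_def by (intro compact_path_image curve_repD)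

lemma curve_image_near:
  assumes C: "C \<in> curves \<Lambda>" and D: "D \<in> curves \<Lambda>" and d: "curve_dist C D < e" and x: "x \<in> curve_image C"
  shows "\<exists>y\<in>curve_image D. dist x y < e"
proof -
  obtain \<alpha> where \<alpha>: "\<alpha> \<in> reparams" "\<forall>t\<in>{0..1}. dist (curve_rep C t) (curve_rep D (\<alpha> t)) < e"
    using curve_dist_lessD[OF C D d] by blast
  obtain t where t: "t \<in> {0..1}" "x = curve_rep C t" using x by (auto simp: curve_image_def path_image_def)
  have "curve_rep D (\<alpha> t) \<in> curve_image D"
    unfolding curve_image_def path_image_def using reparams_in[OF \<alpha>(1) t(1)] by (rule imageI)
  then show ?thesis using \<alpha>(2) t by blast
qed

lemma diameter_curve_image_le:
  fixes C D :: "'a::euclidean_space curve"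
  assumes C: "C \<in> curves \<Lambda>" and D: "D \<in> curves \<Lambda>" and d: "curve_dist C D < e"
  shows "diameter (curve_image C) \<le> diameter (curve_image D) + 2 * e"
proof (rule diameter_le)
  have "curve_rep C 0 \<in> curve_image C" by (simp add: curve_image_def path_image_def)
  then show "curve_image C \<noteq> {} \<or> 0 \<le> diameter (curve_image D) + 2 * e" by blast
  fix x y assume xy: "x \<in> curve_image C" "y \<in> curve_image C"
  obtain x' where x': "x' \<in> curve_image D" "dist x x' < e" using curve_image_near[OF C D d xy(1)] by blast
  obtain y' where y': "y' \<in> curve_image D" "dist y y' < e" using curve_image_near[OF C D d xy(2)] by blast
  have "dist x' y' \<le> diameter (curve_image D)"
    using x' y' compact_imp_bounded[OF compact_curve_image[OF D]] by (intro diameter_bounded_bound)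
  then show "norm (x - y) \<le> diameter (curve_image D) + 2 * e"
    using x' y' dist_triangle[of x y x'] dist_triangle[of x' y y'] by (simp add: dist_commute flip: dist_norm)
qed

section \<open>Passage to the scaling limit\<close>

text \<open>The test function for the weak convergence: it is \<open>1\<close> on configurations that meet \<open>V\<close> and vanishes on
  those without a curve at distance less than \<open>\<eta>\<close> from \<open>V\<close>.\<close>

definition proximity :: "real \<Rightarrow> 'a::metric_space curve set \<Rightarrow> 'a curve set \<Rightarrow> real" where
  "proximity \<eta> V F = Sup (insert 0 ((\<lambda>(C, D). max 0 (1 - curve_dist C D / \<eta>)) ` (F \<times> V)))"

context
  fixes \<Lambda> :: "'a::metric_space set" and V :: "'a curve set" and \<eta> :: real
  assumes V: "V \<subseteq> curves \<Lambda>" and \<eta>: "0 < \<eta>"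
begin

lemma proximity_term_le:
  assumes "F \<in> configs \<Lambda>" "C \<in> F" "D \<in> V"
  shows "max 0 (1 - curve_dist C D / \<eta>) \<le> 1"
proof -
  have "C \<in> curves \<Lambda>" "D \<in> curves \<Lambda>" using assms V by (auto simp: configs_def)
  then have "0 \<le> curve_dist C D / \<eta>" using curve_dist_nonneg[of C \<Lambda> D] \<eta> by simp
  then show ?thesis by simp
qed

lemma proximity_bdd:
  assumes F: "F \<in> configs \<Lambda>"
  shows "bdd_above (insert 0 ((\<lambda>(C, D). max 0 (1 - curve_dist C D / \<eta>)) ` (F \<times> V)))"
  using proximity_term_le[OF F] by (intro bdd_aboveI[of _ 1]) auto

lemma proximity_nonneg: "F \<in> configs \<Lambda> \<Longrightarrow> 0 \<le> proximity \<eta> V F"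
  unfolding proximity_def by (intro cSup_upper proximity_bdd) auto

lemma proximity_le_1: "F \<in> configs \<Lambda> \<Longrightarrow> proximity \<eta> V F \<le> 1"
  unfolding proximity_def using proximity_term_le by (intro cSup_least) auto

lemma proximity_ge:
  assumes "F \<in> configs \<Lambda>" "C \<in> F" "D \<in> V"
  shows "1 - curve_dist C D / \<eta> \<le> proximity \<eta> V F"
proof -
  have "max 0 (1 - curve_dist C D / \<eta>) \<le> proximity \<eta> V F"
    unfolding proximity_def using assms by (intro cSup_upper proximity_bdd) auto
  then show ?thesis by simp
qed

lemma proximity_eq_1:
  assumes F: "F \<in> configs \<Lambda>" and C: "C \<in> F" "C \<in> V"
  shows "1 \<le> proximity \<eta> V F"
proof -
  have "C \<in> curves \<Lambda>" using V C by blast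
  then have "curve_dist C C \<le> 0"
    unfolding curve_dist_def using curve_repD(2) by (intro param_dist_leI[OF _ _ reparams_id]) auto
  then have "curve_dist C C / \<eta> \<le> 0" using \<eta> by (simp add: divide_nonpos_pos)
  then show ?thesis using proximity_ge[OF F C] by linarith
qed

lemma proximity_pos_imp:
  assumes F: "F \<in> configs \<Lambda>" and pos: "0 < proximity \<eta> V F"
  shows "\<exists>C\<in>F. \<exists>D\<in>V. curve_dist C D < \<eta>"
proof (rule ccontr)
  assume no: "\<not> (\<exists>C\<in>F. \<exists>D\<in>V. curve_dist C D < \<eta>)"
  have "proximity \<eta> V F \<le> 0"
    unfolding proximity_def
  proof (rule cSup_least)
    fix z assume "z \<in> insert 0 ((\<lambda>(C, D). max 0 (1 - curve_dist C D / \<eta>)) ` (F \<times> V))"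
    then consider "z = 0" | C D where "C \<in> F" "D \<in> V" "z = max 0 (1 - curve_dist C D / \<eta>)" by auto
    then show "z \<le> 0"
    proof cases
      case 2
      then have "\<eta> \<le> curve_dist C D" using no by (meson not_less)
      then show ?thesis using 2(3) \<eta> by simp
    qed simp
  qed simp
  then show False using pos by simp
qed

text \<open>By the triangle inequality each term of the supremum changes by at most
  \<open>e / \<eta>\<close> when its curve moves by \<open>e\<close>. Closeness in one direction
  gives the inequality in one direction.\<close>

lemma proximity_le_add:
  assumes F: "F \<in> configs \<Lambda>" and G: "G \<in> configs \<Lambda>" and e: "0 < e"
    and near: "\<And>C. C \<in> F \<Longrightarrow> \<exists>C'\<in>G. curve_dist C' C < e"
  shows "proximity \<eta> V F \<le> proximity \<eta> V G + e / \<eta>"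
  unfolding proximity_def[of \<eta> V F]
proof (rule cSup_least)
  fix z assume "z \<in> insert 0 ((\<lambda>(C, D). max 0 (1 - curve_dist C D / \<eta>)) ` (F \<times> V))"
  then consider "z = 0" | C D where "C \<in> F" "D \<in> V" "z = max 0 (1 - curve_dist C D / \<eta>)" by auto
  then show "z \<le> proximity \<eta> V G + e / \<eta>"
  proof cases
    case 1
    then show ?thesis using proximity_nonneg[OF G] e \<eta> by simp
  next
    case 2
    obtain C' where C': "C' \<in> G" "curve_dist C' C < e" using near[OF 2(1)] by blast
    have "curve_dist C' D \<le> curve_dist C' C + curve_dist C D"
      using C' 2 F G V by (intro curve_dist_triangle[of _ \<Lambda>]) (auto simp: configs_def)
    then have "curve_dist C' D \<le> e + curve_dist C D" using C' by simp
    then have "curve_dist C' D / \<eta> \<le> e / \<eta> + curve_dist C D / \<eta>"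
      using \<eta> by (simp add: divide_right_mono flip: add_divide_distrib)
    moreover have "0 \<le> e / \<eta>" using e \<eta> by simp
    ultimately show ?thesis
      using proximity_ge[OF G C'(1) 2(2)] proximity_nonneg[OF G] 2(3) by simp
  qed
qed simp

lemma proximity_lipschitz:
  assumes F: "F \<in> configs \<Lambda>" and G: "G \<in> configs \<Lambda>" and e: "0 < e"
    and d: "hausdorff_edist F G < ennreal e"
  shows "\<bar>proximity \<eta> V F - proximity \<eta> V G\<bar> \<le> e / \<eta>"
proof -
  have 1: "\<exists>D\<in>G. curve_dist C D < e" if "C \<in> F" for C
  proof -
    have "(INF D\<in>G. ennreal (curve_dist C D)) \<le> (SUP C\<in>F. INF D\<in>G. ennreal (curve_dist C D))"
      using that by (rule SUP_upper)
    also have "\<dots> < ennreal e" using d by (simp add: hausdorff_edist_def)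
    finally show ?thesis unfolding INF_less_iff by (meson ennreal_leI leI not_less)
  qed
  have 2: "\<exists>C\<in>F. curve_dist C D < e" if "D \<in> G" for D
  proof -
    have "(INF C\<in>F. ennreal (curve_dist C D)) \<le> (SUP D\<in>G. INF C\<in>F. ennreal (curve_dist C D))"
      using that by (rule SUP_upper)
    also have "\<dots> < ennreal e" using d by (simp add: hausdorff_edist_def)
    finally show ?thesis unfolding INF_less_iff by (meson ennreal_leI leI not_less)
  qed
  have "\<exists>D\<in>G. curve_dist D C < e" if C: "C \<in> F" for C
  proof -
    obtain D where D: "D \<in> G" "curve_dist C D < e" using 1[OF C] by blast
    have "C \<in> curves \<Lambda>" "D \<in> curves \<Lambda>" using C D F G by (auto simp: configs_def)
    then show ?thesis using D curve_dist_commute[of C \<Lambda> D] by force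
  qed
  then have "proximity \<eta> V F \<le> proximity \<eta> V G + e / \<eta>" by (rule proximity_le_add[OF F G e])
  moreover have "proximity \<eta> V G \<le> proximity \<eta> V F + e / \<eta>" using 2 by (rule proximity_le_add[OF G F e])
  ultimately show ?thesis by linarith
qed

lemma openin_proximity_vimage:
  assumes "open S"
  shows "openin (config_topology \<Lambda>) {F \<in> configs \<Lambda>. proximity \<eta> V F \<in> S}"
  unfolding openin_config_topology
proof (intro conjI ballI)
  fix F assume F: "F \<in> {F \<in> configs \<Lambda>. proximity \<eta> V F \<in> S}"
  then obtain e where e: "0 < e" "\<And>y. dist y (proximity \<eta> V F) < e \<Longrightarrow> y \<in> S"
    using assms by (auto simp: open_dist)
  have "G \<in> {F \<in> configs \<Lambda>. proximity \<eta> V F \<in> S}"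
    if G: "G \<in> configs \<Lambda>" "hausdorff_edist F G < ennreal (\<eta> * e / 2)" for G
  proof -
    have "\<bar>proximity \<eta> V F - proximity \<eta> V G\<bar> \<le> \<eta> * e / 2 / \<eta>"
      using F G \<eta> e by (intro proximity_lipschitz) auto
    also have "\<dots> < e" using \<eta> e by simp
    finally show ?thesis using G e(2)[of "proximity \<eta> V G"] by (auto simp: dist_real_def abs_minus_commute)
  qed
  then show "\<exists>d>0. \<forall>G\<in>configs \<Lambda>. hausdorff_edist F G < d \<longrightarrow> G \<in> {F \<in> configs \<Lambda>. proximity \<eta> V F \<in> S}"
    using \<eta> e by (intro exI[of _ "ennreal (\<eta> * e / 2)"]) auto
qed auto

lemma continuous_map_proximity: "continuous_map (config_topology \<Lambda>) euclideanreal (proximity \<eta> V)"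
  unfolding continuous_map_def using openin_proximity_vimage by auto

end

section \<open>Weak convergence against the proximity function\<close>

lemma space_config_borel: "space (config_borel \<Lambda>) = configs \<Lambda>"
  unfolding config_borel_def using openin_subset[of "config_topology \<Lambda>"]
  by (intro space_measure_of) auto

lemma borel_measurable_proximity:
  assumes "V \<subseteq> curves \<Lambda>" "0 < \<eta>" and M: "sets M = sets (config_borel \<Lambda>)"
  shows "proximity \<eta> V \<in> borel_measurable M"
proof (rule borel_measurableI)
  fix S :: "real set" assume "open S"
  have sp: "space M = configs \<Lambda>" using sets_eq_imp_space_eq[OF M] space_config_borel by simp
  have "{F \<in> configs \<Lambda>. proximity \<eta> V F \<in> S} \<in> sets (config_borel \<Lambda>)"
    unfolding config_borel_def using openin_proximity_vimage[OF assms(1,2) \<open>open S\<close>]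
      openin_subset[of "config_topology \<Lambda>"]
    by (subst sets_measure_of) auto
  moreover have "proximity \<eta> V -` S \<inter> space M = {F \<in> configs \<Lambda>. proximity \<eta> V F \<in> S}" using sp by auto
  ultimately show "proximity \<eta> V -` S \<inter> space M \<in> sets M" using M by simp
qed

lemma random_curve_systemD:
  assumes "random_curve_system \<Lambda> \<mu>" "0 < \<delta>" "\<delta> \<le> 1"
  shows "prob_space (\<mu> \<delta>)" "sets (\<mu> \<delta>) = sets (config_borel \<Lambda>)" "space (\<mu> \<delta>) = configs \<Lambda>"
proof -
  show "prob_space (\<mu> \<delta>)" and s: "sets (\<mu> \<delta>) = sets (config_borel \<Lambda>)"
    using assms by (auto simp: random_curve_system_def)
  show "space (\<mu> \<delta>) = configs \<Lambda>" using sets_eq_imp_space_eq[OF s] space_config_borel by simp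
qed

text \<open>The test function lies between the indicators of the events that it is at least 1 and
  that it is positive. The first contains all configurations meeting \<open>V\<close>, and is
  measurable whether or not meeting \<open>V\<close> is; the second is contained in the event
  bounded by assumption.\<close>

lemma scaling_limit_proximity_le:
  assumes rcs: "random_curve_system \<Lambda> \<mu>" and lim: "scaling_limit \<Lambda> \<mu> \<nu>"
    and V: "V \<subseteq> curves \<Lambda>" and \<eta>: "0 < \<eta>" and \<delta>1: "0 < \<delta>1"
    and small: "\<And>\<delta>. 0 < \<delta> \<Longrightarrow> \<delta> \<le> 1 \<Longrightarrow> \<delta> \<le> \<delta>1 \<Longrightarrow>
      Prob (\<mu> \<delta>) {F \<in> space (\<mu> \<delta>). \<exists>C\<in>F. \<exists>D\<in>V. curve_dist C D < \<eta>} \<le> \<epsilon>"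
  shows "measure \<nu> {F \<in> space \<nu>. 1 \<le> proximity \<eta> V F} \<le> \<epsilon>"
proof -
  let ?h = "proximity \<eta> V"
  have \<nu>: "prob_space \<nu>" "sets \<nu> = sets (config_borel \<Lambda>)" using lim by (auto simp: scaling_limit_def)
  have sp\<nu>: "space \<nu> = configs \<Lambda>" using sets_eq_imp_space_eq[OF \<nu>(2)] space_config_borel by simp
  interpret \<nu>: prob_space \<nu> by fact
  obtain \<delta> where \<delta>: "\<And>n. \<delta> n \<in> {0<..1}" "\<delta> \<longlonglongrightarrow> 0"
    and conv: "\<forall>h B. continuous_map (config_topology \<Lambda>) euclideanreal h \<longrightarrow>
              (\<forall>F\<in>configs \<Lambda>. \<bar>h F\<bar> \<le> B) \<longrightarrow> (\<lambda>n. LINT F|\<mu> (\<delta> n). h F) \<longlonglongrightarrow> (LINT F|\<nu>. h F)"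
    using lim unfolding scaling_limit_def by blast
  have h01: "0 \<le> ?h F" "?h F \<le> 1" if "F \<in> configs \<Lambda>" for F
    using proximity_nonneg[OF V \<eta> that] proximity_le_1[OF V \<eta> that] .
  have "(\<lambda>n. LINT F|\<mu> (\<delta> n). ?h F) \<longlonglongrightarrow> (LINT F|\<nu>. ?h F)"
    using conv[rule_format, OF continuous_map_proximity[OF V \<eta>], of 1] h01 by simp
  moreover have "\<forall>\<^sub>F n in sequentially. (LINT F|\<mu> (\<delta> n). ?h F) \<le> \<epsilon>"
  proof -
    have "\<forall>\<^sub>F n in sequentially. \<delta> n < \<delta>1" using \<delta>(2) \<delta>1 by (rule order_tendstoD)
    then show ?thesis
    proof eventually_elim
      case (elim n)
      have d: "0 < \<delta> n" "\<delta> n \<le> 1" using \<delta>(1)[of n] by auto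
      note M = random_curve_systemD[OF rcs d]
      interpret M: prob_space "\<mu> (\<delta> n)" by (rule M)
      note hm[measurable] = borel_measurable_proximity[OF V \<eta> M(2)]
      let ?P = "{F \<in> space (\<mu> (\<delta> n)). 0 < ?h F}"
      have int: "integrable (\<mu> (\<delta> n)) ?h"
        using h01 M(3) by (intro M.integrable_const_bound[of _ 1]) auto
      have "(LINT F|\<mu> (\<delta> n). ?h F) \<le> (LINT F|\<mu> (\<delta> n). indicator ?P F)"
      proof (rule integral_mono[OF int])
        fix F assume F: "F \<in> space (\<mu> (\<delta> n))"
        then have "0 \<le> ?h F" "?h F \<le> 1" using h01 M(3) by auto
        then show "?h F \<le> indicator ?P F" using F by (auto simp: indicator_def)
      qed (simp add: M.emeasure_eq_measure)
      also have "\<dots> = measure (\<mu> (\<delta> n)) ?P" by simp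
      also have "\<dots> = Prob (\<mu> (\<delta> n)) ?P" by (intro Prob_eq_measure[symmetric]) measurable
      also have "\<dots> \<le> Prob (\<mu> (\<delta> n)) {F \<in> space (\<mu> (\<delta> n)). \<exists>C\<in>F. \<exists>D\<in>V. curve_dist C D < \<eta>}"
        using proximity_pos_imp[OF V \<eta>] M(3) by (intro Prob_mono M(1)) auto
      also have "\<dots> \<le> \<epsilon>" using small[OF d] elim by simp
      finally show ?case .
    qed
  qed
  ultimately have le: "(LINT F|\<nu>. ?h F) \<le> \<epsilon>"
    by (rule tendsto_upperbound) simp
  note hm[measurable] = borel_measurable_proximity[OF V \<eta> \<nu>(2)]
  let ?Q = "{F \<in> space \<nu>. 1 \<le> ?h F}"
  have int: "integrable \<nu> ?h" using h01 sp\<nu> by (intro \<nu>.integrable_const_bound[of _ 1]) auto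
  have "measure \<nu> ?Q = (LINT F|\<nu>. indicator ?Q F)" by simp
  also have "\<dots> \<le> (LINT F|\<nu>. ?h F)"
  proof (rule integral_mono[OF _ int])
    fix F assume F: "F \<in> space \<nu>"
    then show "indicator ?Q F \<le> ?h F" using h01[of F] sp\<nu> by (auto simp: indicator_def)
  qed (simp add: \<nu>.emeasure_eq_measure)
  finally show ?thesis using le by simp
qed

text \<open>A curve that violates the energy bound at the fixed cutoff \<open>l n\<close> forces all
  curves close to it to violate the bound, with a constant smaller by \<open>2 powr s\<close>, at
  every cutoff up to \<open>l n\<close>. This has small probability uniformly in \<delta>, hence
  also in the limit.\<close>

lemma scaling_limit_energy_le:
  fixes \<Lambda> :: "'a::euclidean_space set"
  assumes rcs: "random_curve_system \<Lambda> \<mu>" and lim: "scaling_limit \<Lambda> \<mu> \<nu>"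
    and r: "0 < r" and s: "0 < s"
    and small: "\<And>\<epsilon>. 0 < \<epsilon> \<Longrightarrow> \<exists>u>0. \<forall>\<delta>. 0 < \<delta> \<longrightarrow> \<delta> \<le> 1 \<longrightarrow> Prob (\<mu> \<delta>)
      {F \<in> space (\<mu> \<delta>). \<exists>C\<in>F. r / 2 \<le> diameter (curve_image C) \<and> \<not> energy_le s \<delta> u (curve_image C)} \<le> \<epsilon>"
  shows "AE F in \<nu>. \<forall>C\<in>F. r \<le> diameter (curve_image C) \<longrightarrow>
    (\<exists>u>0. \<forall>l\<^sub>0>0. \<exists>l. 0 < l \<and> l \<le> l\<^sub>0 \<and> energy_le s l u (curve_image C))"
proof -
  have \<nu>: "prob_space \<nu>" "sets \<nu> = sets (config_borel \<Lambda>)" using lim by (auto simp: scaling_limit_def)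
  have sp\<nu>: "space \<nu> = configs \<Lambda>" using sets_eq_imp_space_eq[OF \<nu>(2)] space_config_borel by simp
  interpret \<nu>: prob_space \<nu> by fact
  define l where "l n = 1 / real (Suc n)" for n
  \<comment> \<open>\<open>l n / 2\<close> is the displacement that the energy tolerates. With
    \<open>r / 4\<close>, diameters change by at most \<open>r / 2\<close>.\<close>
  define \<eta> where "\<eta> n = min (l n / 2) (r / 4)" for n
  have l: "0 < l n" "0 < \<eta> n" for n using r by (auto simp: l_def \<eta>_def)
  define V where "V u n = {D \<in> curves \<Lambda>. r \<le> diameter (curve_image D) \<and>
      \<not> energy_le s (l n) (2 powr s * u) (curve_image D)}" for u n
  have Vsub: "V u n \<subseteq> curves \<Lambda>" for u n by (auto simp: V_def)
  \<comment> \<open>One constant \<open>u\<close> serves every cutoff \<open>l n\<close>, thanks to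
    the uniformity in \<delta>.\<close>
  have ex: "\<exists>u>0. \<forall>n. measure \<nu> {F \<in> space \<nu>. 1 \<le> proximity (\<eta> n) (V u n) F} \<le> 1 / real (Suc i)" for i
  proof -
    obtain u where u: "0 < u" and P: "\<And>\<delta>. 0 < \<delta> \<Longrightarrow> \<delta> \<le> 1 \<Longrightarrow> Prob (\<mu> \<delta>)
      {F \<in> space (\<mu> \<delta>). \<exists>C\<in>F. r / 2 \<le> diameter (curve_image C) \<and> \<not> energy_le s \<delta> u (curve_image C)} \<le> 1 / real (Suc i)"
      using small[of "1 / real (Suc i)"] by auto
    have "measure \<nu> {F \<in> space \<nu>. 1 \<le> proximity (\<eta> n) (V u n) F} \<le> 1 / real (Suc i)" for n
    proof (rule scaling_limit_proximity_le[OF rcs lim Vsub l(2) l(1)])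
      fix \<delta> :: real assume \<delta>: "0 < \<delta>" "\<delta> \<le> 1" "\<delta> \<le> l n"
      note M = random_curve_systemD[OF rcs \<delta>(1,2)]
      have bad: "r / 2 \<le> diameter (curve_image C) \<and> \<not> energy_le s \<delta> u (curve_image C)"
        if C: "C \<in> curves \<Lambda>" and D: "D \<in> V u n" and d: "curve_dist C D < \<eta> n" for C D
      proof
        have Dc: "D \<in> curves \<Lambda>" and Dr: "r \<le> diameter (curve_image D)"
          and De: "\<not> energy_le s (l n) (2 powr s * u) (curve_image D)" using D by (auto simp: V_def)
        have "curve_dist D C < \<eta> n" using d curve_dist_commute[OF C Dc] by simp
        then show "r / 2 \<le> diameter (curve_image C)"
          using diameter_curve_image_le[OF Dc C] Dr by (fastforce simp: \<eta>_def)
        show "\<not> energy_le s \<delta> u (curve_image C)"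
        proof
          assume "energy_le s \<delta> u (curve_image C)"
          then have "energy_le s (l n) u (curve_image C)"
            using energy_le_mono_cutoff[of s \<delta> "l n"] s \<delta> by auto
          moreover have "\<exists>y\<in>curve_image D. dist x y \<le> l n / 2" if "x \<in> curve_image C" for x
            using curve_image_near[OF C Dc d that] by (force simp: \<eta>_def)
          ultimately have "energy_le s (l n) (2 powr s * u) (curve_image D)"
            using energy_le_perturb[OF l(1), of s] s u by (meson less_imp_le)
          then show False using De by simp
        qed
      qed
      have "Prob (\<mu> \<delta>) {F \<in> space (\<mu> \<delta>). \<exists>C\<in>F. \<exists>D\<in>V u n. curve_dist C D < \<eta> n} \<le>
        Prob (\<mu> \<delta>) {F \<in> space (\<mu> \<delta>). \<exists>C\<in>F. r / 2 \<le> diameter (curve_image C) \<and> \<not> energy_le s \<delta> u (curve_image C)}"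
      proof (rule Prob_mono[OF M(1)], clarify)
        fix F C D assume F: "F \<in> space (\<mu> \<delta>)" "C \<in> F" and D: "D \<in> V u n" "curve_dist C D < \<eta> n"
        have "C \<in> curves \<Lambda>" using F M(3) by (auto simp: configs_def)
        then show "\<exists>C\<in>F. r / 2 \<le> diameter (curve_image C) \<and> \<not> energy_le s \<delta> u (curve_image C)"
          using bad D F(2) by blast
      qed auto
      also have "\<dots> \<le> 1 / real (Suc i)" using P[OF \<delta>(1,2)] .
      finally show "Prob (\<mu> \<delta>) {F \<in> space (\<mu> \<delta>). \<exists>C\<in>F. \<exists>D\<in>V u n. curve_dist C D < \<eta> n} \<le> 1 / real (Suc i)" .
    qed
    then show ?thesis by (intro exI[of _ u] conjI u allI)
  qed
  have "\<forall>i. \<exists>u>0. \<forall>n. measure \<nu> {F \<in> space \<nu>. 1 \<le> proximity (\<eta> n) (V u n) F} \<le> 1 / real (Suc i)"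
    by (rule allI, rule ex)
  from choice[OF this] obtain u where
    uH: "\<forall>i. 0 < u i \<and> (\<forall>n. measure \<nu> {F \<in> space \<nu>. 1 \<le> proximity (\<eta> n) (V (u i) n) F} \<le> 1 / real (Suc i))"
    by (elim exE) (rule that)
  note u = conjunct1[OF spec[OF uH]] and Hle = spec[OF conjunct2[OF spec[OF uH]]]
  define H where "H i n = {F \<in> space \<nu>. 1 \<le> proximity (\<eta> n) (V (u i) n) F}" for i n
  have Hm: "H i n \<in> sets \<nu>" for i n
  proof -
    note [measurable] = borel_measurable_proximity[OF Vsub[of "u i" n] l(2)[of n] \<nu>(2)]
    show ?thesis unfolding H_def by measurable
  qed
  \<comment> \<open>A curve without an energy bound violates the bound \<open>2 powr s * u i\<close>
    at all sufficiently small cutoffs, so for every \<open>i\<close> its configuration lies in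
    \<open>G i N\<close> for some \<open>N\<close>. The increasing union over \<open>N\<close> still
    has measure at most \<open>1 / real (Suc i)\<close>, and the intersection over \<open>i\<close>
    is a null set.\<close>
  define G where "G i N = (\<Inter>n\<in>{N..}. H i n)" for i N
  have Gm: "G i N \<in> sets \<nu>" for i N
    unfolding G_def using Hm by (intro sets.countable_INT') auto
  have GU: "emeasure \<nu> (\<Union>N. G i N) \<le> ennreal (1 / real (Suc i))" for i
  proof -
    have "incseq (G i)" unfolding G_def by (intro monoI INF_superset_mono) auto
    then have "emeasure \<nu> (\<Union>N. G i N) = (SUP N. emeasure \<nu> (G i N))"
      using Gm by (intro SUP_emeasure_incseq[symmetric]) auto
    also have "\<dots> \<le> ennreal (1 / real (Suc i))"
    proof (rule SUP_least)
      fix N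
      have "emeasure \<nu> (G i N) \<le> emeasure \<nu> (H i N)"
        using Hm by (intro emeasure_mono) (auto simp: G_def)
      also have "\<dots> \<le> ennreal (1 / real (Suc i))"
        using Hle[of N i] by (simp add: \<nu>.emeasure_eq_measure H_def)
      finally show "emeasure \<nu> (G i N) \<le> ennreal (1 / real (Suc i))" .
    qed
    finally show ?thesis .
  qed
  define Z where "Z = (\<Inter>i. \<Union>N. G i N)"
  have Zm: "Z \<in> sets \<nu>" unfolding Z_def using Gm by auto
  have "measure \<nu> Z \<le> 0"
  proof (rule LIMSEQ_le_const)
    show "(\<lambda>i. 1 / real (Suc i)) \<longlonglongrightarrow> 0" by (rule LIMSEQ_Suc[OF lim_1_over_n])
    have "measure \<nu> Z \<le> 1 / real (Suc i)" for i
    proof -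
      have "emeasure \<nu> Z \<le> emeasure \<nu> (\<Union>N. G i N)"
        using Gm by (intro emeasure_mono) (auto simp: Z_def)
      also note GU
      finally show ?thesis by (simp add: \<nu>.emeasure_eq_measure)
    qed
    then show "\<exists>N. \<forall>n\<ge>N. measure \<nu> Z \<le> 1 / real (Suc n)" by blast
  qed
  then have Z0: "emeasure \<nu> Z = 0" using measure_nonneg[of \<nu> Z] by (simp add: \<nu>.emeasure_eq_measure)
  show ?thesis
  proof (rule AE_I[OF _ Z0 Zm], rule subsetI)
    fix F assume "F \<in> {F \<in> space \<nu>. \<not> (\<forall>C\<in>F. r \<le> diameter (curve_image C) \<longrightarrow>
      (\<exists>u>0. \<forall>l\<^sub>0>0. \<exists>l. 0 < l \<and> l \<le> l\<^sub>0 \<and> energy_le s l u (curve_image C)))}"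
    then obtain C where F: "F \<in> space \<nu>" "C \<in> F" and d: "r \<le> diameter (curve_image C)"
      and no: "\<not> (\<exists>u>0. \<forall>l\<^sub>0>0. \<exists>l. 0 < l \<and> l \<le> l\<^sub>0 \<and> energy_le s l u (curve_image C))"
      by blast
    have Fc: "F \<in> configs \<Lambda>" using F sp\<nu> by simp
    then have C: "C \<in> curves \<Lambda>" using F by (auto simp: configs_def)
    show "F \<in> Z"
      unfolding Z_def
    proof (rule INT_I)
      fix i
      define v where "v = 2 powr s * u i"
      have "0 < v" using u by (simp add: v_def)
      then have "\<not> (\<forall>l\<^sub>0>0. \<exists>l. 0 < l \<and> l \<le> l\<^sub>0 \<and> energy_le s l v (curve_image C))"
        using no by blast
      then obtain l\<^sub>0 where "0 < l\<^sub>0" "\<not> (\<exists>l. 0 < l \<and> l \<le> l\<^sub>0 \<and> energy_le s l v (curve_image C))"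
        by blast
      then have l0: "0 < l\<^sub>0" "\<And>l. 0 < l \<Longrightarrow> l \<le> l\<^sub>0 \<Longrightarrow> \<not> energy_le s l (2 powr s * u i) (curve_image C)"
        unfolding v_def by blast+
      obtain N where N: "1 / real (Suc N) < l\<^sub>0" using reals_Archimedean[OF l0(1)] by (auto simp: inverse_eq_divide)
      have "F \<in> H i n" if n: "N \<le> n" for n
      proof -
        have "l n \<le> 1 / real (Suc N)" unfolding l_def using n by (intro divide_left_mono) auto
        then have "C \<in> V (u i) n" using C d l0(2)[OF l(1)[of n]] N by (simp add: V_def)
        then show ?thesis
          using proximity_eq_1[OF Vsub l(2) Fc F(2)] F(1) by (simp add: H_def)
      qed
      then show "F \<in> (\<Union>N. G i N)" by (auto simp: G_def)
    qed
  qed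
qed

text \<open>For \<open>\<rho> \<ge> 0\<close> the bound only gets larger. For negative
  \<open>\<rho>\<close>, outer probabilities being nonnegative, the cases \<open>k = 1\<close> and
  \<open>k = 2\<close> force \<open>K = 0\<close>; both are available as initial parts of the given
  collection.\<close>

lemma traversal_bound_normalised:
  fixes \<sigma> \<rho> K :: real
  assumes \<rho>: "\<rho> < 1"
    and H: "\<And>k a u l. 1 \<le> k \<Longrightarrow> (\<And>j. j < k \<Longrightarrow> norm (u j) = 1 \<and> \<delta> \<le> l j) \<Longrightarrow>
           well_separated k (\<lambda>j. cylinder (a j) (u j) (l j) (l j / \<sigma>)) \<Longrightarrow>
           Prob M {F \<in> space M. \<forall>j<k. \<exists>C\<in>F. traverses C (a j) (u j) (l j) (l j / \<sigma>)} \<le> K * \<rho> ^ k"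
  shows "traversal_bound \<sigma> \<bar>K\<bar> (max \<rho> (1/2)) \<delta> M"
  unfolding traversal_bound_def
proof (intro allI impI)
  fix n and a u :: "nat \<Rightarrow> 'a" and l
  assume n: "2 \<le> n" and ul: "\<forall>j<n. norm (u j) = 1 \<and> \<delta> \<le> l j"
    and ws: "well_separated n (\<lambda>j. cylinder (a j) (u j) (l j) (l j / \<sigma>))"
  let ?P = "\<lambda>k. Prob M {F \<in> space M. \<forall>j<k. \<exists>C\<in>F. traverses C (a j) (u j) (l j) (l j / \<sigma>)}"
  have P: "?P k \<le> K * \<rho> ^ k" if "1 \<le> k" "k \<le> n" for k
  proof (rule H[where a=a and u=u and l=l, OF that(1)])
    show "norm (u j) = 1 \<and> \<delta> \<le> l j" if "j < k" for j using ul \<open>k \<le> n\<close> that by simp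
    show "well_separated k (\<lambda>j. cylinder (a j) (u j) (l j) (l j / \<sigma>))"
      unfolding well_separated_def
    proof (intro allI impI)
      fix j i assume "j < k" "i < k" "i \<noteq> j"
      with \<open>k \<le> n\<close> have "j < n" "i < n" by simp_all
      then show "diameter (cylinder (a j) (u j) (l j) (l j / \<sigma>))
          \<le> setdist (cylinder (a j) (u j) (l j) (l j / \<sigma>)) (cylinder (a i) (u i) (l i) (l i / \<sigma>))"
        using ws[unfolded well_separated_def, rule_format, OF _ _ \<open>i \<noteq> j\<close>] by simp
    qed
  qed
  have P0: "0 \<le> ?P k" for k unfolding Prob_def by (rule enn2real_nonneg)
  show "?P n \<le> \<bar>K\<bar> * max \<rho> (1/2) ^ n"
  proof (cases "0 \<le> \<rho>")
    case True
    have "?P n \<le> K * \<rho> ^ n" by (rule P) (use n in auto)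
    also have "\<dots> \<le> \<bar>K\<bar> * max \<rho> (1/2) ^ n" using True by (intro mult_mono power_mono) auto
    finally show ?thesis .
  next
    case False
    have "0 \<le> K * \<rho> ^ 1" by (rule order_trans[OF P0 P]) (use n in auto)
    then have "K \<le> 0" using False by (simp add: zero_le_mult_iff)
    moreover have "0 \<le> K * \<rho> ^ 2" by (rule order_trans[OF P0 P]) (use n in auto)
    then have "0 \<le> K" using False by (simp add: zero_le_mult_iff)
    ultimately have "K = 0" by simp
    have "?P n \<le> K * \<rho> ^ n" by (rule P) (use n in auto)
    also have "\<dots> = \<bar>K\<bar> * max \<rho> (1/2) ^ n" using \<open>K = 0\<close> by simp
    finally show ?thesis .
  qed
qed

theorem theorem1p3:
  fixes \<Lambda> :: "'a::euclidean_space set"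
    and \<mu> :: "real \<Rightarrow> 'a curve set measure"
    and \<sigma> \<rho> K :: real
  assumes "compact \<Lambda>"
    and "random_curve_system \<Lambda> \<mu>"
    and "\<sigma> > 0" and "\<rho> < 1"
    and "\<And>\<delta> k a u l. 0 < \<delta> \<Longrightarrow> \<delta> \<le> 1 \<Longrightarrow> 1 \<le> k \<Longrightarrow>
           (\<And>j. j < k \<Longrightarrow> norm (u j) = 1 \<and> \<delta> \<le> l j) \<Longrightarrow>
           well_separated k (\<lambda>j. cylinder (a j) (u j) (l j) (l j / \<sigma>)) \<Longrightarrow>
           Prob (\<mu> \<delta>) {F \<in> space (\<mu> \<delta>). \<forall>j<k. \<exists>C\<in>F. traverses C (a j) (u j) (l j) (l j / \<sigma>)}
             \<le> K * \<rho> ^ k"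
  shows "\<exists>dmin > 1.
           (\<forall>r>0. \<forall>s. 0 < s \<and> s < dmin \<longrightarrow>
              stoch_bounded_away_from_zero \<mu> (min_capacity s r)) \<and>
           (\<forall>\<nu>. scaling_limit \<Lambda> \<mu> \<nu> \<longrightarrow>
              (AE F in \<nu>. \<forall>C\<in>F. 0 < diameter (curve_image C) \<longrightarrow>
                 ennreal dmin \<le> hausdorff_dim (curve_image C)) \<and>
              (AE F in \<nu>. \<forall>C\<in>F. 0 < diameter (curve_image C) \<longrightarrow> \<not> rectifiable_curve C))"
proof -
  note rcs = assms(2)
  \<comment> \<open>A positive ratio is required, because its logarithm enters the choice of the
    scale ratio.\<close>
  have \<rho>': "0 < max \<rho> (1/2)" "max \<rho> (1/2) < 1" using assms(4) by auto
  have tb: "traversal_bound \<sigma> \<bar>K\<bar> (max \<rho> (1/2)) \<delta> (\<mu> \<delta>)" if "0 < \<delta>" "\<delta> \<le> 1" for \<delta>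
    by (rule traversal_bound_normalised[OF assms(4)]) (rule assms(5)[OF that])
  obtain dmin where dmin: "1 < dmin" and whp: "\<forall>r>0. \<forall>s. 0 < s \<longrightarrow> s < dmin \<longrightarrow> (\<forall>\<epsilon>>0. \<exists>u>0. \<forall>\<delta> M. 0 < \<delta> \<longrightarrow>
    prob_space M \<longrightarrow> space M = configs \<Lambda> \<longrightarrow> traversal_bound \<sigma> \<bar>K\<bar> (max \<rho> (1/2)) \<delta> M \<longrightarrow>
    Prob M {F \<in> space M. \<exists>C\<in>F. r \<le> diameter (curve_image C) \<and> \<not> energy_le s \<delta> u (curve_image C)} \<le> \<epsilon>)"
    using Prob_high_energy_small[OF compact_imp_bounded[OF assms(1)] assms(3) \<rho>' abs_ge_zero, of K]
    by (elim exE conjE) (rule that)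
  have energy: "\<exists>u>0. \<forall>\<delta>. 0 < \<delta> \<longrightarrow> \<delta> \<le> 1 \<longrightarrow> Prob (\<mu> \<delta>)
      {F \<in> space (\<mu> \<delta>). \<exists>C\<in>F. r \<le> diameter (curve_image C) \<and> \<not> energy_le s \<delta> u (curve_image C)} \<le> \<epsilon>"
    if r: "0 < r" and s: "0 < s" "s < dmin" and \<epsilon>: "0 < \<epsilon>" for r s \<epsilon>
  proof -
    obtain u where u: "0 < u" and P: "\<forall>\<delta> M. 0 < \<delta> \<longrightarrow>
      prob_space M \<longrightarrow> space M = configs \<Lambda> \<longrightarrow> traversal_bound \<sigma> \<bar>K\<bar> (max \<rho> (1/2)) \<delta> M \<longrightarrow>
      Prob M {F \<in> space M. \<exists>C\<in>F. r \<le> diameter (curve_image C) \<and> \<not> energy_le s \<delta> u (curve_image C)} \<le> \<epsilon>"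
      using whp[rule_format, OF r s \<epsilon>] by (elim exE conjE) (rule that)
    show ?thesis
      by (rule exI[of _ u], intro conjI u allI impI, rule P[rule_format, OF _ _ _ tb])
        (use random_curve_systemD[OF rcs] in auto)
  qed
  have cap: "stoch_bounded_away_from_zero \<mu> (min_capacity s r)"
    if r: "0 < r" and s: "0 < s \<and> s < dmin" for r s
    unfolding stoch_bounded_away_from_zero_def stoch_bounded_def
  proof (intro allI impI)
    fix \<epsilon> :: real assume \<epsilon>: "0 < \<epsilon>"
    obtain u where u: "0 < u" and P: "\<forall>\<delta>. 0 < \<delta> \<longrightarrow> \<delta> \<le> 1 \<longrightarrow> Prob (\<mu> \<delta>)
      {F \<in> space (\<mu> \<delta>). \<exists>C\<in>F. r \<le> diameter (curve_image C) \<and> \<not> energy_le s \<delta> u (curve_image C)} \<le> \<epsilon>"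
      using energy[OF r conjunct1[OF s] conjunct2[OF s] \<epsilon>] by blast
    show "\<exists>v<\<infinity>. \<forall>\<delta>\<in>{0<..1}. Prob (\<mu> \<delta>) {F \<in> space (\<mu> \<delta>). v \<le> inverse (min_capacity s r \<delta> F)} \<le> \<epsilon>"
    \<comment> \<open>The event is a weak inequality, so its threshold must lie strictly above the
      bound \<open>u\<close>.\<close>
    proof (rule exI[of _ "ennreal (u + 1)"], intro conjI ballI)
      fix \<delta> :: real assume "\<delta> \<in> {0<..1}"
      then have \<delta>: "0 < \<delta>" "\<delta> \<le> 1" by auto
      have "\<exists>C\<in>F. r \<le> diameter (curve_image C) \<and> \<not> energy_le s \<delta> u (curve_image C)"
        if F: "ennreal (u + 1) \<le> inverse (min_capacity s r \<delta> F)" for F :: "'a curve set"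
      proof (rule ccontr)
        assume no: "\<not> (\<exists>C\<in>F. r \<le> diameter (curve_image C) \<and> \<not> energy_le s \<delta> u (curve_image C))"
        have "inverse (ennreal u) \<le> min_capacity s r \<delta> F"
          unfolding min_capacity_def
        proof (rule INF_greatest, rule Cap_ge_of_energy_le)
          fix C assume "C \<in> {C \<in> F. r \<le> diameter (curve_image C)}"
          then show "energy_le s \<delta> u (curve_image C)" using no by blast
        qed
        then have "inverse (min_capacity s r \<delta> F) \<le> inverse (inverse (ennreal u))"
          by (rule ennreal_inverse_antimono)
        also have "\<dots> = ennreal u" using u by (simp add: inverse_ennreal)
        finally have "ennreal (u + 1) \<le> ennreal u" using F by (rule order_trans[rotated])
        then show False using u by simp
      qed
      then have "Prob (\<mu> \<delta>) {F \<in> space (\<mu> \<delta>). ennreal (u + 1) \<le> inverse (min_capacity s r \<delta> F)}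
        \<le> Prob (\<mu> \<delta>) {F \<in> space (\<mu> \<delta>). \<exists>C\<in>F. r \<le> diameter (curve_image C) \<and> \<not> energy_le s \<delta> u (curve_image C)}"
        by (intro Prob_mono random_curve_systemD(1)[OF rcs \<delta>]) blast+
      also have "\<dots> \<le> \<epsilon>" using P \<delta> by blast
      finally show "Prob (\<mu> \<delta>) {F \<in> space (\<mu> \<delta>). ennreal (u + 1) \<le> inverse (min_capacity s r \<delta> F)} \<le> \<epsilon>" .
    qed simp
  qed
  have dim: "AE F in \<nu>. \<forall>C\<in>F. 0 < diameter (curve_image C) \<longrightarrow> ennreal dmin \<le> hausdorff_dim (curve_image C)"
    if lim: "scaling_limit \<Lambda> \<mu> \<nu>" for \<nu>
  proof -
    \<comment> \<open>Countably many radii and exponents suffice, so that the exceptional null sets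
      can be united: some \<open>r i\<close> lies below any given positive diameter, and the
      \<open>s j\<close> increase to \<open>dmin\<close>.\<close>
    define r where "r i = 1 / real (Suc i)" for i
    define s where "s j = dmin * (1 - 1 / real (Suc (Suc j)))" for j
    have r: "0 < r i" for i by (simp add: r_def)
    have s: "0 < s j" "s j < dmin" for j
    proof -
      have x: "0 < 1 / real (Suc (Suc j))" "1 / real (Suc (Suc j)) < 1" by simp_all
      show "0 < s j" unfolding s_def using dmin x by (intro mult_pos_pos) linarith+
      have "s j < dmin * 1" unfolding s_def using dmin x by (intro mult_strict_left_mono) linarith+
      then show "s j < dmin" by simp
    qed
    have "AE F in \<nu>. \<forall>i j. \<forall>C\<in>F. r i \<le> diameter (curve_image C) \<longrightarrow>
      (\<exists>u>0. \<forall>l\<^sub>0>0. \<exists>l. 0 < l \<and> l \<le> l\<^sub>0 \<and> energy_le (s j) l u (curve_image C))"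
      unfolding AE_all_countable
    proof (intro allI)
      fix i j
      show "AE F in \<nu>. \<forall>C\<in>F. r i \<le> diameter (curve_image C) \<longrightarrow>
        (\<exists>u>0. \<forall>l\<^sub>0>0. \<exists>l. 0 < l \<and> l \<le> l\<^sub>0 \<and> energy_le (s j) l u (curve_image C))"
        using r[of i] by (intro scaling_limit_energy_le[OF rcs lim r s(1)] energy s) auto
    qed
    moreover have "AE F in \<nu>. F \<in> space \<nu>" by simp
    ultimately show ?thesis
    proof eventually_elim
      case (elim F)
      show ?case
      proof (intro ballI impI)
        fix C assume C: "C \<in> F" and d: "0 < diameter (curve_image C)"
        have "sets \<nu> = sets (config_borel \<Lambda>)" using lim by (simp add: scaling_limit_def)
        then have "F \<in> configs \<Lambda>" using elim(2) sets_eq_imp_space_eq space_config_borel by metis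
        then have Cc: "C \<in> curves \<Lambda>" using C by (auto simp: configs_def)
        obtain i where i: "r i < diameter (curve_image C)"
          using reals_Archimedean[OF d] by (auto simp: r_def inverse_eq_divide)
        show "ennreal dmin \<le> hausdorff_dim (curve_image C)"
          unfolding hausdorff_dim_def
        proof (rule INF_greatest, clarify, rule ennreal_leI, rule ccontr)
          fix t assume t: "0 < t" "hausdorff_measure t (curve_image C) = 0" "\<not> dmin \<le> t"
          have "s \<longlonglongrightarrow> dmin * (1 - 0)"
            unfolding s_def by (intro tendsto_intros LIMSEQ_Suc[OF LIMSEQ_Suc[OF lim_1_over_n]])
          then have "\<forall>\<^sub>F j in sequentially. t < s j" using t(3) by (intro order_tendstoD(1)) auto
          then obtain j where j: "t < s j" by (auto simp: eventually_sequentially)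
          obtain u where u: "0 < u" "\<And>l\<^sub>0. 0 < l\<^sub>0 \<Longrightarrow> \<exists>l. 0 < l \<and> l \<le> l\<^sub>0 \<and> energy_le (s j) l u (curve_image C)"
            using elim(1) C i by (meson less_imp_le)
          \<comment> \<open>The energy bound at \<open>s j\<close> passes down to the exponent
            \<open>t\<close> at the cost of the additive constant 1.\<close>
          have "hausdorff_measure t (curve_image C) \<noteq> 0"
          proof (rule hausdorff_measure_pos_of_energy_le[OF compact_curve_image[OF Cc] t(1), of "1 + u"])
            fix l\<^sub>0 :: real assume "0 < l\<^sub>0"
            then obtain l where "0 < l" "l \<le> l\<^sub>0" "energy_le (s j) l u (curve_image C)" using u(2) by blast
            then show "\<exists>l. 0 < l \<and> l \<le> l\<^sub>0 \<and> energy_le t l (1 + u) (curve_image C)"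
              using energy_le_lower_exponent[of t "s j" l u] t(1) j u(1) by auto
          qed (use u in simp)
          then show False using t(2) by simp
        qed
      qed
    qed
  qed
  have rect: "AE F in \<nu>. \<forall>C\<in>F. 0 < diameter (curve_image C) \<longrightarrow> \<not> rectifiable_curve C"
    if lim: "scaling_limit \<Lambda> \<mu> \<nu>" for \<nu>
  proof -
    have "AE F in \<nu>. F \<in> space \<nu>" by simp
    with dim[OF lim] show ?thesis
    proof eventually_elim
      case (elim F)
      show ?case
      proof (intro ballI impI notI)
        fix C assume C: "C \<in> F" and d: "0 < diameter (curve_image C)" and rect: "rectifiable_curve C"
        have "sets \<nu> = sets (config_borel \<Lambda>)" using lim by (simp add: scaling_limit_def)
        then have "F \<in> configs \<Lambda>" using elim(2) sets_eq_imp_space_eq space_config_borel by metis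
        then have Cc: "C \<in> curves \<Lambda>" using C by (auto simp: configs_def)
        \<comment> \<open>Any exponent strictly between 1 and \<open>dmin\<close> separates the two
          cases: the measure of a rectifiable curve vanishes there, so its dimension is at most
          \<open>t\<close>.\<close>
        define t where "t = (1 + dmin) / 2"
        have t: "1 < t" "t < dmin" using dmin by (auto simp: t_def)
        have "hausdorff_dim (curve_image C) \<le> ennreal t"
          unfolding hausdorff_dim_def
          using t rectifiable_imp_hausdorff_measure_0[OF Cc rect t(1)] by (intro INF_lower) auto
        then have "ennreal dmin \<le> ennreal t" using elim(1) C d by (meson order_trans)
        then show False using t by simp
      qed
    qed
  qed
  show ?thesis
    by (rule exI[of _ dmin], intro conjI allI impI dmin cap dim rect) auto
qed

end
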